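(* Let $s\in\mathcal{N}$ be a geometric point. Then the automorphism group of $s$ acts faithfully on the tangent space $\mathrm{T}_s\mathcal{N}$, i.e. the homomorphism $\mathrm{Aut}_{\mathcal{N}}(s)\to\mathrm{GL}(\mathrm{T}_s\mathcal{N})$ is injective.
   Context: Let $k$ be an algebraically closed field of characteristic $0$, and let $V$ and $W$ be $k$-vector spaces of dimensions $5$ and $10$; $\mathbf{P}=\mathbf{P}(W)$ is the projective space of lines in $W$. Fix an isomorphism $\phi\colon \wedge^2V\xrightarrow{\sim}W$ and let $\mathrm{Gr}\subset\mathbf{P}$ be the corresponding Pl\"ucker-embedded Grassmannian $\mathrm{Gr}(2,V)$ of $2$-dimensional subspaces of $V$. Let $G=\mathrm{PGL}(W)$ and $H=\mathrm{PGL}(V)$, with the embedding $H\to G$ induced by $A\mapsto \phi\circ\wedge^2A\circ\phi^{-1}$. For $g_1,g_2\in G$ let $X_{g_1,g_2}=g_1\mathrm{Gr}\cap g_2\mathrm{Gr}\subset\mathbf{P}$ (scheme-theoretic intersection), which depends only on the cosets $g_1H,g_2H$. Let $U\subset G/H\times G/H$ be the open subscheme over which the fibers $X_{g_1,g_2}$ are smooth of dimension $3$. The group $\mathbf{Z}/2\times G$ acts on $U$ on the left, $\mathbf{Z}/2$ by swapping the two factors and $G$ by left multiplication on both factors. The moduli stack of GPK$^3$ data is the quotient stack $\mathcal{N}=[(\mathbf{Z}/2\times G)\backslash U]$; it is a smooth Deligne--Mumford stack over $k$. *)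

theory Defs
  imports
    "HOL-Algebra.Elementary_Groups"
    "HOL-Algebra.Left_Coset"
    "HOL-Algebra.Bij"
    "HOL-Library.Poly_Mapping"
    "HOL-Computational_Algebra.Polynomial"
    "HOL-Analysis.Analysis"
begin

section \<open>Square-zero extensions\<close>

text \<open>
  \<open>('a, 'n) sqz\<close> is the ring \<open>a[e\<^sub>i | i \<in> n] / (e\<^sub>i e\<^sub>j | i, j \<in> n)\<close>, with \<open>Sqz c v\<close> denoting
  \<open>c + (\<Sum>i. v\<^sub>i e\<^sub>i)\<close>.  For \<open>'n = 1\<close> these are the dual numbers, which define tangent vectors;
  the case \<open>'n = 2\<close> is used to add tangent vectors.
\<close>

datatype ('a, 'n) sqz = Sqz (sqz_base: 'a) (sqz_eps: "'a ^ 'n")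

instantiation sqz :: (comm_ring_1, finite) comm_ring_1
begin

definition "0 = Sqz 0 0"
definition "1 = Sqz 1 0"
definition "x + y = Sqz (sqz_base x + sqz_base y) (sqz_eps x + sqz_eps y)"
definition "x - y = Sqz (sqz_base x - sqz_base y) (sqz_eps x - sqz_eps y)"
definition "- x = Sqz (- sqz_base x) (- sqz_eps x)"
definition "x * y = Sqz (sqz_base x * sqz_base y) (sqz_base x *s sqz_eps y + sqz_base y *s sqz_eps x)"

instance
  by standard
    (auto simp: zero_sqz_def one_sqz_def plus_sqz_def minus_sqz_def uminus_sqz_def times_sqz_def
      vec_eq_iff algebra_simps)

end

definition sqz_const :: "'a::comm_ring_1 \<Rightarrow> ('a, 'n::finite) sqz" where
  "sqz_const c = Sqz c 0"

definition sqz_map :: "('a ^ 'm \<Rightarrow> 'a ^ 'n) \<Rightarrow> ('a, 'm::finite) sqz \<Rightarrow> ('a, 'n::finite) sqz" where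
  "sqz_map L x = Sqz (sqz_base x) (L (sqz_eps x))"

definition is_ring_hom :: "('a::comm_ring_1 \<Rightarrow> 'b::comm_ring_1) \<Rightarrow> bool" where
  "is_ring_hom f \<longleftrightarrow> f 1 = 1 \<and> (\<forall>x y. f (x + y) = f x + f y) \<and> (\<forall>x y. f (x * y) = f x * f y)"


section \<open>Closed subschemes of projective space\<close>

text \<open>
  A point of projective space is given by any nonzero vector on the corresponding line, and a set
  of points by the set of all such vectors.  A set of homogeneous polynomials in \<open>'n\<close> variables
  defines a closed subscheme, namely the one of the homogeneous ideal it generates.
\<close>

type_synonym ('n, 'a) mpoly = "('n \<Rightarrow>\<^sub>0 nat) \<Rightarrow>\<^sub>0 'a"

definition mpoly_eval :: "('n::finite, 'a::comm_ring_1) mpoly \<Rightarrow> 'a ^ 'n \<Rightarrow> 'a" where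
  "mpoly_eval F w =
    (\<Sum>m\<in>Poly_Mapping.keys F. Poly_Mapping.lookup F m * (\<Prod>j\<in>UNIV. w $ j ^ Poly_Mapping.lookup m j))"

text \<open>The value at \<open>w\<close> of the formal partial derivative of \<open>F\<close> with respect to the variable \<open>i\<close>.\<close>

definition mpoly_partial :: "'n::finite \<Rightarrow> ('n, 'a::comm_ring_1) mpoly \<Rightarrow> 'a ^ 'n \<Rightarrow> 'a" where
  "mpoly_partial i F w =
    (\<Sum>m\<in>Poly_Mapping.keys F. Poly_Mapping.lookup F m * of_nat (Poly_Mapping.lookup m i) *
      (\<Prod>j\<in>UNIV. w $ j ^ (Poly_Mapping.lookup m j - (if j = i then 1 else 0))))"

definition homogeneous :: "('n::finite, 'a::comm_ring_1) mpoly \<Rightarrow> bool" where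
  "homogeneous F \<longleftrightarrow>
    (\<exists>d. \<forall>m\<in>Poly_Mapping.keys F. (\<Sum>j\<in>UNIV. Poly_Mapping.lookup m j) = d)"

definition proj_zeros :: "('n::finite, 'a::comm_ring_1) mpoly set \<Rightarrow> ('a ^ 'n) set" where
  "proj_zeros S = {w. w \<noteq> 0 \<and> (\<forall>F\<in>S. mpoly_eval F w = 0)}"

definition homog_ideal_gens :: "('a ^ 'n) set \<Rightarrow> ('n::finite, 'a::comm_ring_1) mpoly set" where
  "homog_ideal_gens C = {F. homogeneous F \<and> (\<forall>w\<in>C. mpoly_eval F w = 0)}"

definition zariski_closed :: "('a::comm_ring_1 ^ 'n::finite) set \<Rightarrow> bool" where
  "zariski_closed Z \<longleftrightarrow> (\<exists>S. (\<forall>F\<in>S. homogeneous F) \<and> Z = proj_zeros S)"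

definition zariski_irreducible :: "('a::comm_ring_1 ^ 'n::finite) set \<Rightarrow> bool" where
  "zariski_irreducible Z \<longleftrightarrow> zariski_closed Z \<and> Z \<noteq> {} \<and>
    (\<forall>A B. zariski_closed A \<longrightarrow> zariski_closed B \<longrightarrow> Z = A \<union> B \<longrightarrow> Z = A \<or> Z = B)"

definition irreducible_chain_at :: "('a::comm_ring_1 ^ 'n::finite) set \<Rightarrow> 'a ^ 'n \<Rightarrow> nat \<Rightarrow> bool" where
  "irreducible_chain_at X w d \<longleftrightarrow>
    (\<exists>Z. (\<forall>i\<le>d. zariski_irreducible (Z i) \<and> w \<in> Z i \<and> Z i \<subseteq> X) \<and> (\<forall>i<d. Z i \<subset> Z (Suc i)))"

text \<open>The Krull dimension of the local ring at the point \<open>w\<close> equals \<open>d\<close>.\<close>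

definition has_local_dim :: "('a::comm_ring_1 ^ 'n::finite) set \<Rightarrow> 'a ^ 'n \<Rightarrow> nat \<Rightarrow> bool" where
  "has_local_dim X w d \<longleftrightarrow>
    irreducible_chain_at X w d \<and> (\<forall>e. irreducible_chain_at X w e \<longrightarrow> e \<le> d)"

text \<open>
  The tangent space at \<open>w\<close> of the affine cone; the Zariski tangent space of the projective
  scheme is its quotient by the line spanned by \<open>w\<close>.
\<close>

definition cone_tangent_space ::
    "('n::finite, 'a::field) mpoly set \<Rightarrow> 'a ^ 'n \<Rightarrow> ('a ^ 'n) set" where
  "cone_tangent_space S w = {v. \<forall>F\<in>S. (\<Sum>i\<in>UNIV. mpoly_partial i F w * v $ i) = 0}"

text \<open>
  Over an algebraically closed field: the scheme is nonempty and, at each closed point, the Zariski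
  tangent space and the local ring both have dimension \<open>d\<close> (so that the local ring is regular).
\<close>

definition smooth_of_dim :: "nat \<Rightarrow> ('n::finite, 'a::field) mpoly set \<Rightarrow> bool" where
  "smooth_of_dim d S \<longleftrightarrow> proj_zeros S \<noteq> {} \<and>
    (\<forall>w\<in>proj_zeros S. vec.dim (cone_tangent_space S w) = d + 1 \<and> has_local_dim (proj_zeros S) w d)"


section \<open>The second exterior power\<close>

text \<open>
  With \<open>V = R\<^sup>5\<close>, the exterior square of \<open>V\<close> is realised inside \<open>V \<otimes> V\<close>, i.e. as the module of
  alternating \<open>5 \<times> 5\<close>-matrices, by \<open>u \<and> v = u \<otimes> v - v \<otimes> u\<close>.  The space \<open>W\<close> is \<open>R\<^sup>1\<^sup>0\<close>.
\<close>

definition ext2 :: "('r::comm_ring_1 ^ 5 ^ 5) set" where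
  "ext2 = {M. (\<forall>i. M $ i $ i = 0) \<and> (\<forall>i j. M $ i $ j = - M $ j $ i)}"

definition wedge :: "'r::comm_ring_1 ^ 5 \<Rightarrow> 'r ^ 5 \<Rightarrow> 'r ^ 5 ^ 5" where
  "wedge u v = (\<chi> i j. u $ i * v $ j - v $ i * u $ j)"

definition ext2_map :: "'r::comm_ring_1 ^ 5 ^ 5 \<Rightarrow> 'r ^ 5 ^ 5 \<Rightarrow> 'r ^ 5 ^ 5" where
  "ext2_map A M = A ** M ** transpose A"

definition ext2_iso :: "('k::field ^ 5 ^ 5 \<Rightarrow> 'k ^ 10) \<Rightarrow> bool" where
  "ext2_iso \<phi> \<longleftrightarrow> bij_betw \<phi> ext2 UNIV \<and>
    (\<forall>M\<in>ext2. \<forall>N\<in>ext2. \<phi> (M + N) = \<phi> M + \<phi> N) \<and>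
    (\<forall>c. \<forall>M\<in>ext2. \<phi> (\<chi> i j. c * M $ i $ j) = c *s \<phi> M)"

text \<open>The base change of \<open>\<phi>\<close> along a ring homomorphism \<open>f\<close>.\<close>

definition phi_bc :: "('k::field ^ 5 ^ 5 \<Rightarrow> 'k ^ 10) \<Rightarrow> ('k \<Rightarrow> 'r::comm_ring_1) \<Rightarrow>
    'r ^ 5 ^ 5 \<Rightarrow> 'r ^ 10" where
  "phi_bc \<phi> f M = (\<chi> r. \<Sum>(i, j)\<in>{(i, j). i < j}.
     M $ i $ j * f (\<phi> (wedge (axis i 1) (axis j 1)) $ r))"


section \<open>The groups \<open>G\<close> and \<open>H\<close> and the space \<open>G/H\<close>\<close>

text \<open>
  All functors below are evaluated only on algebraically closed fields and their square-zero
  extensions \<open>R\<close>.  Over such rings line bundles and \<open>H\<close>-torsors are trivial, so that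
  \<open>PGL\<^sub>n(R) = GL\<^sub>n(R) / R\<^sup>\<times>\<close> and \<open>(G/H)(R) = G(R) / H(R)\<close>.  Throughout, \<open>f\<close> is the structure
  map from the base field \<open>k\<close> to \<open>R\<close>.
\<close>

definition GLn :: "('r::comm_ring_1 ^ 'n::finite ^ 'n) monoid" where
  "GLn = \<lparr>carrier = {A. invertible A}, monoid.mult = (**), one = mat 1\<rparr>"

definition scalar_matrices :: "('r::comm_ring_1 ^ 'n::finite ^ 'n) set" where
  "scalar_matrices = {mat c | c. c dvd 1}"

definition PGLn :: "('r::comm_ring_1 ^ 'n::finite ^ 'n) set monoid" where
  "PGLn = GLn Mod scalar_matrices"

text \<open>The image of \<open>H(R)\<close> in \<open>G(R)\<close>: the classes of \<open>\<phi> \<circ> \<and>\<^sup>2A \<circ> \<phi>\<^sup>-\<^sup>1\<close>.\<close>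

definition H_subgroup :: "('k::field ^ 5 ^ 5 \<Rightarrow> 'k ^ 10) \<Rightarrow> ('k \<Rightarrow> 'r::comm_ring_1) \<Rightarrow>
    ('r ^ 10 ^ 10) set set" where
  "H_subgroup \<phi> f = {scalar_matrices #>\<^bsub>GLn\<^esub> B | B. B \<in> carrier GLn \<and>
     (\<exists>A\<in>carrier GLn. \<forall>M\<in>ext2. B *v phi_bc \<phi> f M = phi_bc \<phi> f (ext2_map A M))}"

type_synonym 'r coset_pt = "('r ^ 10 ^ 10) set set"

definition GmodH :: "('k::field ^ 5 ^ 5 \<Rightarrow> 'k ^ 10) \<Rightarrow> ('k \<Rightarrow> 'r::comm_ring_1) \<Rightarrow> 'r coset_pt set" where
  "GmodH \<phi> f = lcosets\<^bsub>PGLn\<^esub> (H_subgroup \<phi> f)"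

text \<open>The group \<open>\<int>/2 \<times> G\<close> and its action on \<open>G/H \<times> G/H\<close>.\<close>

type_synonym 'r swapG = "int \<times> ('r ^ 10 ^ 10) set"

definition swapG :: "'r::comm_ring_1 swapG monoid" where
  "swapG = integer_mod_group 2 \<times>\<times> PGLn"

definition swapG_act :: "'r::comm_ring_1 swapG \<Rightarrow> 'r coset_pt \<times> 'r coset_pt \<Rightarrow>
    'r coset_pt \<times> 'r coset_pt" where
  "swapG_act = (\<lambda>(\<sigma>, a) (x, y).
     if \<sigma> = 0 then (a <#\<^bsub>PGLn\<^esub> x, a <#\<^bsub>PGLn\<^esub> y) else (a <#\<^bsub>PGLn\<^esub> y, a <#\<^bsub>PGLn\<^esub> x))"

text \<open>
  Functoriality with respect to a ring homomorphism \<open>h\<close>.  When \<open>h\<close> is not surjective, the image of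
  a class of matrices modulo scalars (or of a coset of \<open>H\<close>) is only part of such a class over the
  target ring, and has to be saturated.
\<close>

definition PGL_map :: "('r \<Rightarrow> 's) \<Rightarrow> ('r::comm_ring_1 ^ 'n::finite ^ 'n) set \<Rightarrow>
    ('s::comm_ring_1 ^ 'n ^ 'n) set" where
  "PGL_map h a = scalar_matrices <#>\<^bsub>GLn\<^esub> (map_matrix h ` a)"

definition swapG_map :: "('r \<Rightarrow> 's) \<Rightarrow> 'r::comm_ring_1 swapG \<Rightarrow> 's::comm_ring_1 swapG" where
  "swapG_map h = (\<lambda>(\<sigma>, a). (\<sigma>, PGL_map h a))"

text \<open>Here \<open>f\<close> is the structure map of the target ring of \<open>h\<close>.\<close>

definition pair_map :: "('k::field ^ 5 ^ 5 \<Rightarrow> 'k ^ 10) \<Rightarrow> ('k \<Rightarrow> 's) \<Rightarrow> ('r \<Rightarrow> 's) \<Rightarrow>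
    'r::comm_ring_1 coset_pt \<times> 'r coset_pt \<Rightarrow> 's::comm_ring_1 coset_pt \<times> 's coset_pt" where
  "pair_map \<phi> f h = (\<lambda>(x, y).
     ((PGL_map h ` x) <#>\<^bsub>PGLn\<^esub> H_subgroup \<phi> f, (PGL_map h ` y) <#>\<^bsub>PGLn\<^esub> H_subgroup \<phi> f))"


section \<open>The open set \<open>U\<close>\<close>

text \<open>
  The affine cone over \<open>g Gr\<close>.  An element \<open>g\<close> of \<open>G\<close> is a class of matrices modulo scalars, and
  \<open>wedge u v\<close> is zero precisely when \<open>u\<close> and \<open>v\<close> do not span a plane.
\<close>

definition Gr_cone :: "('k::field ^ 5 ^ 5 \<Rightarrow> 'k ^ 10) \<Rightarrow> ('k \<Rightarrow> 'r::field) \<Rightarrow>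
    ('r ^ 10 ^ 10) set \<Rightarrow> ('r ^ 10) set" where
  "Gr_cone \<phi> f g = {A *v phi_bc \<phi> f (wedge u v) | A u v. A \<in> g}"

text \<open>Equations for the scheme-theoretic intersection \<open>g\<^sub>1 Gr \<inter> g\<^sub>2 Gr\<close>.\<close>

definition X_eqs :: "('k::field ^ 5 ^ 5 \<Rightarrow> 'k ^ 10) \<Rightarrow> ('k \<Rightarrow> 'r::field) \<Rightarrow>
    ('r ^ 10 ^ 10) set \<Rightarrow> ('r ^ 10 ^ 10) set \<Rightarrow> (10, 'r) mpoly set" where
  "X_eqs \<phi> f g1 g2 = homog_ideal_gens (Gr_cone \<phi> f g1) \<union> homog_ideal_gens (Gr_cone \<phi> f g2)"

definition U_pts :: "('k::field ^ 5 ^ 5 \<Rightarrow> 'k ^ 10) \<Rightarrow> ('k \<Rightarrow> 'r::field) \<Rightarrow>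
    ('r coset_pt \<times> 'r coset_pt) set" where
  "U_pts \<phi> f = {(g1 <#\<^bsub>PGLn\<^esub> H_subgroup \<phi> f, g2 <#\<^bsub>PGLn\<^esub> H_subgroup \<phi> f) | g1 g2.
     g1 \<in> carrier PGLn \<and> g2 \<in> carrier PGLn \<and> smooth_of_dim 3 (X_eqs \<phi> f g1 g2)}"

text \<open>Points of \<open>U\<close> over a square-zero extension: as \<open>U\<close> is open, the condition is on the reduction.\<close>

definition U_sqz :: "('k::field ^ 5 ^ 5 \<Rightarrow> 'k ^ 10) \<Rightarrow> ('k \<Rightarrow> 'r::field) \<Rightarrow>
    (('r, 'n::finite) sqz coset_pt \<times> ('r, 'n) sqz coset_pt) set" where
  "U_sqz \<phi> f = {t \<in> GmodH \<phi> (sqz_const \<circ> f) \<times> GmodH \<phi> (sqz_const \<circ> f).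
     pair_map \<phi> f sqz_base t \<in> U_pts \<phi> f}"


section \<open>The quotient stack\<close>

text \<open>
  Over an algebraically closed field or a square-zero extension of one, all torsors under
  \<open>\<int>/2 \<times> G\<close> are trivial, so the groupoid of points of the quotient stack is the action groupoid of
  \<open>(\<int>/2 \<times> G)(R)\<close> on \<open>U(R)\<close>.
\<close>

definition isoms :: "'r::comm_ring_1 coset_pt \<times> 'r coset_pt \<Rightarrow> 'r coset_pt \<times> 'r coset_pt \<Rightarrow>
    'r swapG set" where
  "isoms x y = {\<gamma> \<in> carrier swapG. swapG_act \<gamma> x = y}"

definition Aut_grp :: "'r::comm_ring_1 coset_pt \<times> 'r coset_pt \<Rightarrow> 'r swapG monoid" where
  "Aut_grp s = swapG\<lparr>carrier := isoms s s\<rparr>"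

text \<open>
  The tangent space of the stack at \<open>s\<close> is the set of isomorphism classes of pairs \<open>(t, \<gamma>)\<close>, where
  \<open>t\<close> is an object over the dual numbers and \<open>\<gamma>\<close> is an isomorphism from the reduction of \<open>t\<close> to \<open>s\<close>.
  More generally, \<open>tangent\<close> with \<open>'n\<close> in place of \<open>1\<close> is the set of isomorphism classes of
  deformations of \<open>s\<close> over \<open>('r, 'n) sqz\<close>.
\<close>

type_synonym ('r, 'n) deform = "(('r, 'n) sqz coset_pt \<times> ('r, 'n) sqz coset_pt) \<times> 'r swapG"

definition deforms :: "('k::field ^ 5 ^ 5 \<Rightarrow> 'k ^ 10) \<Rightarrow> ('k \<Rightarrow> 'r::field) \<Rightarrow>
    'r coset_pt \<times> 'r coset_pt \<Rightarrow> ('r, 'n::finite) deform set" where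
  "deforms \<phi> f s = {(t, \<gamma>). t \<in> U_sqz \<phi> f \<and> \<gamma> \<in> isoms (pair_map \<phi> f sqz_base t) s}"

definition deform_iso :: "('k::field ^ 5 ^ 5 \<Rightarrow> 'k ^ 10) \<Rightarrow> ('k \<Rightarrow> 'r::field) \<Rightarrow>
    'r coset_pt \<times> 'r coset_pt \<Rightarrow> (('r, 'n::finite) deform \<times> ('r, 'n) deform) set" where
  "deform_iso \<phi> f s = {((t, \<gamma>), (t', \<gamma>')). (t, \<gamma>) \<in> deforms \<phi> f s \<and> (t', \<gamma>') \<in> deforms \<phi> f s \<and>
     (\<exists>\<delta>\<in>isoms t t'. \<gamma>' \<otimes>\<^bsub>swapG\<^esub> swapG_map sqz_base \<delta> = \<gamma>)}"

definition tangent :: "('k::field ^ 5 ^ 5 \<Rightarrow> 'k ^ 10) \<Rightarrow> ('k \<Rightarrow> 'r::field) \<Rightarrow>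
    'r coset_pt \<times> 'r coset_pt \<Rightarrow> ('r, 'n::finite) deform set set" where
  "tangent \<phi> f s = deforms \<phi> f s // deform_iso \<phi> f s"

text \<open>The map induced by the ring homomorphism \<open>sqz_map L\<close>, for \<open>L\<close> linear.\<close>

definition tangent_map :: "('k::field ^ 5 ^ 5 \<Rightarrow> 'k ^ 10) \<Rightarrow> ('k \<Rightarrow> 'r::field) \<Rightarrow>
    'r coset_pt \<times> 'r coset_pt \<Rightarrow> ('r ^ 'm \<Rightarrow> 'r ^ 'n) \<Rightarrow>
    ('r, 'm::finite) deform set \<Rightarrow> ('r, 'n::finite) deform set" where
  "tangent_map \<phi> f s L X = deform_iso \<phi> f s `` ((\<lambda>(t, \<gamma>). (pair_map \<phi> (sqz_const \<circ> f) (sqz_map L) t, \<gamma>)) ` X)"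

text \<open>
  The vector space structure of the tangent space: scaling is induced by \<open>e \<mapsto> c e\<close>, and the sum of
  \<open>X\<close> and \<open>Y\<close> is the image under \<open>e\<^sub>1, e\<^sub>2 \<mapsto> e\<close> of the deformation over \<open>('r, 2) sqz\<close>
  that restricts to \<open>X\<close> and \<open>Y\<close> under \<open>(e\<^sub>1, e\<^sub>2) \<mapsto> (e, 0)\<close> and \<open>(e\<^sub>1, e\<^sub>2) \<mapsto> (0, e)\<close>.
\<close>

definition tangent_smult :: "('k::field ^ 5 ^ 5 \<Rightarrow> 'k ^ 10) \<Rightarrow> ('k \<Rightarrow> 'r::field) \<Rightarrow>
    'r coset_pt \<times> 'r coset_pt \<Rightarrow> 'r \<Rightarrow> ('r, 1) deform set \<Rightarrow> ('r, 1) deform set" where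
  "tangent_smult \<phi> f s c = tangent_map \<phi> f s (\<lambda>v. c *s v)"

definition tangent_add :: "('k::field ^ 5 ^ 5 \<Rightarrow> 'k ^ 10) \<Rightarrow> ('k \<Rightarrow> 'r::field) \<Rightarrow>
    'r coset_pt \<times> 'r coset_pt \<Rightarrow>
    ('r, 1) deform set \<Rightarrow> ('r, 1) deform set \<Rightarrow> ('r, 1) deform set" where
  "tangent_add \<phi> f s X Y = (THE Z. \<exists>D\<in>tangent \<phi> f s.
     tangent_map \<phi> f s (\<lambda>v :: 'r ^ 2. \<chi> _. v $ 1) D = X \<and>
     tangent_map \<phi> f s (\<lambda>v :: 'r ^ 2. \<chi> _. v $ 2) D = Y \<and>
     tangent_map \<phi> f s (\<lambda>v :: 'r ^ 2. \<chi> _. v $ 1 + v $ 2) D = Z)"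

definition GL_tangent :: "('k::field ^ 5 ^ 5 \<Rightarrow> 'k ^ 10) \<Rightarrow> ('k \<Rightarrow> 'r::field) \<Rightarrow>
    'r coset_pt \<times> 'r coset_pt \<Rightarrow> (('r, 1) deform set \<Rightarrow> ('r, 1) deform set) monoid" where
  "GL_tangent \<phi> f s = BijGroup (tangent \<phi> f s)
     \<lparr>carrier := {h \<in> Bij (tangent \<phi> f s).
        (\<forall>X\<in>tangent \<phi> f s. \<forall>Y\<in>tangent \<phi> f s.
          h (tangent_add \<phi> f s X Y) = tangent_add \<phi> f s (h X) (h Y)) \<and>
        (\<forall>c. \<forall>X\<in>tangent \<phi> f s. h (tangent_smult \<phi> f s c X) = tangent_smult \<phi> f s c (h X))}\<rparr>"

definition tangent_rep :: "('k::field ^ 5 ^ 5 \<Rightarrow> 'k ^ 10) \<Rightarrow> ('k \<Rightarrow> 'r::field) \<Rightarrow>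
    'r coset_pt \<times> 'r coset_pt \<Rightarrow> 'r swapG \<Rightarrow> ('r, 1) deform set \<Rightarrow> ('r, 1) deform set" where
  "tangent_rep \<phi> f s \<alpha> = (\<lambda>X\<in>tangent \<phi> f s. (\<lambda>(t, \<gamma>). (t, \<alpha> \<otimes>\<^bsub>swapG\<^esub> \<gamma>)) ` X)"

end

theory Submission
  imports Defs
begin

text \<open>
  Represent a geometric point \<open>s\<close> by two matrices \<open>g\<^sub>1, g\<^sub>2\<close>, write \<open>gl(W)\<close> for the
  \<open>10 \<times> 10\<close>-matrices, and let \<open>l\<^sub>i = g\<^sub>i D(gl(V)) g\<^sub>i\<^sup>-\<^sup>1\<close>, where \<open>D(Z)\<close> is the derivation
  \<open>u \<and> v \<mapsto> Zu \<and> v + u \<and> Zv\<close>; this is the set \<open>stab_alg\<close>.  It contains the scalars and maps onto the Lie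
  algebra of the stabiliser of the \<open>i\<close>-th coset.  Every first-order deformation of \<open>s\<close> is isomorphic to
  one in which \<open>g\<^sub>1\<close> is replaced by \<open>(1 + eX) g\<^sub>1\<close> and \<open>g\<^sub>2\<close> is kept, and \<open>X\<close> matters only modulo
  \<open>l\<^sub>1 + l\<^sub>2\<close> (\<open>tangent_eq\<close>, \<open>tangent_vec_eq_iff\<close>).  So the tangent space is \<open>gl(W) / (l\<^sub>1 + l\<^sub>2)\<close>, and this
  also holds for its vector space structure.  An automorphism given by a matrix \<open>a\<close> acts by
  \<open>X \<mapsto> a X a\<^sup>-\<^sup>1\<close> if it fixes both cosets and by \<open>X \<mapsto> - a X a\<^sup>-\<^sup>1\<close> if it exchanges them
  (\<open>tangent_rep_tangent_vec\<close>).  Thus faithfulness becomes a statement about matrices, decided by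
  counting dimensions: each \<open>l\<^sub>i\<close> has dimension at most \<open>25\<close>.

  Suppose first that \<open>a\<close> fixes both cosets and acts trivially, so that \<open>a X a\<^sup>-\<^sup>1 - X \<in> l\<^sub>1 + l\<^sub>2\<close> for all
  \<open>X\<close> (\<open>trivial_action_scalar\<close>).  After a change of coordinates \<open>g\<^sub>1 = 1\<close>, and \<open>a = \<and>\<^sup>2A\<close> up to a
  scalar.  If \<open>A\<close> is not a scalar, then some vector and its image under \<open>A\<close> are
  independent, and in a basis that starts with them \<open>A e\<^sub>1 = e\<^sub>2\<close>.  Let \<open>q\<close> range over the
  \<open>30\<close>-dimensional space of linear maps from \<open>W\<close> to \<open>e\<^sub>1 \<and> \<langle>e\<^sub>3, e\<^sub>4, e\<^sub>5\<rangle>\<close>.  Since \<open>l\<^sub>1\<close> and \<open>l\<^sub>2\<close> share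
  the scalars, \<open>(l\<^sub>1 + l\<^sub>2) / l\<^sub>1\<close> has dimension at most \<open>24\<close>, so that \<open>a q a\<^sup>-\<^sup>1 - q\<close> is
  of the form \<open>D(Z)\<close> for all \<open>q\<close> in a space of dimension at least \<open>6\<close>.  For such \<open>q\<close> the image of
  \<open>Z\<close> lies in \<open>\<langle>e\<^sub>1, e\<^sub>2\<rangle>\<close>, and \<open>q\<close> is determined by the \<open>e\<^sub>2\<close>-component of \<open>Z\<close>, a linear form on
  \<open>V\<close> (\<open>wedge_op_in_stab_trivial\<close>).  Hence there is only a space of dimension at most \<open>5\<close> of them,
  a contradiction.

  Now suppose that \<open>a\<close> exchanges the two cosets and acts trivially (\<open>swap_acts_nontrivially\<close>).  Then
  \<open>a\<^sup>2\<close> fixes both cosets and acts trivially, so it is a scalar, and \<open>a\<^sup>2 = 1\<close> after rescaling.  If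
  \<open>X\<close> commutes with \<open>a\<close>, triviality of the action says \<open>- 2X \<in> l\<^sub>1 + l\<^sub>2\<close>; as conjugation by \<open>a\<close>
  exchanges \<open>l\<^sub>1\<close> and \<open>l\<^sub>2\<close>, averaging gives \<open>X = m + a m a\<close> with \<open>m \<in> l\<^sub>1\<close>.  So the centraliser of
  \<open>a\<close> has dimension at most \<open>25\<close>.  But if the eigenspaces of \<open>a\<close> have dimensions \<open>p\<close> and
  \<open>10 - p\<close>, then the centraliser has dimension \<open>p\<^sup>2 + (10 - p)\<^sup>2 \<ge> 50\<close>.
\<close>

section \<open>Projective linear groups over a commutative ring\<close>

lemma mat_mult_entry: "(mat c ** A) $ i $ j = c * (A $ i $ j)" for A :: "'r::comm_ring_1 ^ 'm ^ 'n"
  unfolding matrix_matrix_mult_def mat_def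
  by (simp add: if_distrib if_distribR cong: if_cong)

lemma mult_mat_entry: "(A ** mat c) $ i $ j = c * (A $ i $ j)" for A :: "'r::comm_ring_1 ^ 'm ^ 'n"
  unfolding matrix_matrix_mult_def mat_def
  by (simp add: if_distrib if_distribR mult.commute cong: if_cong)

lemma mat_central: "A ** mat c = mat c ** A" for A :: "'r::comm_ring_1 ^ 'm ^ 'n"
  by (simp add: vec_eq_iff mat_mult_entry mult_mat_entry)

lemma mat_mult_mat: "mat c ** mat d = (mat (c * d) :: 'r::comm_ring_1 ^ 'n ^ 'n)"
  by (simp add: vec_eq_iff mat_mult_entry) (simp add: mat_def)

lemma mat_left_commute: "A ** (mat c ** B) = mat c ** (A ** B)"
  for A :: "'r::comm_ring_1 ^ 'm ^ 'n"
  by (metis mat_central matrix_mul_assoc)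

lemma unit_obtain_inverse:
  fixes c :: "'r::comm_ring_1"
  assumes "c dvd 1" obtains d where "c * d = 1" "d * c = 1" "d dvd 1"
  using assms by (metis dvd_def mult.commute)

lemma invertible_mat: "c dvd 1 \<Longrightarrow> invertible (mat c :: 'r::comm_ring_1 ^ 'n ^ 'n)"
  unfolding invertible_def by (metis mat_mult_mat unit_obtain_inverse)

lemma matrix_inv_right: "invertible A \<Longrightarrow> A ** matrix_inv A = mat 1"
  and matrix_inv_left: "invertible A \<Longrightarrow> matrix_inv A ** A = mat 1"
  for A :: "'r::comm_ring_1 ^ 'n ^ 'n"
  unfolding invertible_def matrix_inv_def by (metis (mono_tags, lifting) someI_ex)+

lemma invertible_matrix_inv: "invertible A \<Longrightarrow> invertible (matrix_inv A)"
  for A :: "'r::comm_ring_1 ^ 'n ^ 'n"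
  using matrix_inv_left matrix_inv_right unfolding invertible_def by blast

lemma matrix_inv_cancel:
  fixes A :: "'r::comm_ring_1 ^ 'n ^ 'n"
  assumes "invertible A"
  shows "A ** (matrix_inv A ** B) = B" "matrix_inv A ** (A ** B) = B"
    and "(C ** A) ** matrix_inv A = C" "(C ** matrix_inv A) ** A = C"
  using assms by (simp_all add: matrix_mul_assoc matrix_inv_left matrix_inv_right)
    (simp_all add: matrix_mul_assoc[symmetric] matrix_inv_left matrix_inv_right)

lemma invertible_mat_1 [simp]: "invertible (mat 1 :: 'r::comm_ring_1 ^ 'n ^ 'n)"
  by (simp add: invertible_mat)

lemma matrix_diff_distrib: "A ** (B - C) = A ** B - A ** C" "(B - C) ** D = B ** D - C ** D"
  for B C :: "'r::comm_ring_1 ^ 'n ^ 'm"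
  by (simp_all add: vec_eq_iff matrix_matrix_mult_def algebra_simps sum_subtractf)

lemma matrix_add_distrib: "A ** (B + C) = A ** B + A ** C" "(B + C) ** D = B ** D + C ** D"
  for B C :: "'r::comm_ring_1 ^ 'n ^ 'm"
  by (simp_all add: vec_eq_iff matrix_matrix_mult_def algebra_simps sum.distrib)

lemma sum_entry: "sum F S $ i $ j = (\<Sum>p\<in>S. F p $ i $ j)"
  by (induction S rule: infinite_finite_induct) auto

lemma unit_mult: "c dvd 1 \<Longrightarrow> d dvd 1 \<Longrightarrow> c * d dvd (1 :: 'r::comm_ring_1)"
  by (metis mult_dvd_mono mult_1)

lemma scaled_mult: "(mat c ** A) ** (mat d ** B) = mat (c * d) ** (A ** B)"
  for A B :: "'r::comm_ring_1 ^ 'n ^ 'n"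
proof -
  have "(mat c ** A) ** (mat d ** B) = mat c ** (A ** (mat d ** B))"
    by (simp add: matrix_mul_assoc)
  also have "A ** (mat d ** B) = mat d ** (A ** B)" by (rule mat_left_commute)
  finally show ?thesis by (simp add: matrix_mul_assoc mat_mult_mat)
qed

lemma scaled_matrix_vector_mult: "(mat c ** B) *v w = c *s (B *v w)" for B :: "'r::comm_ring_1 ^ 'n ^ 'm"
  by (simp add: vec_eq_iff matrix_vector_mult_def mat_mult_entry sum_distrib_left mult.assoc)

lemma uminus_as_scale: "- X = mat (- 1) ** X" for X :: "'r::comm_ring_1 ^ 'n ^ 'm"
  by (simp add: vec_eq_iff mat_mult_entry)

lemma matrix_inv_mult:
  fixes A B :: "'r::comm_ring_1 ^ 'n ^ 'n"
  assumes "invertible A" "invertible B"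
  shows "matrix_inv (A ** B) = matrix_inv B ** matrix_inv A"
proof -
  have "(A ** B) ** (matrix_inv B ** matrix_inv A) = mat 1"
    by (simp add: matrix_mul_assoc[symmetric] matrix_inv_cancel assms matrix_inv_right)
  then have "matrix_inv (A ** B) = matrix_inv (A ** B) ** ((A ** B) ** (matrix_inv B ** matrix_inv A))"
    by simp
  also have "\<dots> = matrix_inv B ** matrix_inv A"
    by (rule matrix_inv_cancel(2)[OF invertible_mult[OF assms]])
  finally show ?thesis .
qed

lemma matrix_inv_unique: "a ** b = mat 1 \<Longrightarrow> b ** a = mat 1 \<Longrightarrow> matrix_inv a = b"
  for a b :: "'r::comm_ring_1 ^ 'n ^ 'n"
  by (metis invertible_def matrix_inv_left matrix_mul_assoc matrix_mul_lid matrix_mul_rid)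

lemma conj_scaled: "A ** (mat d ** X) ** B = mat d ** (A ** X ** B)"
  for A :: "'r::comm_ring_1 ^ 'm ^ 'n"
  by (simp only: mat_left_commute[of A]) (simp only: matrix_mul_assoc)

lemma conj_mult:
  fixes a b g X :: "'r::comm_ring_1 ^ 'n ^ 'n"
  assumes "invertible g" "invertible a" "a ** g = g ** b"
  shows "a ** (g ** X ** matrix_inv g) ** matrix_inv a = g ** (b ** X ** matrix_inv b) ** matrix_inv g"
proof -
  have b: "b = matrix_inv g ** (a ** g)" using assms(3) by (simp add: matrix_inv_cancel[OF assms(1)])
  have "invertible b" unfolding b by (intro invertible_mult invertible_matrix_inv assms)
  have "matrix_inv g ** matrix_inv a = matrix_inv (g ** b)"
    using assms matrix_inv_mult by metis
  also have "\<dots> = matrix_inv b ** matrix_inv g"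
    using matrix_inv_mult[OF assms(1) \<open>invertible b\<close>] .
  finally have "matrix_inv g ** matrix_inv a = matrix_inv b ** matrix_inv g" .
  then have "g ** b ** X ** (matrix_inv g ** matrix_inv a) = g ** b ** X ** (matrix_inv b ** matrix_inv g)"
    by simp
  then show ?thesis by (simp add: matrix_mul_assoc assms(3))
qed

lemma conj_scale:
  fixes a X :: "'a::field ^ 'n ^ 'n"
  assumes "c \<noteq> 0" "invertible a"
  shows "(mat c ** a) ** X ** matrix_inv (mat c ** a) = a ** X ** matrix_inv a"
proof -
  have c: "invertible (mat c :: 'a ^ 'n ^ 'n)" using assms(1) by (intro invertible_mat) (simp add: dvd_field_iff)
  have "(mat c ** a) ** X ** matrix_inv (mat c ** a) = mat c ** (a ** X ** matrix_inv a) ** matrix_inv (mat c)"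
    by (simp add: matrix_inv_mult[OF c assms(2)] matrix_mul_assoc)
  also have "\<dots> = a ** X ** matrix_inv a ** mat c ** matrix_inv (mat c)"
    by (simp only: mat_central)
  finally show ?thesis by (simp add: matrix_inv_cancel(3)[OF c])
qed

lemma GLn_simps [simp]: "carrier GLn = {A. invertible A}" "A \<otimes>\<^bsub>GLn\<^esub> B = A ** B" "\<one>\<^bsub>GLn\<^esub> = mat 1"
  by (simp_all add: GLn_def)

lemma GLn_group: "group (GLn :: ('r::comm_ring_1 ^ 'n ^ 'n) monoid)"
proof (rule groupI)
  fix A :: "'r ^ 'n ^ 'n" assume "A \<in> carrier GLn"
  then show "\<exists>B\<in>carrier GLn. B \<otimes>\<^bsub>GLn\<^esub> A = \<one>\<^bsub>GLn\<^esub>"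
    using invertible_matrix_inv matrix_inv_left by auto
qed (auto simp: invertible_mult matrix_mul_assoc)

lemma scalar_matrices_normal: "scalar_matrices \<lhd> (GLn :: ('r::comm_ring_1 ^ 'n ^ 'n) monoid)"
proof -
  interpret group "GLn :: ('r ^ 'n ^ 'n) monoid" by (rule GLn_group)
  have "subgroup scalar_matrices (GLn :: ('r ^ 'n ^ 'n) monoid)"
  proof (rule subgroupI)
    show "scalar_matrices \<subseteq> carrier GLn"
      by (auto simp: scalar_matrices_def invertible_mat)
    show "(scalar_matrices :: ('r ^ 'n ^ 'n) set) \<noteq> {}"
      by (auto simp: scalar_matrices_def intro: dvd_refl)
  next
    fix a :: "'r ^ 'n ^ 'n" assume "a \<in> scalar_matrices"
    then obtain c where c: "a = mat c" "c dvd 1" by (auto simp: scalar_matrices_def)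
    then obtain d where d: "c * d = 1" "d * c = 1" "d dvd 1" by (metis unit_obtain_inverse)
    have "inv\<^bsub>GLn\<^esub> a = mat d"
      using c d by (intro inv_equality) (auto simp: mat_mult_mat invertible_mat)
    then show "inv\<^bsub>GLn\<^esub> a \<in> scalar_matrices"
      using d by (auto simp: scalar_matrices_def)
  next
    fix a b :: "'r ^ 'n ^ 'n" assume "a \<in> scalar_matrices" "b \<in> scalar_matrices"
    then show "a \<otimes>\<^bsub>GLn\<^esub> b \<in> scalar_matrices"
      by (auto simp: scalar_matrices_def mat_mult_mat) (metis mult_dvd_mono mult_1)
  qed
  then show ?thesis
    by (rule normalI) (auto simp: r_coset_def l_coset_def scalar_matrices_def mat_central)
qed

lemma PGLn_group: "group (PGLn :: ('r::comm_ring_1 ^ 'n ^ 'n) set monoid)"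
  unfolding PGLn_def by (rule normal.factorgroup_is_group[OF scalar_matrices_normal])

text \<open>
  The point of \<open>PGLn\<close> given by a matrix; representatives make it possible to compute with matrices
  instead of sets of sets of matrices.
\<close>

definition pclass :: "'r::comm_ring_1 ^ 'n ^ 'n \<Rightarrow> ('r ^ 'n ^ 'n) set" where
  "pclass B = scalar_matrices #>\<^bsub>GLn\<^esub> B"

lemma pclass_eq: "pclass B = {mat c ** B | c. c dvd 1}"
  by (auto simp: pclass_def r_coset_def scalar_matrices_def)

lemma pclass_eq_iff: "pclass B = pclass C \<longleftrightarrow> (\<exists>c. c dvd 1 \<and> C = mat c ** B)"
proof
  assume "pclass B = pclass C"
  moreover have "C \<in> pclass C" by (auto simp: pclass_eq intro!: exI[of _ 1])
  ultimately show "\<exists>c. c dvd 1 \<and> C = mat c ** B" by (auto simp: pclass_eq)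
next
  assume "\<exists>c. c dvd 1 \<and> C = mat c ** B"
  then obtain c where c: "c dvd 1" "C = mat c ** B" by auto
  then obtain d where d: "c * d = 1" "d * c = 1" "d dvd 1" by (metis unit_obtain_inverse)
  have "B = mat d ** C" using c d by (simp add: matrix_mul_assoc mat_mult_mat)
  have *: "x * y dvd 1" if "x dvd 1" "y dvd 1" for x y :: 'a using that by (metis mult_dvd_mono mult_1)
  have "mat e ** C \<in> pclass B" if "e dvd 1" for e
    using c *[OF that c(1)] by (auto simp: pclass_eq matrix_mul_assoc mat_mult_mat)
  moreover have "mat e ** B \<in> pclass C" if "e dvd 1" for e
    using \<open>B = mat d ** C\<close> *[OF that d(3)] by (auto simp: pclass_eq matrix_mul_assoc mat_mult_mat)
  ultimately show "pclass B = pclass C" unfolding pclass_eq[of B] pclass_eq[of C]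
    by (auto simp: pclass_eq)
qed

lemma carrier_PGLn: "carrier PGLn = pclass ` {A. invertible A}"
  by (simp add: PGLn_def carrier_FactGroup pclass_def)

lemma pclass_in_carrier [intro, simp]: "invertible A \<Longrightarrow> pclass A \<in> carrier PGLn"
  by (auto simp: carrier_PGLn)

lemma pclass_mult [simp]:
  assumes "invertible A" "invertible B" shows "pclass A \<otimes>\<^bsub>PGLn\<^esub> pclass B = pclass (A ** B)"
  using normal.rcos_sum[OF scalar_matrices_normal, of A B] assms by (simp add: PGLn_def pclass_def)

lemma one_PGLn: "\<one>\<^bsub>PGLn\<^esub> = pclass (mat 1)"
  by (auto simp: PGLn_def pclass_eq scalar_matrices_def)

lemma is_ring_homD:
  assumes "is_ring_hom h"
  shows "h 1 = 1" "h (x + y) = h x + h y" "h (x * y) = h x * h y" "h 0 = 0"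
    "h (- x) = - h x" "h (x - y) = h x - h y" "h (sum p S) = (\<Sum>a\<in>S. h (p a))"
proof -
  show *: "h 1 = 1" "h (x + y) = h x + h y" "h (x * y) = h x * h y" for x y
    using assms by (auto simp: is_ring_hom_def)
  show 0: "h 0 = 0" using *(2)[of 0 0] by simp
  show m: "h (- x) = - h x" for x using *(2)[of x "-x"] 0 by (metis add.inverse_unique add.right_inverse)
  show "h (x - y) = h x - h y" using *(2)[of x "- y"] m[of y] by simp
  show "h (sum p S) = (\<Sum>a\<in>S. h (p a))" by (induction S rule: infinite_finite_induct) (auto simp: 0 *)
qed

lemma is_ring_hom_comp: "is_ring_hom g \<Longrightarrow> is_ring_hom h \<Longrightarrow> is_ring_hom (h \<circ> g)"
  by (auto simp: is_ring_hom_def)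

lemma map_matrix_mat: "is_ring_hom h \<Longrightarrow> map_matrix h (mat c) = mat (h c)"
  by (simp add: vec_eq_iff mat_def is_ring_homD)

lemma map_matrix_mult: "is_ring_hom h \<Longrightarrow> map_matrix h (A ** B) = map_matrix h A ** map_matrix h B"
  by (simp add: vec_eq_iff matrix_matrix_mult_def is_ring_homD)

lemma ring_hom_unit: "is_ring_hom h \<Longrightarrow> c dvd 1 \<Longrightarrow> h c dvd 1"
  unfolding dvd_def by (metis is_ring_homD(1,3))

lemma map_matrix_invertible: "is_ring_hom h \<Longrightarrow> invertible A \<Longrightarrow> invertible (map_matrix h A)"
  for A :: "'r::comm_ring_1 ^ 'n ^ 'n"
  unfolding invertible_def by (metis is_ring_homD(1) map_matrix_mat map_matrix_mult)

text \<open>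
  The saturation by scalars in \<open>PGL_map\<close> is what makes the image of a class a full class again.
\<close>

lemma PGL_map_pclass:
  assumes "is_ring_hom h" shows "PGL_map h (pclass B) = pclass (map_matrix h B)"
proof -
  have "PGL_map h (pclass B) = {mat d ** map_matrix h (mat c ** B) | c d. c dvd 1 \<and> d dvd 1}"
    by (auto simp: PGL_map_def pclass_eq set_mult_def scalar_matrices_def)
  also have "\<dots> = {mat (d * h c) ** map_matrix h B | c d. c dvd 1 \<and> d dvd 1}"
    by (simp add: map_matrix_mult[OF assms] map_matrix_mat[OF assms] matrix_mul_assoc mat_mult_mat)
  also have "\<dots> = pclass (map_matrix h B)"
  proof -
    have "x * h c dvd 1" if "x dvd 1" "c dvd 1" for x c
      using that ring_hom_unit[OF assms] by (metis mult_dvd_mono mult_1)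
    moreover have "\<exists>c d. mat e ** map_matrix h B = mat (d * h c) ** map_matrix h B \<and> c dvd 1 \<and> d dvd 1"
      if "e dvd 1" for e
      using that is_ring_homD(1)[OF assms] by (intro exI[of _ 1] exI[of _ e]) auto
    ultimately show ?thesis by (auto simp: pclass_eq)
  qed
  finally show ?thesis .
qed

lemma swapG_group: "group swapG"
  unfolding swapG_def by (rule DirProd_group[OF group_integer_mod_group PGLn_group])

lemma carrier_swapG: "carrier swapG = {(\<sigma>, pclass a) | \<sigma> a. (\<sigma> = 0 \<or> \<sigma> = 1) \<and> invertible a}"
proof -
  have "{0..<int 2} = {0, 1}" by auto
  then show ?thesis by (auto simp: swapG_def carrier_integer_mod_group carrier_PGLn)
qed

lemma mult_swapG:
  "invertible a \<Longrightarrow> invertible b \<Longrightarrow>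
    (\<sigma>, pclass a) \<otimes>\<^bsub>swapG\<^esub> (\<tau>, pclass b) = ((\<sigma> + \<tau>) mod 2, pclass (a ** b))"
  by (simp add: swapG_def)

lemma one_swapG: "\<one>\<^bsub>swapG\<^esub> = (0, pclass (mat 1))"
  by (simp add: swapG_def one_PGLn)

lemma swapG_map_pclass: "is_ring_hom h \<Longrightarrow> swapG_map h (\<sigma>, pclass a) = (\<sigma>, pclass (map_matrix h a))"
  by (simp add: swapG_map_def PGL_map_pclass)

lemma swapG_cases:
  assumes "\<gamma> \<in> carrier swapG"
  obtains \<sigma> a where "\<gamma> = (\<sigma>, pclass a)" "\<sigma> = 0 \<or> \<sigma> = 1" "invertible a"
  using assms by (auto simp: carrier_swapG)

lemma swapG_map_hom:
  assumes "is_ring_hom h" "\<gamma> \<in> carrier swapG" "\<delta> \<in> carrier swapG"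
  shows "swapG_map h (\<gamma> \<otimes>\<^bsub>swapG\<^esub> \<delta>) = swapG_map h \<gamma> \<otimes>\<^bsub>swapG\<^esub> swapG_map h \<delta>"
    "swapG_map h \<gamma> \<in> carrier swapG" "swapG_map h \<one>\<^bsub>swapG\<^esub> = \<one>\<^bsub>swapG\<^esub>"
proof -
  obtain \<sigma> a where a: "\<gamma> = (\<sigma>, pclass a)" "\<sigma> = 0 \<or> \<sigma> = 1" "invertible a"
    using assms swapG_cases by blast
  obtain \<tau> b where b: "\<delta> = (\<tau>, pclass b)" "\<tau> = 0 \<or> \<tau> = 1" "invertible b"
    using assms swapG_cases by blast
  note inv = a(3) b(3) map_matrix_invertible[OF assms(1) a(3)] map_matrix_invertible[OF assms(1) b(3)]
  show "swapG_map h (\<gamma> \<otimes>\<^bsub>swapG\<^esub> \<delta>) = swapG_map h \<gamma> \<otimes>\<^bsub>swapG\<^esub> swapG_map h \<delta>"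
    by (simp add: a(1) b(1) inv mult_swapG swapG_map_pclass assms(1) map_matrix_mult)
  show "swapG_map h \<gamma> \<in> carrier swapG"
    using a inv by (auto simp: swapG_map_pclass assms(1) carrier_swapG)
  show "swapG_map h \<one>\<^bsub>swapG\<^esub> = \<one>\<^bsub>swapG\<^esub>"
    by (simp add: one_swapG swapG_map_pclass assms(1) map_matrix_mat is_ring_homD)
qed

section \<open>The exterior square after base change\<close>

lemma ext2I: "(\<And>i. M $ i $ i = 0) \<Longrightarrow> (\<And>i j. M $ i $ j = - M $ j $ i) \<Longrightarrow> M \<in> ext2"
  unfolding ext2_def by blast

lemma ext2D: "M \<in> ext2 \<Longrightarrow> M $ i $ i = 0" "M \<in> ext2 \<Longrightarrow> M $ i $ j = - M $ j $ i"
  unfolding ext2_def by blast+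

lemma ext2_add:
  assumes "M \<in> ext2" "N \<in> ext2" shows "M + N \<in> ext2"
proof (rule ext2I)
  show "(M + N) $ i $ j = - (M + N) $ j $ i" for i j
    using ext2D(2)[OF assms(1), of i j] ext2D(2)[OF assms(2), of i j] by simp
qed (use assms in \<open>simp add: ext2D(1)\<close>)

lemma ext2_scale:
  assumes "M \<in> ext2" shows "mat c ** M \<in> ext2"
proof (rule ext2I)
  show "(mat c ** M) $ i $ j = - (mat c ** M) $ j $ i" for i j
    using ext2D(2)[OF assms, of i j] by (simp add: mat_mult_entry)
qed (use assms in \<open>simp add: ext2D(1) mat_mult_entry\<close>)

lemma ext2_zero: "0 \<in> ext2"
  by (simp add: ext2_def)

lemma ext2_sum: "(\<And>p. p \<in> S \<Longrightarrow> F p \<in> ext2) \<Longrightarrow> sum F S \<in> ext2"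
  by (induction S rule: infinite_finite_induct) (auto simp: ext2_zero ext2_add)

lemma wedge_in_ext2: "wedge u v \<in> ext2"
  by (simp add: ext2_def wedge_def algebra_simps)

lemma wedge_entry: "wedge u v $ i $ j = u $ i * v $ j - v $ i * u $ j"
  by (simp add: wedge_def)

lemma wedge_add_right: "wedge u (v + w) = wedge u v + wedge u w" for u :: "'r::comm_ring_1 ^ 5"
  by (simp add: vec_eq_iff wedge_entry algebra_simps)

lemma wedge_scale_right: "wedge u (c *s v) = mat c ** wedge u v" for u :: "'r::comm_ring_1 ^ 5"
  by (simp add: vec_eq_iff wedge_entry mat_mult_entry algebra_simps)

abbreviation pairs :: "(5 \<times> 5) set" where "pairs \<equiv> {(i, j). i < j}"

abbreviation basis_wedge :: "5 \<times> 5 \<Rightarrow> 'r::comm_ring_1 ^ 5 ^ 5" where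
  "basis_wedge p \<equiv> wedge (axis (fst p) 1) (axis (snd p) 1)"

lemma basis_wedge_entry:
  "(basis_wedge p :: 'r::comm_ring_1 ^ 5 ^ 5) $ i $ j = (if p = (i, j) then 1 else 0) - (if p = (j, i) then 1 else 0)"
proof -
  obtain a b where p: "p = (a, b)" by (cases p)
  have "(if a = i then 1 else 0) * (if b = j then 1 else 0) = (if p = (i, j) then 1 else 0 :: 'r)"
    "(if b = i then 1 else 0) * (if a = j then 1 else 0) = (if p = (j, i) then 1 else 0 :: 'r)"
    unfolding p by auto
  then show ?thesis by (simp add: wedge_def axis_def p eq_commute[of i] eq_commute[of j])
qed

text \<open>
  Over an arbitrary ring an alternating matrix is still the combination of the basis
  \<open>e\<^sub>i \<and> e\<^sub>j\<close>, \<open>i < j\<close>, with its entries as coefficients; the two conditions in \<open>ext2\<close> cover the cases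
  \<open>i = j\<close> and \<open>i > j\<close>.
\<close>

lemma ext2_entry_expansion:
  fixes M :: "'r::comm_ring_1 ^ 5 ^ 5"
  assumes "M \<in> ext2"
  shows "(\<Sum>p\<in>pairs. M $ fst p $ snd p * basis_wedge p $ i $ j) = M $ i $ j"
proof -
  have fin: "finite pairs" by simp
  have "(\<Sum>p\<in>pairs. M $ fst p $ snd p * basis_wedge p $ i $ j) =
      (\<Sum>p\<in>pairs. (if (i, j) = p then M $ fst p $ snd p else 0)) -
      (\<Sum>p\<in>pairs. (if (j, i) = p then M $ fst p $ snd p else 0))"
    unfolding sum_subtractf[symmetric] by (rule sum.cong) (auto simp: basis_wedge_entry)
  also have "\<dots> = (if i < j then M $ i $ j else 0) - (if j < i then M $ j $ i else 0)"
    using fin by (simp add: sum.delta' sum.delta)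
  also have "\<dots> = M $ i $ j"
    using ext2D(1)[OF assms, of i] ext2D(2)[OF assms, of i j] by (cases i j rule: linorder_cases) auto
  finally show ?thesis .
qed

lemma ext2_expansion:
  fixes M :: "'r::comm_ring_1 ^ 5 ^ 5"
  assumes "M \<in> ext2"
  shows "(\<Sum>p\<in>pairs. mat (M $ fst p $ snd p) ** basis_wedge p) = M"
  using ext2_entry_expansion[OF assms]
  by (simp add: vec_eq_iff sum_entry mat_mult_entry)

text \<open>
  Linear statements on the exterior square need to be checked on decomposable elements only.
\<close>

lemma ext2_induct [consumes 1, case_names zero add scale wedge]:
  fixes M :: "'r::comm_ring_1 ^ 5 ^ 5"
  assumes "M \<in> ext2" "P 0"
    and add: "\<And>M N. M \<in> ext2 \<Longrightarrow> N \<in> ext2 \<Longrightarrow> P M \<Longrightarrow> P N \<Longrightarrow> P (M + N)"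
    and scale: "\<And>c M. M \<in> ext2 \<Longrightarrow> P M \<Longrightarrow> P (mat c ** M)"
    and wedge: "\<And>u v. P (wedge u v)"
  shows "P M"
proof -
  have "P (sum F S) \<and> sum F S \<in> ext2" if "\<And>p. F p \<in> ext2 \<and> P (F p)" for S :: "(5 \<times> 5) set" and F
    using that assms(2) by (induction S rule: infinite_finite_induct) (auto simp: ext2_zero ext2_add add)
  note sums = this
  have terms: "mat (M $ fst p $ snd p) ** basis_wedge p \<in> ext2 \<and> P (mat (M $ fst p $ snd p) ** basis_wedge p)" for p
    by (intro conjI ext2_scale scale wedge wedge_in_ext2)
  have "P (\<Sum>p\<in>pairs. mat (M $ fst p $ snd p) ** basis_wedge p)"
    by (rule sums[THEN conjunct1], rule terms)
  then show ?thesis by (simp only: ext2_expansion[OF assms(1)])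
qed

text \<open>
  A wedge is an antisymmetrised tensor, and matrices act on the two factors of a tensor separately;
  this gives the formulas for \<open>ext2_map\<close> and \<open>ext2_der\<close> on wedges without expanding double sums.
\<close>

definition tensor :: "'r::comm_ring_1 ^ 5 \<Rightarrow> 'r ^ 5 \<Rightarrow> 'r ^ 5 ^ 5" where
  "tensor u v = (\<chi> i j. u $ i * v $ j)"

lemma wedge_tensor: "wedge u v = tensor u v - tensor v u"
  by (simp add: vec_eq_iff wedge_def tensor_def)

lemma tensor_mult: "A ** tensor u v = tensor (A *v u) v" "tensor u v ** transpose A = tensor u (A *v v)"
  by (simp_all add: vec_eq_iff matrix_matrix_mult_def matrix_vector_mult_def tensor_def transpose_def
      sum_distrib_left sum_distrib_right mult_ac)

lemma ext2_map_wedge: "ext2_map A (wedge u v) = wedge (A *v u) (A *v v)"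
  by (simp add: ext2_map_def wedge_tensor matrix_diff_distrib tensor_mult)

text \<open>
  The derivative at \<open>A = 1\<close> of \<open>ext2_map A\<close> in direction \<open>Z\<close>.
\<close>

definition ext2_der :: "'r::comm_ring_1 ^ 5 ^ 5 \<Rightarrow> 'r ^ 5 ^ 5 \<Rightarrow> 'r ^ 5 ^ 5" where
  "ext2_der Z M = Z ** M + M ** transpose Z"

lemma ext2_der_wedge: "ext2_der Z (wedge u v) = wedge (Z *v u) v + wedge u (Z *v v)"
  by (simp add: ext2_der_def wedge_tensor matrix_diff_distrib tensor_mult)

lemma ext2_map_linear:
  "ext2_map A (M + N) = ext2_map A M + ext2_map A N" "ext2_map A (mat c ** M) = mat c ** ext2_map A M"
  by (simp_all add: ext2_map_def matrix_add_distrib mat_left_commute matrix_mul_assoc[symmetric])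

lemma ext2_der_linear:
  "ext2_der Z (M + N) = ext2_der Z M + ext2_der Z N" "ext2_der Z (mat c ** M) = mat c ** ext2_der Z M"
  by (simp_all add: ext2_der_def matrix_add_distrib mat_left_commute matrix_mul_assoc[symmetric] algebra_simps)

lemma ext2_map_in_ext2: "M \<in> ext2 \<Longrightarrow> ext2_map A M \<in> ext2"
proof (induction rule: ext2_induct)
  case zero then show ?case by (simp add: ext2_map_def ext2_def matrix_matrix_mult_def)
qed (simp_all add: ext2_map_linear ext2_map_wedge wedge_in_ext2 ext2_add ext2_scale)

lemma ext2_der_in_ext2: "M \<in> ext2 \<Longrightarrow> ext2_der Z M \<in> ext2"
proof (induction rule: ext2_induct)
  case zero then show ?case by (simp add: ext2_der_def ext2_def matrix_matrix_mult_def)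
qed (simp_all add: ext2_der_linear ext2_der_wedge wedge_in_ext2 ext2_add ext2_scale)

lemma phi_bc_pairs: "phi_bc \<phi> f M $ r = (\<Sum>p\<in>pairs. M $ fst p $ snd p * f (\<phi> (basis_wedge p) $ r))"
  by (simp add: phi_bc_def case_prod_unfold)

lemma phi_bc_linear:
  "phi_bc \<phi> f (M + N) = phi_bc \<phi> f M + phi_bc \<phi> f N"
  "phi_bc \<phi> f (mat c ** M) = c *s phi_bc \<phi> f M"
  by (simp_all add: vec_eq_iff phi_bc_pairs algebra_simps sum.distrib sum_distrib_left mat_mult_entry)

text \<open>
  The base change of the inverse of \<open>\<phi>\<close>.
\<close>

definition psi_bc :: "('k::field ^ 5 ^ 5 \<Rightarrow> 'k ^ 10) \<Rightarrow> ('k \<Rightarrow> 'r::comm_ring_1) \<Rightarrow>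
    'r ^ 10 \<Rightarrow> 'r ^ 5 ^ 5" where
  "psi_bc \<phi> f w = (\<chi> i j. \<Sum>s\<in>UNIV. w $ s * f (inv_into ext2 \<phi> (axis s 1) $ i $ j))"

lemma psi_bc_linear:
  "psi_bc \<phi> f (v + w) = psi_bc \<phi> f v + psi_bc \<phi> f w"
  "psi_bc \<phi> f (c *s w) = mat c ** psi_bc \<phi> f w"
  by (simp_all add: vec_eq_iff psi_bc_def algebra_simps sum.distrib sum_distrib_left mat_mult_entry)

locale ext2_base_change =
  fixes \<phi> :: "'k::field ^ 5 ^ 5 \<Rightarrow> 'k ^ 10" and f :: "'k \<Rightarrow> 'r::comm_ring_1"
  assumes iso: "ext2_iso \<phi>" and hom: "is_ring_hom f"
begin

lemma phi_sum:
  assumes "\<And>p. p \<in> S \<Longrightarrow> F p \<in> ext2"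
  shows "\<phi> (\<Sum>p\<in>S. mat (c p) ** F p) = (\<Sum>p\<in>S. c p *s \<phi> (F p))"
proof -
  have a: "\<phi> (M + N) = \<phi> M + \<phi> N" if "M \<in> ext2" "N \<in> ext2" for M N
    using iso that by (auto simp: ext2_iso_def)
  have s: "\<phi> (mat d ** M) = d *s \<phi> M" if "M \<in> ext2" for d M
  proof -
    have "mat d ** M = (\<chi> i j. d * M $ i $ j)" by (simp add: vec_eq_iff mat_mult_entry)
    then show ?thesis using iso that by (auto simp: ext2_iso_def)
  qed
  have z: "\<phi> 0 = 0" using a[OF ext2_zero ext2_zero] by simp
  show ?thesis using assms
    by (induction S rule: infinite_finite_induct) (auto simp: z a s ext2_sum ext2_scale)
qed

lemma phi_inv: "\<phi> (inv_into ext2 \<phi> w) = w" "inv_into ext2 \<phi> w \<in> ext2"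
proof -
  have "w \<in> \<phi> ` ext2" using iso by (auto simp: ext2_iso_def bij_betw_def)
  then show "\<phi> (inv_into ext2 \<phi> w) = w" "inv_into ext2 \<phi> w \<in> ext2"
    by (auto simp: f_inv_into_f inv_into_into)
qed

lemma psi_bc_in_ext2: "psi_bc \<phi> f w \<in> ext2"
proof -
  let ?N = "\<lambda>s. inv_into ext2 \<phi> (axis s 1)"
  have N: "f (?N s $ i $ i) = 0" "f (?N s $ i $ j) = - f (?N s $ j $ i)" for s i j
    using ext2D(1)[OF phi_inv(2), of "axis s 1" i] ext2D(2)[OF phi_inv(2), of "axis s 1" i j]
    by (simp_all add: is_ring_homD[OF hom])
  have neg: "w $ s * f (?N s $ i $ j) = - (w $ s * f (?N s $ j $ i))" for s i j
    by (subst N(2)) simp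
  show ?thesis
  proof (rule ext2I)
    show "psi_bc \<phi> f w $ i $ i = 0" for i
      by (simp add: psi_bc_def N(1))
    show "psi_bc \<phi> f w $ i $ j = - psi_bc \<phi> f w $ j $ i" for i j
    proof -
      have "psi_bc \<phi> f w $ i $ j = (\<Sum>s\<in>UNIV. w $ s * f (?N s $ i $ j))"
        by (simp add: psi_bc_def)
      also have "\<dots> = (\<Sum>s\<in>UNIV. - (w $ s * f (?N s $ j $ i)))"
        by (rule sum.cong[OF refl]) (rule neg)
      also have "\<dots> = - psi_bc \<phi> f w $ j $ i"
        by (simp add: psi_bc_def sum_negf)
      finally show ?thesis .
    qed
  qed
qed

text \<open>
  That \<open>\<phi>\<close> and its inverse compose to the identity amounts to polynomial identities between
  their matrix entries over the base field, and these survive the ring homomorphism \<open>f\<close>.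
\<close>

lemma phi_psi [simp]: "phi_bc \<phi> f (psi_bc \<phi> f w) = w"
proof -
  let ?N = "\<lambda>s. inv_into ext2 \<phi> (axis s 1)"
  have rel: "(\<Sum>p\<in>pairs. ?N s $ fst p $ snd p * \<phi> (basis_wedge p) $ r) = (if r = s then 1 else 0)" for r s
  proof -
    have "(\<Sum>p\<in>pairs. ?N s $ fst p $ snd p * \<phi> (basis_wedge p) $ r) =
        (\<Sum>p\<in>pairs. ?N s $ fst p $ snd p *s \<phi> (basis_wedge p)) $ r" by simp
    also have "\<dots> = \<phi> (\<Sum>p\<in>pairs. mat (?N s $ fst p $ snd p) ** basis_wedge p) $ r"
      by (subst phi_sum) (simp_all add: wedge_in_ext2)
    also have "\<dots> = axis s 1 $ r"
      by (simp only: ext2_expansion[OF phi_inv(2)] phi_inv(1))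
    finally show ?thesis by (simp add: axis_def)
  qed
  have "phi_bc \<phi> f (psi_bc \<phi> f w) $ r = w $ r" for r
  proof -
    have "phi_bc \<phi> f (psi_bc \<phi> f w) $ r =
        (\<Sum>p\<in>pairs. \<Sum>s\<in>UNIV. w $ s * f (?N s $ fst p $ snd p * \<phi> (basis_wedge p) $ r))"
      by (simp add: phi_bc_pairs psi_bc_def sum_distrib_left sum_distrib_right is_ring_homD[OF hom] mult_ac)
    also have "\<dots> = (\<Sum>s\<in>UNIV. w $ s * f (\<Sum>p\<in>pairs. ?N s $ fst p $ snd p * \<phi> (basis_wedge p) $ r))"
      by (subst sum.swap) (simp add: is_ring_homD[OF hom] sum_distrib_left)
    also have "\<dots> = w $ r"
      by (simp add: rel if_distrib is_ring_homD[OF hom] cong: if_cong)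
    finally show ?thesis .
  qed
  then show ?thesis by (simp add: vec_eq_iff)
qed

lemma psi_phi:
  assumes "M \<in> ext2" shows "psi_bc \<phi> f (phi_bc \<phi> f M) = M"
proof -
  let ?N = "\<lambda>s. inv_into ext2 \<phi> (axis s 1)"
  have inj: "inj_on \<phi> ext2" using iso by (simp add: ext2_iso_def bij_betw_def)
  have rel: "(\<Sum>s\<in>UNIV. \<phi> (basis_wedge p) $ s * ?N s $ i $ j) = basis_wedge p $ i $ j" for p i j
  proof -
    let ?M = "\<Sum>s\<in>UNIV. mat (\<phi> (basis_wedge p) $ s) ** ?N s"
    have "\<phi> ?M = \<phi> (basis_wedge p)"
      by (subst phi_sum) (auto simp: phi_inv basis_expansion)
    moreover have "?M \<in> ext2" by (intro ext2_sum ext2_scale phi_inv)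
    ultimately have "?M = basis_wedge p"
      by (rule inj_onD[OF inj _ _ wedge_in_ext2])
    then have "?M $ i $ j = basis_wedge p $ i $ j" by simp
    then show ?thesis by (simp add: sum_entry mat_mult_entry)
  qed
  have f_wedge: "f (basis_wedge p $ i $ j) = basis_wedge p $ i $ j" for p i j
  proof -
    have "f ((if a then 1 else 0) - (if b then 1 else 0)) = (if a then 1 else 0) - (if b then 1 else 0)" for a b
      by (simp add: is_ring_homD[OF hom])
    then show ?thesis unfolding basis_wedge_entry by blast
  qed
  have "psi_bc \<phi> f (phi_bc \<phi> f M) $ i $ j = M $ i $ j" for i j
  proof -
    have "psi_bc \<phi> f (phi_bc \<phi> f M) $ i $ j =
        (\<Sum>s\<in>UNIV. \<Sum>p\<in>pairs. M $ fst p $ snd p * f (\<phi> (basis_wedge p) $ s * ?N s $ i $ j))"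
      by (simp add: phi_bc_pairs psi_bc_def sum_distrib_left sum_distrib_right is_ring_homD[OF hom] mult_ac)
    also have "\<dots> = (\<Sum>p\<in>pairs. M $ fst p $ snd p * f (\<Sum>s\<in>UNIV. \<phi> (basis_wedge p) $ s * ?N s $ i $ j))"
      by (subst sum.swap) (simp add: is_ring_homD[OF hom] sum_distrib_left)
    also have "\<dots> = M $ i $ j"
      by (simp add: rel f_wedge ext2_entry_expansion[OF assms])
    finally show ?thesis .
  qed
  then show ?thesis by (simp add: vec_eq_iff)
qed


lemma phi_inj: "M \<in> ext2 \<Longrightarrow> N \<in> ext2 \<Longrightarrow> phi_bc \<phi> f M = phi_bc \<phi> f N \<Longrightarrow> M = N"
  by (metis psi_phi)

lemma matrix_eq_on_ext2:
  assumes "\<And>M. M \<in> ext2 \<Longrightarrow> B *v phi_bc \<phi> f M = C *v phi_bc \<phi> f M"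
  shows "B = C"
proof -
  have "B *v w = C *v w" for w
    using assms[OF psi_bc_in_ext2, of w] by simp
  then show ?thesis by (simp add: matrix_eq)
qed

end

lemma matrix_of_linear:
  fixes g :: "'r::comm_ring_1 ^ 'n \<Rightarrow> 'r ^ 'm"
  assumes "\<And>v w. g (v + w) = g v + g w" "\<And>c v. g (c *s v) = c *s g v"
  shows "(\<chi> r s. g (axis s 1) $ r) *v w = g w"
proof -
  have "g 0 = 0" using assms(2)[of 0 0] by simp
  then have s: "g (\<Sum>s\<in>S. h s) = (\<Sum>s\<in>S. g (h s))" for h and S :: "'n set"
    by (induction S rule: infinite_finite_induct) (auto simp: assms)
  have "g w = g (\<Sum>s\<in>UNIV. w $ s *s axis s 1)" by (simp add: basis_expansion)
  also have "\<dots> = (\<Sum>s\<in>UNIV. w $ s *s g (axis s 1))" by (simp add: s assms)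
  finally show ?thesis by (simp add: vec_eq_iff matrix_vector_mult_def mult.commute)
qed

text \<open>
  The matrix on \<open>W\<close> of an endomorphism of \<open>\<and>\<^sup>2V\<close>, transported along \<open>\<phi>\<close>.
\<close>

definition transport :: "('k::field ^ 5 ^ 5 \<Rightarrow> 'k ^ 10) \<Rightarrow> ('k \<Rightarrow> 'r::comm_ring_1) \<Rightarrow>
    ('r ^ 5 ^ 5 \<Rightarrow> 'r ^ 5 ^ 5) \<Rightarrow> 'r ^ 10 ^ 10" where
  "transport \<phi> f F = (\<chi> r s. phi_bc \<phi> f (F (psi_bc \<phi> f (axis s 1))) $ r)"

definition ext_mat :: "('k::field ^ 5 ^ 5 \<Rightarrow> 'k ^ 10) \<Rightarrow> ('k \<Rightarrow> 'r::comm_ring_1) \<Rightarrow>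
    'r ^ 5 ^ 5 \<Rightarrow> 'r ^ 10 ^ 10" where
  "ext_mat \<phi> f A = transport \<phi> f (ext2_map A)"

definition der_mat :: "('k::field ^ 5 ^ 5 \<Rightarrow> 'k ^ 10) \<Rightarrow> ('k \<Rightarrow> 'r::comm_ring_1) \<Rightarrow>
    'r ^ 5 ^ 5 \<Rightarrow> 'r ^ 10 ^ 10" where
  "der_mat \<phi> f Z = transport \<phi> f (ext2_der Z)"

context ext2_base_change
begin

lemma transport_phi:
  assumes "\<And>M N. F (M + N) = F M + F N" "\<And>c M. F (mat c ** M) = mat c ** F M" "M \<in> ext2"
  shows "transport \<phi> f F *v phi_bc \<phi> f M = phi_bc \<phi> f (F M)"
proof -
  have "transport \<phi> f F *v w = phi_bc \<phi> f (F (psi_bc \<phi> f w))" for w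
    unfolding transport_def
    by (rule matrix_of_linear) (simp_all add: assms(1,2) psi_bc_linear phi_bc_linear)
  then show ?thesis by (simp add: psi_phi[OF assms(3)])
qed

lemma ext_mat_phi: "M \<in> ext2 \<Longrightarrow> ext_mat \<phi> f A *v phi_bc \<phi> f M = phi_bc \<phi> f (ext2_map A M)"
  unfolding ext_mat_def by (rule transport_phi) (simp_all add: ext2_map_linear)

lemma der_mat_phi: "M \<in> ext2 \<Longrightarrow> der_mat \<phi> f Z *v phi_bc \<phi> f M = phi_bc \<phi> f (ext2_der Z M)"
  unfolding der_mat_def by (rule transport_phi) (simp_all add: ext2_der_linear)

lemma ext_mat_mult: "ext_mat \<phi> f (A ** B) = ext_mat \<phi> f A ** ext_mat \<phi> f B"
  by (rule matrix_eq_on_ext2)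
    (simp add: ext_mat_phi matrix_vector_mul_assoc[symmetric] ext2_map_in_ext2,
     simp add: ext2_map_def matrix_transpose_mul matrix_mul_assoc)

lemma ext_mat_scale: "ext_mat \<phi> f (mat c ** A) = mat (c * c) ** ext_mat \<phi> f A"
proof (rule matrix_eq_on_ext2)
  fix M :: "'r ^ 5 ^ 5" assume M: "M \<in> ext2"
  have "ext2_map (mat c ** A) M = mat (c * c) ** ext2_map A M"
  proof -
    have "ext2_map (mat c ** A) M = mat c ** ((A ** M ** transpose A) ** mat c)"
      by (simp add: ext2_map_def matrix_transpose_mul matrix_mul_assoc)
    also have "\<dots> = mat c ** (mat c ** (A ** M ** transpose A))"
      by (subst mat_central) (rule refl)
    finally show ?thesis by (simp only: matrix_mul_assoc mat_mult_mat ext2_map_def)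
  qed
  moreover have "mat (c * c) *v w = (c * c) *s w" for w :: "'r ^ 10"
    by (simp add: vec_eq_iff matrix_vector_mult_def mat_def if_distrib if_distribR cong: if_cong)
  ultimately show "ext_mat \<phi> f (mat c ** A) *v phi_bc \<phi> f M = (mat (c * c) ** ext_mat \<phi> f A) *v phi_bc \<phi> f M"
    by (simp add: ext_mat_phi M matrix_vector_mul_assoc[symmetric] phi_bc_linear)
qed

lemma ext_mat_1 [simp]: "ext_mat \<phi> f (mat 1) = mat 1"
  by (rule matrix_eq_on_ext2) (simp add: ext_mat_phi, simp add: ext2_map_def)

lemma ext_mat_invertible: "invertible A \<Longrightarrow> invertible (ext_mat \<phi> f A)"
  unfolding invertible_def by (metis ext_mat_1 ext_mat_mult)

lemma ext_mat_unique:
  assumes "\<And>M. M \<in> ext2 \<Longrightarrow> B *v phi_bc \<phi> f M = phi_bc \<phi> f (ext2_map A M)"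
  shows "B = ext_mat \<phi> f A"
  by (rule matrix_eq_on_ext2) (simp add: assms ext_mat_phi)

text \<open>
  The transported matrices \<open>ext_mat \<phi> f A\<close> are the only matrices that satisfy the defining condition of
  \<open>H_subgroup\<close>.
\<close>

lemma H_subgroup_eq: "H_subgroup \<phi> f = {pclass (ext_mat \<phi> f A) | A. invertible A}"
  unfolding H_subgroup_def pclass_def[symmetric]
proof (rule subset_antisym; rule subsetI)
  fix x assume "x \<in> {pclass B |B. B \<in> carrier GLn \<and>
    (\<exists>A\<in>carrier GLn. \<forall>M\<in>ext2. B *v phi_bc \<phi> f M = phi_bc \<phi> f (ext2_map A M))}"
  then show "x \<in> {pclass (ext_mat \<phi> f A) | A. invertible A}"
    using ext_mat_unique by auto
next
  fix x assume "x \<in> {pclass (ext_mat \<phi> f A) | A. invertible A}"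
  then obtain A where A: "x = pclass (ext_mat \<phi> f A)" "invertible A" by auto
  show "x \<in> {pclass B |B. B \<in> carrier GLn \<and>
    (\<exists>A\<in>carrier GLn. \<forall>M\<in>ext2. B *v phi_bc \<phi> f M = phi_bc \<phi> f (ext2_map A M))}"
    unfolding mem_Collect_eq
    by (rule exI[of _ "ext_mat \<phi> f A"]) (use A ext_mat_invertible ext_mat_phi in auto)
qed

end

lemma map_matrix_ext_mat:
  assumes "is_ring_hom h" "is_ring_hom f"
  shows "map_matrix h (ext_mat \<phi> f A) = ext_mat \<phi> (h \<circ> f) (map_matrix h A)"
proof -
  have phi: "h (phi_bc \<phi> f M $ r) = phi_bc \<phi> (h \<circ> f) (map_matrix h M) $ r" for M r
    by (simp add: phi_bc_pairs is_ring_homD[OF assms(1)])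
  have psi: "map_matrix h (psi_bc \<phi> f (axis s 1)) = psi_bc \<phi> (h \<circ> f) (axis s 1)" for s
  proof -
    have "h (axis s 1 $ a * y) = axis s 1 $ a * h y" for a y
      by (simp add: axis_def is_ring_homD[OF assms(1)])
    then show ?thesis
      by (simp add: vec_eq_iff psi_bc_def is_ring_homD(7)[OF assms(1)])
  qed
  have ext2: "map_matrix h (ext2_map A M) = ext2_map (map_matrix h A) (map_matrix h M)" for M
    by (simp add: ext2_map_def map_matrix_mult[OF assms(1)]) (simp add: vec_eq_iff transpose_def map_matrix_def)
  show ?thesis
    by (simp add: vec_eq_iff ext_mat_def transport_def phi ext2 psi)
qed

section \<open>Points of the homogeneous space\<close>

text \<open>
  The preimage of \<open>H\<close> in the general linear group.
\<close>

definition H_lift :: "('k::field ^ 5 ^ 5 \<Rightarrow> 'k ^ 10) \<Rightarrow> ('k \<Rightarrow> 'r::comm_ring_1) \<Rightarrow> ('r ^ 10 ^ 10) set" where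
  "H_lift \<phi> f = {mat c ** ext_mat \<phi> f A | c A. c dvd 1 \<and> invertible A}"

definition coset_point :: "('k::field ^ 5 ^ 5 \<Rightarrow> 'k ^ 10) \<Rightarrow> ('k \<Rightarrow> 'r::comm_ring_1) \<Rightarrow>
    'r ^ 10 ^ 10 \<Rightarrow> 'r coset_pt" where
  "coset_point \<phi> f B = pclass B <#\<^bsub>PGLn\<^esub> H_subgroup \<phi> f"

context ext2_base_change
begin

lemma H_lift_invertible: "h \<in> H_lift \<phi> f \<Longrightarrow> invertible h"
  by (auto simp: H_lift_def ext_mat_invertible invertible_mat intro!: invertible_mult)

lemma H_lift_ext_mat: "invertible A \<Longrightarrow> ext_mat \<phi> f A \<in> H_lift \<phi> f"
  unfolding H_lift_def mem_Collect_eq by (rule exI[of _ 1], rule exI[of _ A]) simp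

lemma H_lift_mult:
  assumes "g \<in> H_lift \<phi> f" "h \<in> H_lift \<phi> f" shows "g ** h \<in> H_lift \<phi> f"
proof -
  obtain c A where g: "g = mat c ** ext_mat \<phi> f A" "c dvd 1" "invertible A"
    using assms(1) by (auto simp: H_lift_def)
  obtain d B where h: "h = mat d ** ext_mat \<phi> f B" "d dvd 1" "invertible B"
    using assms(2) by (auto simp: H_lift_def)
  have "g ** h = mat (c * d) ** ext_mat \<phi> f (A ** B)"
    by (simp add: g(1) h(1) scaled_mult ext_mat_mult)
  then show ?thesis
    unfolding H_lift_def mem_Collect_eq
    using unit_mult[OF g(2) h(2)] invertible_mult[OF g(3) h(3)] by blast
qed

lemma H_lift_inverse:
  assumes "h \<in> H_lift \<phi> f" shows "matrix_inv h \<in> H_lift \<phi> f"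
proof -
  obtain c A where h: "h = mat c ** ext_mat \<phi> f A" "c dvd 1" "invertible A"
    using assms(1) by (auto simp: H_lift_def)
  obtain d where d: "c * d = 1" "d * c = 1" "d dvd 1" by (metis h(2) unit_obtain_inverse)
  let ?k = "mat d ** ext_mat \<phi> f (matrix_inv A)"
  have "?k \<in> H_lift \<phi> f" using d invertible_matrix_inv[OF h(3)] by (auto simp: H_lift_def)
  have "h ** ?k = mat 1"
    by (simp add: h(1) scaled_mult ext_mat_mult[symmetric] matrix_inv_right[OF h(3)] d)
  then have "matrix_inv h = ?k"
    using matrix_inv_cancel(2)[OF H_lift_invertible[OF assms]] by (metis matrix_mul_rid)
  then show ?thesis using \<open>?k \<in> H_lift \<phi> f\<close> by simp
qed

lemma coset_point_eq:
  assumes "invertible B"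
  shows "coset_point \<phi> f B = {pclass (B ** ext_mat \<phi> f A) | A. invertible A}"
proof -
  have "coset_point \<phi> f B = {pclass B \<otimes>\<^bsub>PGLn\<^esub> pclass (ext_mat \<phi> f A) | A. invertible A}"
    by (auto simp: coset_point_def l_coset_def H_subgroup_eq)
  also have "\<dots> = {pclass (B ** ext_mat \<phi> f A) | A. invertible A}"
    by (rule Collect_cong) (metis pclass_mult[OF assms] ext_mat_invertible)
  finally show ?thesis .
qed

text \<open>
  Passing to classes modulo scalars loses nothing here, as \<open>H_lift\<close> contains the scalars.
\<close>

lemma coset_point_eq_iff:
  assumes "invertible B" "invertible C"
  shows "coset_point \<phi> f B = coset_point \<phi> f C \<longleftrightarrow> (\<exists>h\<in>H_lift \<phi> f. C = B ** h)"
proof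
  assume eq: "coset_point \<phi> f B = coset_point \<phi> f C"
  have "pclass (C ** ext_mat \<phi> f (mat 1)) \<in> coset_point \<phi> f C"
    unfolding coset_point_eq[OF assms(2)] using invertible_mat_1 by blast
  then obtain A where A: "invertible A" "pclass C = pclass (B ** ext_mat \<phi> f A)"
    unfolding eq[symmetric] coset_point_eq[OF assms(1)] by auto
  then obtain c where c: "c dvd 1" "C = mat c ** (B ** ext_mat \<phi> f A)"
    using pclass_eq_iff by metis
  then have "C = B ** (mat c ** ext_mat \<phi> f A)" by (simp add: mat_left_commute)
  then show "\<exists>h\<in>H_lift \<phi> f. C = B ** h" using A c by (auto simp: H_lift_def)
next
  assume "\<exists>h\<in>H_lift \<phi> f. C = B ** h"
  then obtain c A where C: "C = B ** (mat c ** ext_mat \<phi> f A)" "c dvd 1" "invertible A"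
    by (auto simp: H_lift_def)
  have *: "pclass (C ** ext_mat \<phi> f D) = pclass (B ** ext_mat \<phi> f (A ** D))" for D
  proof -
    have "C ** ext_mat \<phi> f D = B ** (mat c ** ext_mat \<phi> f (A ** D))"
      by (simp add: C(1) ext_mat_mult matrix_mul_assoc)
    also have "\<dots> = mat c ** (B ** ext_mat \<phi> f (A ** D))" by (rule mat_left_commute)
    finally show ?thesis using C(2) by (metis pclass_eq_iff)
  qed
  have "pclass (B ** ext_mat \<phi> f D) = pclass (C ** ext_mat \<phi> f (matrix_inv A ** D))" for D
    by (simp add: * matrix_inv_cancel[OF C(3)])
  then show "coset_point \<phi> f B = coset_point \<phi> f C"
    unfolding coset_point_eq[OF assms(1)] coset_point_eq[OF assms(2)]
    using * C(3) invertible_mult invertible_matrix_inv by (intro subset_antisym subsetI) blast+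
qed

lemma GmodH_eq: "GmodH \<phi> f = coset_point \<phi> f ` {B. invertible B}"
  by (auto simp: GmodH_def LCOSETS_def coset_point_def carrier_PGLn)

lemma act_coset_point:
  assumes "invertible A" "invertible B"
  shows "pclass A <#\<^bsub>PGLn\<^esub> coset_point \<phi> f B = coset_point \<phi> f (A ** B)"
proof -
  have "pclass A <#\<^bsub>PGLn\<^esub> coset_point \<phi> f B =
      {pclass A \<otimes>\<^bsub>PGLn\<^esub> pclass (B ** ext_mat \<phi> f D) | D. invertible D}"
    by (auto simp: coset_point_eq[OF assms(2)] l_coset_def)
  also have "\<dots> = {pclass (A ** B ** ext_mat \<phi> f D) | D. invertible D}"
    by (rule Collect_cong) (metis assms ext_mat_invertible invertible_mult matrix_mul_assoc pclass_mult)
  also have "\<dots> = coset_point \<phi> f (A ** B)"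
    by (simp add: coset_point_eq invertible_mult assms)
  finally show ?thesis .
qed

lemma swapG_act_coset_point:
  assumes "invertible A" "invertible B" "invertible C"
  shows "swapG_act (\<sigma>, pclass A) (coset_point \<phi> f B, coset_point \<phi> f C) =
    (if \<sigma> = 0 then (coset_point \<phi> f (A ** B), coset_point \<phi> f (A ** C))
     else (coset_point \<phi> f (A ** C), coset_point \<phi> f (A ** B)))"
  by (simp add: swapG_act_def act_coset_point assms)

lemma GmodH_pair_cases:
  assumes "t \<in> GmodH \<phi> f \<times> GmodH \<phi> f"
  obtains B C where "t = (coset_point \<phi> f B, coset_point \<phi> f C)" "invertible B" "invertible C"
  using assms by (auto simp: GmodH_eq)

lemma swapG_act_mult:
  assumes "\<gamma> \<in> carrier swapG" "\<delta> \<in> carrier swapG" "t \<in> GmodH \<phi> f \<times> GmodH \<phi> f"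
  shows "swapG_act (\<gamma> \<otimes>\<^bsub>swapG\<^esub> \<delta>) t = swapG_act \<gamma> (swapG_act \<delta> t)"
    "swapG_act \<gamma> t \<in> GmodH \<phi> f \<times> GmodH \<phi> f" "swapG_act \<one>\<^bsub>swapG\<^esub> t = t"
proof -
  obtain \<sigma> a where a: "\<gamma> = (\<sigma>, pclass a)" "\<sigma> = 0 \<or> \<sigma> = 1" "invertible a"
    using assms swapG_cases by blast
  obtain \<tau> b where b: "\<delta> = (\<tau>, pclass b)" "\<tau> = 0 \<or> \<tau> = 1" "invertible b"
    using assms swapG_cases by blast
  obtain B C where t: "t = (coset_point \<phi> f B, coset_point \<phi> f C)" "invertible B" "invertible C"
    using assms GmodH_pair_cases by blast
  note inv = a(3) b(3) t(2,3) invertible_mult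
  show "swapG_act (\<gamma> \<otimes>\<^bsub>swapG\<^esub> \<delta>) t = swapG_act \<gamma> (swapG_act \<delta> t)"
    using a(2) b(2) by (auto simp: a(1) b(1) t(1) mult_swapG swapG_act_coset_point inv matrix_mul_assoc)
  show "swapG_act \<gamma> t \<in> GmodH \<phi> f \<times> GmodH \<phi> f"
    by (auto simp: a(1) t(1) swapG_act_coset_point inv GmodH_eq)
  show "swapG_act \<one>\<^bsub>swapG\<^esub> t = t"
    by (simp add: one_swapG t(1) swapG_act_coset_point inv)
qed

text \<open>
  The image of \<open>gH\<close> under \<open>h\<close> is multiplied by the full group \<open>H\<close> over the target ring, and this
  absorbs the images of the elements of \<open>H\<close> over the source ring.
\<close>

lemma base_change_coset_point:
  assumes "is_ring_hom h" "invertible B"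
  shows "(PGL_map h ` coset_point \<phi> f B) <#>\<^bsub>PGLn\<^esub> H_subgroup \<phi> (h \<circ> f) =
    coset_point \<phi> (h \<circ> f) (map_matrix h B)"
proof -
  interpret h: ext2_base_change \<phi> "h \<circ> f"
    by unfold_locales (rule iso, rule is_ring_hom_comp[OF hom assms(1)])
  let ?e = "ext_mat \<phi> (h \<circ> f)" and ?B = "map_matrix h B"
  note inv = map_matrix_invertible[OF assms(1)]
  have im: "PGL_map h ` coset_point \<phi> f B = {pclass (?B ** ?e (map_matrix h A)) | A. invertible A}"
  proof -
    have "PGL_map h (pclass (B ** ext_mat \<phi> f A)) = pclass (?B ** ?e (map_matrix h A))" for A
      by (simp add: PGL_map_pclass[OF assms(1)] map_matrix_mult[OF assms(1)]
          map_matrix_ext_mat[OF assms(1) hom])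
    moreover have "PGL_map h ` coset_point \<phi> f B = {PGL_map h (pclass (B ** ext_mat \<phi> f A)) | A. invertible A}"
      unfolding coset_point_eq[OF assms(2)] by blast
    ultimately show ?thesis by simp
  qed
  have "(PGL_map h ` coset_point \<phi> f B) <#>\<^bsub>PGLn\<^esub> H_subgroup \<phi> (h \<circ> f) =
      {pclass (?B ** ?e (map_matrix h A)) \<otimes>\<^bsub>PGLn\<^esub> pclass (?e D) | A D. invertible A \<and> invertible D}"
    unfolding im h.H_subgroup_eq set_mult_def by blast
  also have "\<dots> = {pclass (?B ** ?e (map_matrix h A ** D)) | A D. invertible (A :: 'r ^ 5 ^ 5) \<and> invertible D}"
  proof -
    have "pclass (?B ** ?e (map_matrix h A)) \<otimes>\<^bsub>PGLn\<^esub> pclass (?e D) = pclass (?B ** ?e (map_matrix h A ** D))"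
      if "invertible A" "invertible D" for A :: "'r ^ 5 ^ 5" and D
      using that assms(2)
      by (simp add: inv invertible_mult h.ext_mat_invertible h.ext_mat_mult matrix_mul_assoc)
    then show ?thesis by (intro Collect_cong) metis
  qed
  also have "\<dots> = {pclass (?B ** ?e D) | D. invertible D}"
  proof (rule subset_antisym; rule subsetI)
    fix x assume "x \<in> {pclass (?B ** ?e (map_matrix h A ** D)) | A D. invertible (A :: 'r ^ 5 ^ 5) \<and> invertible D}"
    then show "x \<in> {pclass (?B ** ?e D) | D. invertible D}" using inv invertible_mult by blast
  next
    fix x assume "x \<in> {pclass (?B ** ?e D) | D. invertible D}"
    then obtain D where D: "x = pclass (?B ** ?e D)" "invertible D" by auto
    have "x = pclass (?B ** ?e (map_matrix h (mat 1) ** D))"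
      by (simp add: D(1) map_matrix_mat[OF assms(1)] is_ring_homD[OF assms(1)])
    then show "x \<in> {pclass (?B ** ?e (map_matrix h A ** D)) | A D. invertible (A :: 'r ^ 5 ^ 5) \<and> invertible D}"
      using D(2) invertible_mat_1 by blast
  qed
  also have "\<dots> = coset_point \<phi> (h \<circ> f) ?B"
    by (rule h.coset_point_eq[symmetric, OF inv[OF assms(2)]])
  finally show ?thesis .
qed

lemma pair_map_coset_point:
  assumes "is_ring_hom h" "invertible B" "invertible C" "h \<circ> f = f'"
  shows "pair_map \<phi> f' h (coset_point \<phi> f B, coset_point \<phi> f C) =
    (coset_point \<phi> f' (map_matrix h B), coset_point \<phi> f' (map_matrix h C))"
  using base_change_coset_point[OF assms(1)] assms(2-4) by (auto simp: pair_map_def)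

lemma pair_map_swapG_act:
  assumes "is_ring_hom h" "h \<circ> f = f'" "\<gamma> \<in> carrier swapG" "t \<in> GmodH \<phi> f \<times> GmodH \<phi> f"
  shows "pair_map \<phi> f' h (swapG_act \<gamma> t) = swapG_act (swapG_map h \<gamma>) (pair_map \<phi> f' h t)"
    "pair_map \<phi> f' h t \<in> GmodH \<phi> f' \<times> GmodH \<phi> f'"
proof -
  interpret h: ext2_base_change \<phi> f'
    by unfold_locales (rule iso, use is_ring_hom_comp[OF hom assms(1)] assms(2) in simp)
  obtain \<sigma> a where a: "\<gamma> = (\<sigma>, pclass a)" "\<sigma> = 0 \<or> \<sigma> = 1" "invertible a"
    using assms swapG_cases by blast
  obtain B C where t: "t = (coset_point \<phi> f B, coset_point \<phi> f C)" "invertible B" "invertible C"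
    using assms GmodH_pair_cases by blast
  note inv = a(3) t(2,3) invertible_mult map_matrix_invertible[OF assms(1)]
  show "pair_map \<phi> f' h (swapG_act \<gamma> t) = swapG_act (swapG_map h \<gamma>) (pair_map \<phi> f' h t)"
    by (simp add: a(1) t(1) swapG_act_coset_point h.swapG_act_coset_point inv assms(1,2)
        pair_map_coset_point swapG_map_pclass map_matrix_mult)
  show "pair_map \<phi> f' h t \<in> GmodH \<phi> f' \<times> GmodH \<phi> f'"
    by (simp add: t(1) inv assms(1,2) pair_map_coset_point h.GmodH_eq)
qed

end

section \<open>Matrices over square-zero extensions\<close>

lemma sqz_eq_iff: "x = y \<longleftrightarrow> sqz_base x = sqz_base y \<and> (\<forall>l. sqz_eps x $ l = sqz_eps y $ l)"
  by (cases x; cases y) (auto simp: vec_eq_iff)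

lemma sqz_base_simps [simp]:
  "sqz_base 0 = 0" "sqz_base 1 = 1" "sqz_base (x + y) = sqz_base x + sqz_base y"
  "sqz_base (x * y) = sqz_base x * sqz_base y" "sqz_base (sum p S) = (\<Sum>a\<in>S. sqz_base (p a))"
  by (simp_all add: zero_sqz_def one_sqz_def plus_sqz_def times_sqz_def)
    (induction S rule: infinite_finite_induct; simp add: zero_sqz_def plus_sqz_def)

lemma sqz_eps_simps [simp]:
  "sqz_eps 0 = 0" "sqz_eps 1 = 0" "sqz_eps (x + y) = sqz_eps x + sqz_eps y"
  "sqz_eps (x * y) = sqz_base x *s sqz_eps y + sqz_base y *s sqz_eps x"
  "sqz_eps (sum p S) = (\<Sum>a\<in>S. sqz_eps (p a))"
  by (simp_all add: zero_sqz_def one_sqz_def plus_sqz_def times_sqz_def)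
    (induction S rule: infinite_finite_induct; simp add: zero_sqz_def plus_sqz_def)

lemma sqz_base_hom: "is_ring_hom sqz_base"
  by (simp add: is_ring_hom_def)

lemma sqz_const_hom: "is_ring_hom sqz_const"
  by (auto simp: is_ring_hom_def sqz_const_def sqz_eq_iff)

lemma sqz_map_hom:
  assumes "\<And>v w. L (v + w) = L v + L w" "\<And>c v. L (c *s v) = c *s L v"
  shows "is_ring_hom (sqz_map L)"
proof -
  have "L 0 = 0" using assms(2)[of 0 0] by simp
  then show ?thesis by (auto simp: is_ring_hom_def sqz_map_def sqz_eq_iff assms)
qed

lemma sqz_base_const: "sqz_base \<circ> (sqz_const \<circ> f) = f"
  by (auto simp: sqz_const_def)

text \<open>
  A matrix over a square-zero extension is the same as its reduction \<open>B\<close> together with one matrix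
  \<open>X l\<close> of coefficients for each \<open>e\<^sub>l\<close>.
\<close>

definition sqz_mat :: "'a ^ 'p ^ 'm \<Rightarrow> ('n::finite \<Rightarrow> 'a ^ 'p ^ 'm) \<Rightarrow> ('a, 'n) sqz ^ 'p ^ 'm" where
  "sqz_mat B X = (\<chi> i j. Sqz (B $ i $ j) (\<chi> l. X l $ i $ j))"

lemma sqz_mat_exhaust: obtains B X where "M = sqz_mat B X"
proof
  show "M = sqz_mat (map_matrix sqz_base M) (\<lambda>l. \<chi> i j. sqz_eps (M $ i $ j) $ l)"
    by (simp add: vec_eq_iff sqz_mat_def)
qed

lemma sqz_mat_eq_iff: "sqz_mat B X = sqz_mat C Y \<longleftrightarrow> B = C \<and> (\<forall>l. X l = Y l)"
  by (auto simp: vec_eq_iff sqz_mat_def)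

lemma sqz_mat_base [simp]: "map_matrix sqz_base (sqz_mat B X) = B"
  by (simp add: vec_eq_iff sqz_mat_def)

lemma sqz_mat_const: "map_matrix sqz_const B = sqz_mat B (\<lambda>_. 0)"
  by (simp add: vec_eq_iff sqz_mat_def sqz_const_def)

lemma sqz_mat_mult:
  "sqz_mat B X ** sqz_mat C Y = sqz_mat (B ** C) (\<lambda>l. B ** Y l + X l ** C)"
  for B :: "'a::comm_ring_1 ^ 'p ^ 'm" and C :: "'a ^ 'q ^ 'p"
  by (simp add: vec_eq_iff sqz_mat_def matrix_matrix_mult_def sqz_eq_iff sum.distrib mult.commute)

lemma sqz_mat_1: "sqz_mat (mat 1) (\<lambda>_. 0) = mat 1"
  by (simp add: vec_eq_iff sqz_mat_def mat_def sqz_eq_iff)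

text \<open>
  The matrix \<open>1 + \<Sum>\<^sub>l e\<^sub>l X\<^sub>l\<close>; multiplication of such matrices is addition of the \<open>X\<^sub>l\<close>.
\<close>

definition eps_mat :: "('n::finite \<Rightarrow> 'a::comm_ring_1 ^ 'm ^ 'm) \<Rightarrow> ('a, 'n) sqz ^ 'm ^ 'm" where
  "eps_mat X = sqz_mat (mat 1) X"

abbreviation const_mat :: "'a::comm_ring_1 ^ 'm ^ 'm \<Rightarrow> ('a, 'n::finite) sqz ^ 'm ^ 'm" where
  "const_mat \<equiv> map_matrix sqz_const"

lemma eps_mat_mult: "eps_mat X ** eps_mat Y = eps_mat (\<lambda>l. X l + Y l)"
  by (simp add: eps_mat_def sqz_mat_mult add.commute)

lemma eps_mat_zero: "eps_mat (\<lambda>_. 0) = mat 1"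
  by (simp add: eps_mat_def sqz_mat_1)

lemma eps_mat_eq_iff: "eps_mat X = eps_mat Y \<longleftrightarrow> (\<forall>l. X l = Y l)"
  by (simp add: eps_mat_def sqz_mat_eq_iff)

lemma eps_mat_base [simp]: "map_matrix sqz_base (eps_mat X) = mat 1"
  by (simp add: eps_mat_def)

lemma const_mat_base [simp]: "map_matrix sqz_base (const_mat B) = B"
  by (simp add: sqz_mat_const)

lemma const_mat_mult: "const_mat (A ** B) = const_mat A ** const_mat B"
  by (rule map_matrix_mult[OF sqz_const_hom])

lemma const_mat_1: "const_mat (mat 1) = mat 1"
  by (simp add: sqz_mat_const sqz_mat_1)

lemma const_mat_invertible: "invertible B \<Longrightarrow> invertible (const_mat B)"
  by (rule map_matrix_invertible[OF sqz_const_hom])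

lemma eps_mat_invertible: "invertible (eps_mat X)"
proof -
  have "eps_mat X ** eps_mat (\<lambda>l. - X l) = mat 1" "eps_mat (\<lambda>l. - X l) ** eps_mat X = mat 1"
    by (simp_all add: eps_mat_mult eps_mat_zero)
  then show ?thesis unfolding invertible_def by blast
qed

lemma const_eps_mat:
  assumes "invertible B"
  shows "const_mat B ** eps_mat X = eps_mat (\<lambda>l. B ** X l ** matrix_inv B) ** const_mat B"
  by (simp add: eps_mat_def sqz_mat_const sqz_mat_mult matrix_inv_cancel[OF assms])

text \<open>
  The general linear group over a square-zero extension is the semidirect product of its constant
  matrices and its matrices of the form \<open>eps_mat X\<close>.
\<close>

lemma sqz_mat_decompose:
  assumes "invertible (map_matrix sqz_base M)"
  obtains X where "M = eps_mat X ** const_mat (map_matrix sqz_base M)"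
proof -
  obtain B X where M: "M = sqz_mat B X" by (rule sqz_mat_exhaust)
  then have B: "map_matrix sqz_base M = B" by simp
  have "M = eps_mat (\<lambda>l. X l ** matrix_inv B) ** const_mat (map_matrix sqz_base M)"
    unfolding B using assms M
    by (simp add: eps_mat_def sqz_mat_const sqz_mat_mult matrix_inv_cancel)
  then show ?thesis by (rule that)
qed

lemma unit_mat_decompose:
  fixes c :: "('a::comm_ring_1, 'n::finite) sqz"
  assumes "c dvd 1"
  obtains d where "(mat c :: ('a, 'n) sqz ^ 'm ^ 'm) = eps_mat (\<lambda>l. mat (d l)) ** const_mat (mat (sqz_base c))"
    "sqz_base c dvd 1"
proof -
  have u: "sqz_base c dvd 1" by (rule ring_hom_unit[OF sqz_base_hom assms])
  then obtain e where e: "e * sqz_base c = 1" by (metis unit_obtain_inverse)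
  have "(mat c :: ('a, 'n) sqz ^ 'm ^ 'm) =
      eps_mat (\<lambda>l. mat (sqz_eps c $ l * e)) ** const_mat (mat (sqz_base c))"
    by (simp add: eps_mat_def sqz_mat_const sqz_mat_mult mat_mult_mat mult.assoc e)
      (auto simp: vec_eq_iff sqz_mat_def mat_def sqz_eq_iff)
  then show ?thesis using u by (rule that)
qed

lemma map_eps_mat:
  assumes "L 0 = 0"
  shows "map_matrix (sqz_map L) (eps_mat X) = eps_mat (\<lambda>l. \<chi> i j. L (\<chi> k. X k $ i $ j) $ l)"
  using assms by (auto simp: vec_eq_iff eps_mat_def sqz_mat_def sqz_map_def)

lemma map_const_mat:
  assumes "L 0 = 0"
  shows "map_matrix (sqz_map L) (const_mat B) = const_mat B"
  using assms by (simp add: vec_eq_iff sqz_const_def sqz_map_def)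

section \<open>Infinitesimal stabilisers\<close>

text \<open>
  The tangent directions to \<open>g H_lift g\<^sup>-\<^sup>1\<close>, the preimage in the general linear group of the stabiliser
  of the coset of \<open>g\<close>.
\<close>

definition stab_alg :: "('k::field ^ 5 ^ 5 \<Rightarrow> 'k ^ 10) \<Rightarrow> ('k \<Rightarrow> 'r::comm_ring_1) \<Rightarrow>
    'r ^ 10 ^ 10 \<Rightarrow> ('r ^ 10 ^ 10) set" where
  "stab_alg \<phi> f g = range (\<lambda>Z. g ** der_mat \<phi> f Z ** matrix_inv g)"

lemma ext2_der_add: "ext2_der (Y + Z) M = ext2_der Y M + ext2_der Z M"
proof -
  have "transpose (Y + Z) = transpose Y + transpose Z" by (simp add: vec_eq_iff transpose_def)
  then show ?thesis by (simp add: ext2_der_def matrix_add_distrib algebra_simps)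
qed

lemma ext2_der_scale: "ext2_der (mat c ** Z) M = mat c ** ext2_der Z M"
proof -
  have "M ** transpose (mat c ** Z) = mat c ** (M ** transpose Z)"
    by (simp add: matrix_transpose_mul) (metis mat_central matrix_mul_assoc)
  then show ?thesis by (simp add: ext2_der_def matrix_add_distrib matrix_mul_assoc[symmetric])
qed

context ext2_base_change
begin

lemma der_mat_add: "der_mat \<phi> f (Y + Z) = der_mat \<phi> f Y + der_mat \<phi> f Z"
  by (rule matrix_eq_on_ext2) (simp add: der_mat_phi ext2_der_add phi_bc_linear matrix_vector_mult_add_rdistrib)

lemma der_mat_scale: "der_mat \<phi> f (mat c ** Z) = mat c ** der_mat \<phi> f Z"
  by (rule matrix_eq_on_ext2) (simp add: der_mat_phi ext2_der_scale phi_bc_linear scaled_matrix_vector_mult)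

lemma der_mat_one: "der_mat \<phi> f (mat c) = mat (c + c)"
proof (rule matrix_eq_on_ext2)
  fix M :: "'r ^ 5 ^ 5" assume M: "M \<in> ext2"
  have "ext2_der (mat c) M = mat c ** M + mat c ** M"
    by (simp add: ext2_der_def) (rule mat_central)
  moreover have "mat (c + c) *v w = c *s w + c *s w" for w :: "'r ^ 10"
    using scaled_matrix_vector_mult[of "c + c" "mat 1" w] by (simp add: vec_eq_iff algebra_simps)
  ultimately show "der_mat \<phi> f (mat c) *v phi_bc \<phi> f M = mat (c + c) *v phi_bc \<phi> f M"
    by (simp only: der_mat_phi[OF M] phi_bc_linear)
qed

lemma ext_der_mat:
  assumes "invertible A"
  shows "ext_mat \<phi> f A ** der_mat \<phi> f Z = der_mat \<phi> f (A ** Z ** matrix_inv A) ** ext_mat \<phi> f A"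
proof (rule matrix_eq_on_ext2)
  fix M :: "'r ^ 5 ^ 5" assume M: "M \<in> ext2"
  have "ext2_map A (ext2_der Z M) = ext2_der (A ** Z ** matrix_inv A) (ext2_map A M)"
  proof -
    have "transpose (matrix_inv A) ** transpose Z ** transpose A = transpose (A ** Z ** matrix_inv A)"
      by (simp add: matrix_transpose_mul matrix_mul_assoc)
    moreover have "transpose A ** transpose (matrix_inv A) = mat 1"
      by (simp add: matrix_transpose_mul[symmetric] matrix_inv_left assms)
    ultimately have "transpose A ** transpose (A ** Z ** matrix_inv A) = transpose Z ** transpose A"
      by (metis matrix_mul_assoc matrix_mul_lid)
    then have "M ** transpose Z ** transpose A = M ** transpose A ** transpose (A ** Z ** matrix_inv A)"
      by (simp only: matrix_mul_assoc[symmetric])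
    moreover have "A ** Z ** matrix_inv A ** (A ** M ** transpose A) = A ** Z ** M ** transpose A"
      by (simp only: matrix_mul_assoc matrix_inv_cancel(4)[OF assms])
    ultimately show ?thesis
      by (simp add: ext2_map_def ext2_der_def matrix_add_distrib matrix_mul_assoc)
        (metis matrix_mul_assoc)
  qed
  then show "(ext_mat \<phi> f A ** der_mat \<phi> f Z) *v phi_bc \<phi> f M =
      (der_mat \<phi> f (A ** Z ** matrix_inv A) ** ext_mat \<phi> f A) *v phi_bc \<phi> f M"
    by (simp add: matrix_vector_mul_assoc[symmetric] der_mat_phi ext_mat_phi M ext2_der_in_ext2 ext2_map_in_ext2)
qed

lemma stab_alg_add: "X \<in> stab_alg \<phi> f g \<Longrightarrow> Y \<in> stab_alg \<phi> f g \<Longrightarrow> X + Y \<in> stab_alg \<phi> f g"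
  by (auto simp: stab_alg_def matrix_add_distrib[symmetric] der_mat_add[symmetric])

lemma stab_alg_scale:
  assumes "X \<in> stab_alg \<phi> f g" shows "mat c ** X \<in> stab_alg \<phi> f g"
proof -
  obtain Z where X: "X = g ** der_mat \<phi> f Z ** matrix_inv g"
    using assms by (auto simp: stab_alg_def)
  have "g ** der_mat \<phi> f (mat c ** Z) = mat c ** (g ** der_mat \<phi> f Z)"
    by (simp only: der_mat_scale) (rule mat_left_commute)
  then have "mat c ** X = g ** der_mat \<phi> f (mat c ** Z) ** matrix_inv g"
    by (simp add: X matrix_mul_assoc)
  then show ?thesis by (auto simp: stab_alg_def)
qed

lemma stab_alg_uminus: "X \<in> stab_alg \<phi> f g \<Longrightarrow> - X \<in> stab_alg \<phi> f g"
  by (simp add: uminus_as_scale stab_alg_scale)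

lemma stab_alg_diff: "X \<in> stab_alg \<phi> f g \<Longrightarrow> Y \<in> stab_alg \<phi> f g \<Longrightarrow> X - Y \<in> stab_alg \<phi> f g"
  using stab_alg_add stab_alg_uminus by (metis diff_conv_add_uminus)

lemma stab_alg_conj:
  assumes "invertible a" "invertible g" "X \<in> stab_alg \<phi> f g"
  shows "a ** X ** matrix_inv a \<in> stab_alg \<phi> f (a ** g)"
  using assms by (auto simp: stab_alg_def matrix_inv_mult matrix_mul_assoc)

lemma stab_alg_H_lift_subset:
  assumes "invertible g" "h \<in> H_lift \<phi> f"
  shows "stab_alg \<phi> f (g ** h) \<subseteq> stab_alg \<phi> f g"
proof
  fix X assume "X \<in> stab_alg \<phi> f (g ** h)"
  then obtain Z where X: "X = g ** h ** der_mat \<phi> f Z ** matrix_inv (g ** h)"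
    by (auto simp: stab_alg_def)
  obtain c A where h: "h = mat c ** ext_mat \<phi> f A" "c dvd 1" "invertible A"
    using assms(2) by (auto simp: H_lift_def)
  have inv: "invertible h" by (rule H_lift_invertible[OF assms(2)])
  let ?D = "der_mat \<phi> f (A ** Z ** matrix_inv A)"
  have eq: "h ** der_mat \<phi> f Z = ?D ** h"
    by (simp add: h(1) mat_left_commute ext_der_mat[OF h(3)] matrix_mul_assoc[symmetric])
  have "X = g ** (h ** der_mat \<phi> f Z) ** matrix_inv h ** matrix_inv g"
    by (simp add: X matrix_inv_mult[OF assms(1) inv] matrix_mul_assoc)
  also have "\<dots> = g ** ?D ** h ** matrix_inv h ** matrix_inv g"
    by (simp only: eq matrix_mul_assoc)
  finally have "X = g ** ?D ** matrix_inv g"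
    by (simp only: matrix_inv_cancel(3)[OF inv])
  then show "X \<in> stab_alg \<phi> f g" by (auto simp: stab_alg_def)
qed

text \<open>
  The stabiliser depends only on the coset of \<open>g\<close>, because \<open>H_lift\<close> normalises its own Lie algebra
  (\<open>ext_der_mat\<close>).
\<close>

lemma stab_alg_H_lift:
  assumes "invertible g" "h \<in> H_lift \<phi> f"
  shows "stab_alg \<phi> f (g ** h) = stab_alg \<phi> f g"
proof
  have "stab_alg \<phi> f (g ** h ** matrix_inv h) \<subseteq> stab_alg \<phi> f (g ** h)"
    by (intro stab_alg_H_lift_subset H_lift_inverse assms invertible_mult H_lift_invertible)
  then show "stab_alg \<phi> f g \<subseteq> stab_alg \<phi> f (g ** h)"
    using matrix_inv_cancel(3)[OF H_lift_invertible[OF assms(2)], of g] by simp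
qed (rule stab_alg_H_lift_subset[OF assms])

end

text \<open>
  The functor \<open>\<and>\<^sup>2\<close> maps \<open>1 + eZ\<close> to \<open>1 + e D(Z)\<close>: in \<open>(1 + eZ) N (1 + eZ)\<^sup>T\<close> the quadratic term
  vanishes.
\<close>

lemma ext_mat_eps_mat:
  fixes \<phi> :: "'k::field ^ 5 ^ 5 \<Rightarrow> 'k ^ 10" and f :: "'k \<Rightarrow> 'a::comm_ring_1"
    and Z :: "'n::finite \<Rightarrow> 'a ^ 5 ^ 5"
  assumes "ext2_iso \<phi>" "is_ring_hom f"
  shows "ext_mat \<phi> (sqz_const \<circ> f) (eps_mat Z) = eps_mat (\<lambda>l. der_mat \<phi> f (Z l))"
proof -
  interpret ext2_base_change \<phi> f by unfold_locales fact+
  have psi: "psi_bc \<phi> (sqz_const \<circ> f) (axis s 1) = sqz_mat (psi_bc \<phi> f (axis s 1)) (\<lambda>_ :: 'n. 0)" for s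
  proof -
    have "sqz_base ((axis s 1 :: ('a, 'n) sqz ^ 10) $ a) = axis s 1 $ a"
      "sqz_eps ((axis s 1 :: ('a, 'n) sqz ^ 10) $ a) = 0" for a
      by (simp_all add: axis_def)
    then show ?thesis
      by (simp add: vec_eq_iff psi_bc_def sqz_mat_def sqz_eq_iff sqz_const_def)
  qed
  have phi: "phi_bc \<phi> (sqz_const \<circ> f) (sqz_mat N Y) $ r = Sqz (phi_bc \<phi> f N $ r) (\<chi> l. phi_bc \<phi> f (Y l) $ r)"
    for N r and Y :: "'n \<Rightarrow> _"
    by (simp add: phi_bc_pairs sqz_mat_def sqz_eq_iff sqz_const_def mult.commute)
  have tr: "transpose (eps_mat Z) = eps_mat (\<lambda>l. transpose (Z l))"
    by (simp add: eps_mat_def sqz_mat_def vec_eq_iff transpose_def mat_def sqz_eq_iff)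
  have map: "ext2_map (eps_mat Z) (sqz_mat N (\<lambda>_. 0)) = sqz_mat N (\<lambda>l. ext2_der (Z l) N)" for N
    by (simp add: ext2_map_def tr) (simp add: eps_mat_def sqz_mat_mult ext2_der_def sqz_mat_eq_iff add.commute)
  have "phi_bc \<phi> f (psi_bc \<phi> f (axis s 1)) $ r = mat 1 $ r $ s" for r s
    by (simp add: axis_def mat_def)
  then show ?thesis
    by (simp add: vec_eq_iff ext_mat_def der_mat_def transport_def psi phi map)
      (simp add: eps_mat_def sqz_mat_def)
qed

locale ext2_field_change = ext2_base_change \<phi> f
  for \<phi> :: "'k::field ^ 5 ^ 5 \<Rightarrow> 'k ^ 10" and f :: "'k \<Rightarrow> 'a::field_char_0"
begin

lemma sqz_base_change: "ext2_base_change \<phi> (sqz_const \<circ> f)"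
  by unfold_locales (rule iso, rule is_ring_hom_comp[OF hom sqz_const_hom])

lemma ext_mat_const: "ext_mat \<phi> (sqz_const \<circ> f) (const_mat A) = const_mat (ext_mat \<phi> f A)"
  by (rule map_matrix_ext_mat[OF sqz_const_hom hom, symmetric])

lemma const_mat_H_lift:
  assumes "h \<in> H_lift \<phi> f" shows "const_mat h \<in> H_lift \<phi> (sqz_const \<circ> f)"
proof -
  obtain c A where h: "h = mat c ** ext_mat \<phi> f A" "c dvd 1" "invertible A"
    using assms by (auto simp: H_lift_def)
  have "const_mat h = mat (sqz_const c) ** ext_mat \<phi> (sqz_const \<circ> f) (const_mat A)"
    by (simp add: h(1) const_mat_mult ext_mat_const map_matrix_mat[OF sqz_const_hom])
  then show ?thesis
    using ring_hom_unit[OF sqz_const_hom h(2)] const_mat_invertible[OF h(3)] by (auto simp: H_lift_def)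
qed

text \<open>
  An element of \<open>H_lift\<close> over the extension is a constant element times one of the form
  \<open>1 + e(d + D(Z))\<close>, where \<open>d\<close> comes from the scalar factor.  The scalar matrix \<open>d\<close> equals
  \<open>D(d/2)\<close>, so it adds nothing to the range of \<open>D\<close>.
\<close>

lemma eps_mat_H_lift_iff:
  fixes X :: "'n::finite \<Rightarrow> 'a ^ 10 ^ 10"
  shows "eps_mat X \<in> H_lift \<phi> (sqz_const \<circ> f) \<longleftrightarrow> (\<forall>l. X l \<in> range (der_mat \<phi> f))"
proof
  interpret R: ext2_base_change \<phi> "sqz_const \<circ> f :: 'k \<Rightarrow> ('a, 'n) sqz" by (rule sqz_base_change)
  assume "\<forall>l. X l \<in> range (der_mat \<phi> f)"
  then have "\<forall>l. \<exists>Z. X l = der_mat \<phi> f Z" by auto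
  then obtain Z where "\<And>l. X l = der_mat \<phi> f (Z l)" by metis
  then have "eps_mat X = ext_mat \<phi> (sqz_const \<circ> f) (eps_mat Z)"
    by (simp add: ext_mat_eps_mat[OF iso hom] eps_mat_eq_iff)
  then show "eps_mat X \<in> H_lift \<phi> (sqz_const \<circ> f)"
    using R.H_lift_ext_mat[OF eps_mat_invertible] by simp
next
  interpret R: ext2_base_change \<phi> "sqz_const \<circ> f :: 'k \<Rightarrow> ('a, 'n) sqz" by (rule sqz_base_change)
  assume "eps_mat X \<in> H_lift \<phi> (sqz_const \<circ> f)"
  then obtain c A where A: "eps_mat X = mat c ** ext_mat \<phi> (sqz_const \<circ> f) A" "c dvd 1" "invertible A"
    by (auto simp: H_lift_def)
  obtain Z where Z: "A = eps_mat Z ** const_mat (map_matrix sqz_base A)"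
    using sqz_mat_decompose[OF map_matrix_invertible[OF sqz_base_hom A(3)]] by blast
  obtain d where d: "(mat c :: ('a, 'n) sqz ^ 10 ^ 10) = eps_mat (\<lambda>l. mat (d l)) ** const_mat (mat (sqz_base c))"
    "sqz_base c dvd 1" using unit_mat_decompose[OF A(2)] by blast
  let ?A0 = "map_matrix sqz_base A" and ?c0 = "mat (sqz_base c) :: 'a ^ 10 ^ 10"
  have c0: "invertible ?c0" using d(2) by (rule invertible_mat)
  have conj: "?c0 ** Y ** matrix_inv ?c0 = Y" for Y
    using matrix_inv_cancel(3)[OF c0, of Y] by (simp only: mat_central)
  have "eps_mat X = eps_mat (\<lambda>l. mat (d l)) ** (const_mat ?c0 ** (eps_mat (\<lambda>l. der_mat \<phi> f (Z l)) ** const_mat (ext_mat \<phi> f ?A0)))"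
    unfolding A(1) by (subst Z, subst R.ext_mat_mult)
      (simp add: d(1) ext_mat_eps_mat[OF iso hom] ext_mat_const matrix_mul_assoc)
  also have "const_mat ?c0 ** (eps_mat (\<lambda>l. der_mat \<phi> f (Z l)) ** const_mat (ext_mat \<phi> f ?A0)) =
      eps_mat (\<lambda>l. der_mat \<phi> f (Z l)) ** const_mat (?c0 ** ext_mat \<phi> f ?A0)"
    by (simp add: matrix_mul_assoc const_eps_mat[OF c0] conj const_mat_mult)
  finally have eq: "eps_mat X = eps_mat (\<lambda>l. mat (d l) + der_mat \<phi> f (Z l)) ** const_mat (?c0 ** ext_mat \<phi> f ?A0)"
    by (simp add: matrix_mul_assoc eps_mat_mult)
  then have "map_matrix sqz_base (eps_mat X) = ?c0 ** ext_mat \<phi> f ?A0"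
    by (simp add: map_matrix_mult[OF sqz_base_hom])
  then have "?c0 ** ext_mat \<phi> f ?A0 = mat 1" by simp
  with eq have X: "X l = mat (d l) + der_mat \<phi> f (Z l)" for l
    by (simp add: const_mat_1 eps_mat_eq_iff)
  have "mat (d l) = der_mat \<phi> f (mat (d l / 2))" for l
    by (simp add: der_mat_one)
  then show "\<forall>l. X l \<in> range (der_mat \<phi> f)"
    using X by (metis der_mat_add rangeI)
qed

text \<open>
  Deformations of a single coset: the fibre of \<open>G/H\<close> over the coset of \<open>g\<close> is \<open>gl(W)\<close> modulo the
  infinitesimal stabiliser.
\<close>

lemma coset_point_eps_eq_iff:
  fixes X Y :: "'n::finite \<Rightarrow> 'a ^ 10 ^ 10"
  assumes g: "invertible g"
  shows "coset_point \<phi> (sqz_const \<circ> f) (eps_mat X ** const_mat g) =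
      coset_point \<phi> (sqz_const \<circ> f) (eps_mat Y ** const_mat g) \<longleftrightarrow> (\<forall>l. X l - Y l \<in> stab_alg \<phi> f g)"
proof -
  interpret R: ext2_base_change \<phi> "sqz_const \<circ> f :: 'k \<Rightarrow> ('a, 'n) sqz" by (rule sqz_base_change)
  let ?D = "\<lambda>l. matrix_inv g ** (Y l - X l) ** g"
  have inv: "invertible (eps_mat X ** const_mat g)" for X :: "'n::finite \<Rightarrow> 'a ^ 10 ^ 10"
    by (intro invertible_mult eps_mat_invertible const_mat_invertible g)
  have "(\<lambda>l. g ** ?D l ** matrix_inv g) = (\<lambda>l. Y l - X l)"
    by (simp add: matrix_inv_cancel[OF g] matrix_mul_assoc matrix_inv_right[OF g])
  then have "const_mat g ** eps_mat ?D = eps_mat (\<lambda>l. Y l - X l) ** const_mat g"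
    by (simp add: const_eps_mat[OF g])
  then have *: "eps_mat X ** const_mat g ** eps_mat ?D = eps_mat Y ** const_mat g"
    by (simp add: matrix_mul_assoc[symmetric]) (simp add: matrix_mul_assoc eps_mat_mult)
  have "coset_point \<phi> (sqz_const \<circ> f) (eps_mat X ** const_mat g) =
      coset_point \<phi> (sqz_const \<circ> f) (eps_mat Y ** const_mat g) \<longleftrightarrow> eps_mat ?D \<in> H_lift \<phi> (sqz_const \<circ> f)"
  proof -
    have uniq: "h = eps_mat ?D" if "eps_mat Y ** const_mat g = eps_mat X ** const_mat g ** h" for h
      using arg_cong[OF that[folded *], of "\<lambda>M. matrix_inv (eps_mat X ** const_mat g) ** M"]
      by (simp only: matrix_inv_cancel(2)[OF inv])
    show ?thesis
      unfolding R.coset_point_eq_iff[OF inv inv]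
    proof
      assume "\<exists>h\<in>H_lift \<phi> (sqz_const \<circ> f). eps_mat Y ** const_mat g = eps_mat X ** const_mat g ** h"
      then show "eps_mat ?D \<in> H_lift \<phi> (sqz_const \<circ> f)" using uniq by auto
    next
      assume "eps_mat ?D \<in> H_lift \<phi> (sqz_const \<circ> f)"
      then show "\<exists>h\<in>H_lift \<phi> (sqz_const \<circ> f). eps_mat Y ** const_mat g = eps_mat X ** const_mat g ** h"
        by (rule bexI[rotated]) (rule *[symmetric])
    qed
  qed
  also have "\<dots> \<longleftrightarrow> (\<forall>l. Y l - X l \<in> stab_alg \<phi> f g)"
  proof -
    have "?D l \<in> range (der_mat \<phi> f) \<longleftrightarrow> Y l - X l \<in> stab_alg \<phi> f g" for l
    proof
      assume "?D l \<in> range (der_mat \<phi> f)"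
      then obtain Z where "?D l = der_mat \<phi> f Z" by auto
      then have "Y l - X l = g ** der_mat \<phi> f Z ** matrix_inv g"
        by (metis g matrix_inv_cancel(1,3) matrix_mul_assoc)
      then show "Y l - X l \<in> stab_alg \<phi> f g" by (auto simp: stab_alg_def)
    next
      assume "Y l - X l \<in> stab_alg \<phi> f g"
      then obtain Z where "Y l - X l = g ** der_mat \<phi> f Z ** matrix_inv g" by (auto simp: stab_alg_def)
      then have "?D l = der_mat \<phi> f Z"
        by (metis g matrix_inv_cancel(2,4) matrix_mul_assoc)
      then show "?D l \<in> range (der_mat \<phi> f)" by auto
    qed
    then show ?thesis by (simp add: eps_mat_H_lift_iff)
  qed
  also have "\<dots> \<longleftrightarrow> (\<forall>l. X l - Y l \<in> stab_alg \<phi> f g)"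
    using stab_alg_uminus by (metis minus_diff_eq)
  finally show ?thesis .
qed

end

section \<open>Counting dimensions\<close>

lemma mult_axis_entry: "(Z *v axis k 1) $ i = Z $ i $ k" for Z :: "'a::comm_ring_1 ^ 'n ^ 'm"
  by (simp add: matrix_vector_mult_def axis_def if_distrib cong: if_cong)

text \<open>
  More vectors than coordinates are linearly dependent.  The family may have repetitions.
\<close>

lemma linear_relation_exists:
  fixes F :: "'i \<Rightarrow> 'a::field ^ 'j"
  assumes "finite I" "CARD('j) < card I"
  obtains c where "\<exists>i\<in>I. c i \<noteq> 0" "(\<Sum>i\<in>I. c i *s F i) = 0"
proof (cases "inj_on F I")
  case False
  then obtain i j where ij: "i \<in> I" "j \<in> I" "i \<noteq> j" "F i = F j" by (auto simp: inj_on_def)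
  let ?c = "\<lambda>k. if k = i then 1 else if k = j then - 1 else (0 :: 'a)"
  have "(\<Sum>k\<in>I. ?c k *s F k) = (\<Sum>k\<in>{i, j}. ?c k *s F k)"
    using ij assms(1) by (intro sum.mono_neutral_right) auto
  also have "\<dots> = 0" using ij by simp
  finally show ?thesis using ij(1) by (intro that[of ?c]) auto
next
  case True
  have "vec.dependent (F ` I)"
  proof (rule ccontr)
    assume "\<not> vec.dependent (F ` I)"
    then have "card (F ` I) = vec.dim (F ` I)" by (simp add: vec.dim_eq_card_independent)
    also have "\<dots> \<le> CARD('j)" by (rule dim_subset_UNIV_cart_gen)
    finally show False using assms(2) card_image[OF True] by simp
  qed
  then obtain u where u: "\<exists>v\<in>F ` I. u v \<noteq> 0" "(\<Sum>v\<in>F ` I. u v *s v) = 0"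
    using vec.dependent_finite[of "F ` I"] assms(1) by auto
  show ?thesis
    by (rule that[of "u \<circ> F"]) (use u sum.reindex[OF True, of "\<lambda>v. u v *s v"] in \<open>auto simp: o_def\<close>)
qed

lemma invertible_columns:
  fixes v :: "'n::finite \<Rightarrow> 'a::field ^ 'n"
  assumes "inj v" "vec.independent (range v)"
  shows "invertible (\<chi> i j. v j $ i)"
proof -
  let ?A = "(\<chi> i j. v j $ i) :: 'a ^ 'n ^ 'n"
  have "x = 0" if "?A *v x = 0" for x
  proof -
    have "(\<Sum>j\<in>UNIV. x $ j *s v j) = 0"
      using that by (simp add: vec_eq_iff matrix_vector_mult_def mult.commute)
    then have "(\<Sum>w\<in>range v. x $ inv_into UNIV v w *s w) = 0"
      by (simp add: sum.reindex[OF assms(1)] assms(1))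
    then have "\<forall>w\<in>range v. x $ inv_into UNIV v w = 0"
      using assms(2) vec.dependent_finite[of "range v"] by auto
    then show ?thesis using assms(1) by (simp add: vec_eq_iff)
  qed
  then show ?thesis
    by (simp add: invertible_left_inverse matrix_left_invertible_ker)
qed

lemma exists_basis_starting_with:
  fixes u v :: "'a::field ^ 5"
  assumes "u \<noteq> v" "vec.independent {u, v}"
  obtains B :: "'a ^ 5 ^ 5" where "invertible B" "B *v axis 1 1 = u" "B *v axis 2 1 = v"
proof -
  let ?S = "vec.extend_basis {u, v}"
  have S: "{u, v} \<subseteq> ?S" "vec.independent ?S" "vec.span ?S = UNIV"
    using vec.extend_basis_superset vec.independent_extend_basis vec.span_extend_basis assms(2) by blast+
  have "card ?S = CARD(5)"
    by (metis S(2,3) vec.dim_eq_card_independent vec.dim_span vec_dim_card)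
  moreover have fin: "finite ?S" using S(2) vec.finiteI_independent by blast
  ultimately have "card (UNIV - {1, 2 :: 5}) = card (?S - {u, v})"
    using S(1) assms(1) by (simp add: card_Diff_subset)
  then obtain b where b: "bij_betw b (UNIV - {1, 2 :: 5}) (?S - {u, v})"
    using fin by (metis finite_Diff finite_same_card_bij finite_class.finite_UNIV)
  define w where "w j = (if j = 1 then u else if j = 2 then v else b j)" for j
  have "bij_betw w {1, 2} {u, v}" using assms(1) by (auto simp: bij_betw_def w_def)
  moreover have "bij_betw w (UNIV - {1, 2}) (?S - {u, v})"
    using b by (rule bij_betw_cong[THEN iffD1, rotated]) (simp add: w_def)
  ultimately have "bij_betw w ({1, 2} \<union> (UNIV - {1, 2})) ({u, v} \<union> (?S - {u, v}))"
    by (rule bij_betw_combine) blast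
  moreover have "{1, 2} \<union> (UNIV - {1, 2}) = (UNIV :: 5 set)" "{u, v} \<union> (?S - {u, v}) = ?S"
    using S(1) by blast+
  ultimately have "bij_betw w UNIV ?S" by simp
  then have "inj w" "range w \<subseteq> ?S" by (auto simp: bij_betw_def)
  then have "vec.independent (range w)" using S(2) vec.independent_mono by blast
  then have "invertible ((\<chi> i j. w j $ i) :: 'a ^ 5 ^ 5)" using \<open>inj w\<close> invertible_columns by blast
  moreover have "(\<chi> i j. w j $ i) *v axis k 1 = w k" for k
    by (simp add: vec_eq_iff mult_axis_entry)
  ultimately show ?thesis by (intro that[of "\<chi> i j. w j $ i"]) (simp_all add: w_def)
qed

lemma nonscalar_moves_a_vector:
  fixes A :: "'a::field ^ 'n ^ 'n"
  assumes "\<And>c. A \<noteq> mat c"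
  obtains v where "A *v v \<noteq> v" "vec.independent {v, A *v v}"
proof -
  have "\<exists>v. \<forall>c. A *v v \<noteq> c *s v"
  proof (rule ccontr)
    assume "\<not> (\<exists>v. \<forall>c. A *v v \<noteq> c *s v)"
    then obtain c where c: "\<And>v. A *v v = c v *s v" by metis
    have "c (axis i 1) = c (axis j 1)" for i j
    proof (cases "i = j")
      case False
      let ?s = "axis i 1 + axis j 1"
      have "c ?s *s ?s = c (axis i 1) *s axis i 1 + c (axis j 1) *s axis j 1"
        using c[of ?s] c[of "axis i 1"] c[of "axis j 1"] by (simp add: matrix_vector_right_distrib)
      then have "(c ?s *s ?s) $ k = (c (axis i 1) *s axis i 1 + c (axis j 1) *s axis j 1) $ k" for k by simp
      from this[of i] this[of j] False show ?thesis by (simp add: axis_def)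
    qed simp
    then obtain d where d: "\<And>i. c (axis i 1) = d" by metis
    have "A $ i $ j = mat d $ i $ j" for i j
    proof -
      have "A $ i $ j = (A *v axis j 1) $ i" by (simp add: mult_axis_entry)
      also have "\<dots> = mat d $ i $ j" by (simp add: c d) (simp add: axis_def mat_def)
      finally show ?thesis .
    qed
    then show False using assms[of d] by (simp add: vec_eq_iff)
  qed
  then obtain v where v: "\<And>c. A *v v \<noteq> c *s v" by auto
  have "v \<noteq> 0" using v[of 0] by auto
  moreover have "A *v v \<notin> vec.span {v}" using v by (auto simp: vec.span_singleton)
  ultimately have "vec.independent (insert (A *v v) (insert v {}))"
    by (intro vec.independent_insertI) (simp_all add: vec.independent_empty)
  then have "vec.independent {v, A *v v}" by (simp add: insert_commute)
  moreover have "A *v v \<noteq> v" using v[of 1] by simp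
  ultimately show ?thesis by (rule that[rotated])
qed

text \<open>
  Each \<open>v\<close> is half the sum of the eigenvectors \<open>v + av\<close> and \<open>v - av\<close>, so the eigenvectors span and
  contain a basis.
\<close>

lemma involution_diagonalizable:
  fixes a :: "'a::field_char_0 ^ 'n ^ 'n"
  assumes "a ** a = mat 1"
  obtains P :: "'a ^ 'n ^ 'n" and d where "invertible P" "\<And>i. d i = 1 \<or> d i = (- 1 :: 'a)" "a ** P = (\<chi> i j. P $ i $ j * d j)"
proof -
  let ?S = "{v. a *v v = v \<or> a *v v = - v}"
  obtain T where T: "T \<subseteq> ?S" "vec.independent T" "?S \<subseteq> vec.span T"
    using vec.maximal_independent_subset by blast
  have "v \<in> vec.span T" for v
  proof -
    let ?p = "v + a *v v" and ?m = "v - a *v v"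
    have aa: "a *v (a *v v) = v" by (simp add: matrix_vector_mul_assoc assms)
    have "?p \<in> ?S" "?m \<in> ?S"
      by (auto simp: matrix_vector_right_distrib matrix_vector_mult_diff_distrib aa add.commute)
    then have "(1 / 2) *s (?p + ?m) \<in> vec.span T"
      using T(3) by (intro vec.span_scale vec.span_add[of ?p _ ?m] subsetD[OF T(3)])
    moreover have "(1 / 2) *s (?p + ?m) = v"
      by (simp add: vec_eq_iff field_simps)
    ultimately show ?thesis by simp
  qed
  then have "card T = CARD('n)"
    by (metis (no_types, opaque_lifting) T(2) UNIV_eq_I vec.dim_eq_card_independent vec.dim_span vec_dim_card)
  moreover have "finite T" using T(2) vec.finiteI_independent by blast
  ultimately obtain w where w: "bij_betw w (UNIV :: 'n set) T"
    by (metis finite_same_card_bij finite_class.finite_UNIV)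
  let ?P = "(\<chi> i j. w j $ i) :: 'a ^ 'n ^ 'n"
  define d where "d j = (if a *v w j = w j then 1 else - 1 :: 'a)" for j
  have "w j \<in> ?S" for j using w T(1) by (auto simp: bij_betw_def)
  then have "a *v w j = d j *s w j" for j by (auto simp: d_def)
  then have "(a *v w j) $ i = d j * w j $ i" for i j by simp
  then have "a ** ?P = (\<chi> i j. ?P $ i $ j * d j)"
    by (simp add: vec_eq_iff matrix_matrix_mult_def matrix_vector_mult_def mult.commute)
  moreover have "invertible ?P"
    using w T(2) by (intro invertible_columns) (auto simp: bij_betw_def)
  ultimately show ?thesis by (intro that[of ?P d]) (auto simp: d_def)
qed

text \<open>
  The dimension of the centraliser of a diagonal matrix with entries \<open>\<plusminus>1\<close>: if \<open>1\<close> occurs \<open>p\<close> times and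
  \<open>-1\<close> occurs \<open>q = 10 - p\<close> times, it is \<open>p\<^sup>2 + q\<^sup>2\<close>.
\<close>

lemma card_equal_signs:
  fixes d :: "10 \<Rightarrow> 'a::ring_char_0"
  assumes "\<And>i. d i = 1 \<or> d i = - 1"
  shows "25 < card {(i, j). d i = d j}"
proof -
  let ?S = "{i. d i = 1}"
  have eq: "{(i, j). d i = d j} = ?S \<times> ?S \<union> (- ?S) \<times> (- ?S)"
    using assms by auto (metis one_neq_neg_one)+
  have "card {(i, j). d i = d j} = card ?S * card ?S + card (- ?S) * card (- ?S)"
    unfolding eq by (subst card_Un_disjoint) (auto simp: card_cartesian_product)
  moreover have "card ?S + card (- ?S) = 10"
    using card_Un_disjoint[of ?S "- ?S"] by simp
  moreover have "25 < p * p + q * q" if "p + q = 10" for p q :: nat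
  proof -
    consider "p \<ge> 6" | "q \<ge> 6" | "p = 5" "q = 5" using \<open>p + q = 10\<close> by linarith
    then show ?thesis
    proof cases
      case 1 then show ?thesis using mult_le_mono[of 6 p 6 p] by simp
    next
      case 2 then show ?thesis using mult_le_mono[of 6 q 6 q] by simp
    qed simp
  qed
  ultimately show ?thesis by metis
qed

text \<open>
  Linear relations between three matrices pass to linear combinations; this transfers relations known on
  basis elements.
\<close>

lemma linear_combination_closed:
  fixes rel :: "'a::comm_ring_1 ^ 'p ^ 'q \<Rightarrow> 'a ^ 'r ^ 's \<Rightarrow> 'a ^ 't ^ 'u \<Rightarrow> bool"
  assumes "rel 0 0 0"
    and "\<And>X Y Z X' Y' Z'. rel X Y Z \<Longrightarrow> rel X' Y' Z' \<Longrightarrow> rel (X + X') (Y + Y') (Z + Z')"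
    and "\<And>c X Y Z. rel X Y Z \<Longrightarrow> rel (mat c ** X) (mat c ** Y) (mat c ** Z)"
    and "\<And>i. i \<in> I \<Longrightarrow> rel (X i) (Y i) (Z i)"
  shows "rel (\<Sum>i\<in>I. mat (c i) ** X i) (\<Sum>i\<in>I. mat (c i) ** Y i) (\<Sum>i\<in>I. mat (c i) ** Z i)"
  using assms(4) by (induction I rule: infinite_finite_induct) (simp_all add: assms(1-3))

lemma sum_mat_entry:
  fixes M :: "'b \<Rightarrow> 'a::comm_ring_1 ^ 'n ^ 'm"
  shows "(\<Sum>b\<in>I. mat (c b) ** M b) $ i $ j = (\<Sum>b\<in>I. c b * M b $ i $ j)"
  by (simp add: sum_entry mat_mult_entry)

section \<open>Stabilisers acting trivially\<close>

lemma two_more_indices: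
  obtains l m :: 5 where "l \<noteq> m" "l \<notin> {1, 2, k}" "m \<notin> {1, 2, k}"
proof -
  have "card {1, 2, k} \<le> 3" by (rule card_insert_le_m1; simp)+
  then have "card (- {1, 2, k}) \<ge> 2" by (simp add: Compl_eq_Diff_UNIV card_Diff_subset)
  then obtain T where T: "T \<subseteq> - {1, 2, k}" "card T = 2" by (meson obtain_subset_with_card_n)
  then obtain l m where "T = {l, m}" "l \<noteq> m" by (meson card_2_iff)
  then show ?thesis using that T(1) by auto
qed

lemma one_more_index:
  obtains j :: 5 where "j \<notin> {1, 2, i, k}"
proof -
  obtain l m :: 5 where "l \<noteq> m" "l \<notin> {1, 2, k}" "m \<notin> {1, 2, k}" by (rule two_more_indices)
  then show ?thesis using that by (metis insert_iff empty_iff)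
qed

text \<open>
  The left-hand side of the assumption has no component \<open>e\<^sub>i \<and> e\<^sub>j\<close> with \<open>i, j\<close> both outside \<open>{1, 2}\<close>.
  So the endomorphism of \<open>V / \<langle>e\<^sub>1, e\<^sub>2\<rangle>\<close> induced by \<open>Z\<close> acts as zero on the exterior square, which
  for a three-dimensional space forces it to vanish.  The off-diagonal entries vanish individually; for
  the diagonal ones only the sums of two are seen to vanish, which suffices as there are three of them.
\<close>

lemma derivation_into_plane:
  fixes Z :: "'a::field_char_0 ^ 5 ^ 5" and r p :: "'a ^ 5 \<Rightarrow> 'a ^ 5 \<Rightarrow> 'a ^ 5"
  assumes eq: "\<And>u v. wedge (axis 2 1) (r u v) - wedge (axis 1 1) (p u v) =
      wedge (Z *v u) v + wedge u (Z *v v)"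
    and i: "i \<notin> {1, 2}"
  shows "Z $ i $ k = 0"
proof -
  have comp: "Z $ i $ k * axis j 1 $ j - axis j 1 $ i * Z $ j $ k + (axis k 1 $ i * Z $ j $ j - Z $ i $ j * axis k 1 $ j) = 0"
    if "i \<notin> {1, 2}" "j \<notin> {1, 2}" for i j k
    using arg_cong[OF eq[of "axis k 1" "axis j 1"], of "\<lambda>M. M $ i $ j"] that
    by (simp add: wedge_entry mult_axis_entry) (simp add: axis_def)
  have diag: "Z $ i $ i + Z $ j $ j = 0" if "i \<notin> {1, 2}" "j \<notin> {1, 2}" "i \<noteq> j" for i j
    using comp[OF that(1,2), of i] that(3) by (simp add: axis_def)
  show ?thesis
  proof (cases "k = i")
    case False
    obtain j where j: "j \<notin> {1, 2, i, k}" by (rule one_more_index)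
    then show ?thesis using comp[of i j k] i False by (auto simp: axis_def)
  next
    case True
    obtain j l where "j \<noteq> l" "j \<notin> {1, 2, i}" "l \<notin> {1, 2, i}" by (rule two_more_indices)
    then have "Z $ i $ i + Z $ j $ j = 0" "Z $ i $ i + Z $ l $ l = 0" "Z $ j $ j + Z $ l $ l = 0"
      using diag i by auto
    then have "2 * Z $ i $ i = 0" by algebra
    then show ?thesis using True by simp
  qed
qed

context ext2_field_change
begin

text \<open>
  The map \<open>w \<mapsto> e\<^sub>1 \<and> Qw\<close> from \<open>W\<close> to \<open>W\<close>.
\<close>

definition wedge_op :: "'a ^ 10 ^ 5 \<Rightarrow> 'a ^ 10 ^ 10" where
  "wedge_op Q = (\<chi> r s. phi_bc \<phi> f (wedge (axis 1 1) (Q *v axis s 1)) $ r)"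

lemma wedge_op_apply: "wedge_op Q *v w = phi_bc \<phi> f (wedge (axis 1 1) (Q *v w))"
  unfolding wedge_op_def
  by (rule matrix_of_linear)
    (simp_all add: matrix_vector_right_distrib wedge_add_right phi_bc_linear vec.scale wedge_scale_right
      vector_smult_assoc)

lemma wedge_op_add: "wedge_op (P + Q) = wedge_op P + wedge_op Q"
  by (simp add: matrix_eq wedge_op_apply matrix_vector_mult_add_rdistrib wedge_add_right phi_bc_linear)

lemma wedge_op_scale: "wedge_op (mat c ** Q) = mat c ** wedge_op Q"
  by (simp add: matrix_eq wedge_op_apply scaled_matrix_vector_mult wedge_scale_right phi_bc_linear)

text \<open>
  Write \<open>p(u,v) = Q(u \<and> v)\<close>, with values in \<open>\<langle>e\<^sub>3, e\<^sub>4, e\<^sub>5\<rangle>\<close>, and \<open>r(u,v) = A p(A\<^sup>-\<^sup>1u, A\<^sup>-\<^sup>1v)\<close>.  As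
  \<open>A e\<^sub>1 = e\<^sub>2\<close>, the hypothesis says \<open>e\<^sub>2 \<and> r(u,v) - e\<^sub>1 \<and> p(u,v) = Zu \<and> v + u \<and> Zv\<close>.  Then
  only the first row \<open>\<alpha>\<close> of \<open>Z\<close> can be nonzero, and the \<open>e\<^sub>1\<close>-components give
  \<open>p(u,v) = \<alpha>(v)u - \<alpha>(u)v\<close> modulo \<open>e\<^sub>1, e\<^sub>2\<close>.  The \<open>e\<^sub>2\<close>-components show that \<open>A\<close> maps the values of \<open>p\<close>
  to \<open>\<langle>e\<^sub>1, e\<^sub>2\<rangle>\<close>; since it maps \<open>e\<^sub>1\<close> there too, the values of \<open>p\<close> all lie on one line.  This is
  incompatible with the formula for \<open>p\<close> unless \<open>\<alpha> = 0\<close>.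
\<close>

lemma wedge_op_in_stab_trivial:
  assumes A: "invertible A" "A *v axis 1 1 = axis 2 1"
    and Q: "\<And>s. Q $ 1 $ s = 0" "\<And>s. Q $ 2 $ s = 0"
    and eq: "ext_mat \<phi> f A ** wedge_op Q ** matrix_inv (ext_mat \<phi> f A) - wedge_op Q = der_mat \<phi> f Z"
    and Z2: "\<And>k. Z $ 2 $ k = 0"
  shows "Q = 0"
proof -
  let ?a = "ext_mat \<phi> f A" and ?phi = "phi_bc \<phi> f" and ?e = "\<lambda>i. axis i 1 :: 'a ^ 5"
  define p where "p u v = Q *v ?phi (wedge u v)" for u v
  define r where "r u v = A *v p (matrix_inv A *v u) (matrix_inv A *v v)" for u v
  have inv: "invertible ?a" by (rule ext_mat_invertible[OF A(1)])
  have comm: "?a ** wedge_op Q - wedge_op Q ** ?a = der_mat \<phi> f Z ** ?a"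
    unfolding eq[symmetric] by (simp add: matrix_diff_distrib matrix_inv_cancel[OF inv])
  have rel: "wedge (?e 2) (A *v p x y) - wedge (?e 1) (p (A *v x) (A *v y)) =
      wedge (Z *v (A *v x)) (A *v y) + wedge (A *v x) (Z *v (A *v y))" for x y
  proof (rule phi_inj)
    have "?phi (wedge (?e 2) (A *v p x y)) - ?phi (wedge (?e 1) (p (A *v x) (A *v y))) =
        (?a ** wedge_op Q - wedge_op Q ** ?a) *v ?phi (wedge x y)"
      by (simp add: matrix_vector_mult_diff_rdistrib matrix_vector_mul_assoc[symmetric] wedge_op_apply
          ext_mat_phi wedge_in_ext2 ext2_map_wedge A(2) p_def)
    also have "\<dots> = ?phi (wedge (Z *v (A *v x)) (A *v y) + wedge (A *v x) (Z *v (A *v y)))"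
      by (simp add: comm matrix_vector_mul_assoc[symmetric] ext_mat_phi wedge_in_ext2 ext2_map_wedge
          der_mat_phi ext2_der_wedge)
    finally show "?phi (wedge (?e 2) (A *v p x y) - wedge (?e 1) (p (A *v x) (A *v y))) =
        ?phi (wedge (Z *v (A *v x)) (A *v y) + wedge (A *v x) (Z *v (A *v y)))"
      using phi_bc_linear(1)[of \<phi> f "wedge (?e 2) (A *v p x y) - wedge (?e 1) (p (A *v x) (A *v y))"
          "wedge (?e 1) (p (A *v x) (A *v y))"] by (simp add: algebra_simps)
    have "wedge (?e 1) (- p (A *v x) (A *v y)) = - wedge (?e 1) (p (A *v x) (A *v y))"
      by (simp add: vec_eq_iff wedge_entry)
    then show "wedge (?e 2) (A *v p x y) - wedge (?e 1) (p (A *v x) (A *v y)) \<in> ext2"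
      by (metis diff_conv_add_uminus ext2_add wedge_in_ext2)
    show "wedge (Z *v (A *v x)) (A *v y) + wedge (A *v x) (Z *v (A *v y)) \<in> ext2"
      by (intro ext2_add wedge_in_ext2)
  qed
  have AA: "A *v (matrix_inv A *v u) = u" "matrix_inv A *v (A *v u) = u" for u
    by (simp_all add: matrix_vector_mul_assoc matrix_inv_left matrix_inv_right A(1))
  have rel': "wedge (?e 2) (r u v) - wedge (?e 1) (p u v) = wedge (Z *v u) v + wedge u (Z *v v)" for u v
    using rel[of "matrix_inv A *v u" "matrix_inv A *v v"] by (simp add: r_def AA)
  \<comment> \<open>So \<open>Z\<close> has its image in the span of the first two basis vectors.\<close>
  have Z3: "Z $ i $ k = 0" if "i \<notin> {1, 2}" for i k
    by (rule derivation_into_plane[OF rel' that])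
  have Zu: "(Z *v u) $ i = 0" if "i \<noteq> 1" for u i
  proof -
    have "Z $ i $ k = 0" for k using Z2 Z3[of i k] that by (cases "i = 2") auto
    then show ?thesis by (simp add: matrix_vector_mult_def)
  qed
  have p12: "p u v $ 1 = 0" "p u v $ 2 = 0" for u v
    by (simp_all add: p_def matrix_vector_mult_def Q)
  have pj: "p u v $ j = (Z *v v) $ 1 * u $ j - (Z *v u) $ 1 * v $ j" if "j \<notin> {1, 2}" for u v j
    using arg_cong[OF rel'[of u v], of "\<lambda>M. M $ 1 $ j"] that Zu[of j]
    by (simp add: wedge_entry) (simp add: axis_def algebra_simps)
  have rj: "r u v $ j = 0" if "j \<notin> {1, 2}" for u v j
    using arg_cong[OF rel'[of u v], of "\<lambda>M. M $ 2 $ j"] that Zu[of j] Zu[of 2]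
    by (simp add: wedge_entry) (simp add: axis_def)
  define g where "g = matrix_inv A *v ?e 1"
  \<comment> \<open>All values of \<open>p\<close> are multiples of \<open>A\<^sup>-\<^sup>1 e\<^sub>1\<close> modulo \<open>e\<^sub>1, e\<^sub>2\<close>.\<close>
  have proportional: "\<exists>c. \<forall>j. j \<notin> {1, 2} \<longrightarrow> p u v $ j = c * g $ j" for u v
  proof -
    let ?z = "A *v p u v"
    have "?z $ j = 0" if "j \<notin> {1, 2}" for j
      using rj[OF that, of "A *v u" "A *v v"] by (simp add: r_def AA)
    then have "?z = ?z $ 1 *s ?e 1 + ?z $ 2 *s ?e 2"
      by (auto simp: vec_eq_iff axis_def)
    then have "matrix_inv A *v ?z = matrix_inv A *v (?z $ 1 *s ?e 1 + ?z $ 2 *s ?e 2)" by simp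
    also have "\<dots> = ?z $ 1 *s g + ?z $ 2 *s ?e 1"
      by (simp add: matrix_vector_right_distrib vec.scale g_def A(2)[symmetric] AA)
    finally have eq: "p u v = ?z $ 1 *s g + ?z $ 2 *s ?e 1" by (simp add: AA)
    have "p u v $ j = ?z $ 1 * g $ j" if "j \<notin> {1, 2}" for j
      using that arg_cong[OF eq, of "\<lambda>v. v $ j"] by (simp add: axis_def)
    then show ?thesis by blast
  qed
  have Z1: "Z $ 1 $ k = 0" for k
  proof (rule ccontr)
    assume k: "Z $ 1 $ k \<noteq> 0"
    obtain l m where lm: "l \<noteq> m" "l \<notin> {1, 2, k}" "m \<notin> {1, 2, k}" by (rule two_more_indices)
    \<comment> \<open>Here \<open>p(e\<^sub>l, e\<^sub>k)\<close> has \<open>l\<close>-th component \<open>\<alpha>(e\<^sub>k) \<noteq> 0\<close> and \<open>m\<close>-th component \<open>0\<close>; exchanging \<open>l\<close> and \<open>m\<close>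
        gives a contradiction.\<close>
    have *: "g $ m = 0 \<and> g $ l \<noteq> 0" if lm: "l \<noteq> m" "l \<notin> {1, 2, k}" "m \<notin> {1, 2, k}" for l m
    proof -
      obtain c where c: "\<And>j. j \<notin> {1, 2} \<Longrightarrow> p (?e l) (?e k) $ j = c * g $ j"
        using proportional[of "?e l" "?e k"] by auto
      have "c * g $ l = Z $ 1 $ k" "c * g $ m = 0"
        using c[of l] c[of m] pj[of l "?e l" "?e k"] pj[of m "?e l" "?e k"] lm
        by (simp_all add: mult_axis_entry) (simp_all add: axis_def)
      then show ?thesis using k by auto
    qed
    show False using *[OF lm] *[of m l] lm by auto
  qed
  have "p u v = 0" for u v
  proof -
    have "(Z *v u) $ 1 = 0" for u by (simp add: matrix_vector_mult_def Z1)
    then have "p u v $ j = 0" for j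
      using p12 pj[of j u v] by (cases "j = 1"; cases "j = 2") auto
    then show ?thesis by (simp add: vec_eq_iff)
  qed
  then have wedge: "Q *v ?phi (wedge u v) = 0" for u v by (simp add: p_def)
  have "Q *v ?phi M = 0" if "M \<in> ext2" for M using that
  proof (induction rule: ext2_induct)
    case zero
    have "?phi 0 = 0" by (simp add: vec_eq_iff phi_bc_pairs)
    then show ?case by simp
  next
    case (add M N)
    then show ?case by (simp add: phi_bc_linear matrix_vector_right_distrib)
  next
    case (scale c M)
    then show ?case by (simp add: phi_bc_linear vec.scale)
  next
    case (wedge u v)
    show ?case by fact
  qed
  then have "Q *v w = 0" for w
    using psi_bc_in_ext2[of w] phi_psi[of w] by metis
  then show ?thesis by (simp add: matrix_eq)
qed

end

context ext2_field_change
begin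

text \<open>
  The dimension count.  Each \<open>q = wedge_op Q\<close> comes with \<open>Z\<^sub>1, Z\<^sub>2\<close> such that
  \<open>a q a\<^sup>-\<^sup>1 - q = D(Z\<^sub>1) + h D(Z\<^sub>2) h\<^sup>-\<^sup>1\<close>.  If \<open>Z\<^sub>2\<close> and the second row of \<open>Z\<^sub>1\<close> vanish, then \<open>q = 0\<close>.  These
  are \<open>30\<close> linear conditions on a space of \<open>q\<close> of dimension \<open>30\<close>, so one more unknown is needed to force a
  nonzero solution.  It comes from the relation \<open>0 = D(-1) + h D(1) h\<^sup>-\<^sup>1\<close>, which
  expresses that the two subspaces share the scalars.
\<close>

lemma no_trivial_action_moving_vector:
  assumes A: "invertible A" "A *v axis 1 1 = axis 2 1" and h: "invertible h"
    and triv: "\<And>X. \<exists>Z1 Z2. ext_mat \<phi> f A ** X ** matrix_inv (ext_mat \<phi> f A) - X =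
      der_mat \<phi> f Z1 + h ** der_mat \<phi> f Z2 ** matrix_inv h"
  shows False
proof -
  let ?a = "ext_mat \<phi> f A" and ?I = "insert None (Some ` ((- {1, 2}) \<times> UNIV)) :: (5 \<times> 10) option set"
  define rel where "rel Q Z1 Z2 \<longleftrightarrow> ?a ** wedge_op Q ** matrix_inv ?a - wedge_op Q =
    der_mat \<phi> f Z1 + h ** der_mat \<phi> f Z2 ** matrix_inv h" for Q Z1 Z2
  define Q :: "(5 \<times> 10) option \<Rightarrow> 'a ^ 10 ^ 5" where
    "Q b = (case b of None \<Rightarrow> 0 | Some p \<Rightarrow> (\<chi> k t. if p = (k, t) then 1 else 0))" for b
  have zero: "der_mat \<phi> f 0 = 0" "wedge_op 0 = 0"
    using der_mat_scale[of 0 0] wedge_op_scale[of 0 0] by (simp_all add: matrix_matrix_mult_def zero_vec_def[symmetric])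
  have "\<exists>Z1 Z2. rel (Q b) Z1 Z2 \<and> (b = None \<longrightarrow> Z2 = mat 1)" for b
  proof (cases b)
    case None
    \<comment> \<open>The index \<open>None\<close> carries the relation that comes from the common scalars.\<close>
    have "rel 0 (mat (- 1)) (mat 1)"
      using matrix_inv_right[OF h]
      by (simp add: rel_def zero der_mat_one mat_central[of h] matrix_mul_assoc[symmetric])
        (simp add: vec_eq_iff mat_def matrix_matrix_mult_def)
    then show ?thesis using None by (auto simp: Q_def)
  next
    case (Some p)
    then show ?thesis using triv[of "wedge_op (Q b)"] by (auto simp: rel_def)
  qed
  then obtain Z1 Z2 where Z: "\<And>b. rel (Q b) (Z1 b) (Z2 b)" "Z2 None = mat 1" by metis
  define F :: "(5 \<times> 10) option \<Rightarrow> 'a ^ ((5 \<times> 5) + 5)" where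
    "F b = (\<chi> x. case x of Inl p \<Rightarrow> Z2 b $ fst p $ snd p | Inr j \<Rightarrow> Z1 b $ 2 $ j)" for b
  have "card (- {1, 2 :: 5}) = 3" by (simp add: Compl_eq_Diff_UNIV card_Diff_subset)
  then have card: "card ?I = 31"
    by (subst card_insert_disjoint) (auto simp: card_image card_cartesian_product)
  have fin: "finite ?I" by simp
  have small: "CARD((5 \<times> 5) + 5) < card ?I" unfolding card by simp
  obtain c where c: "\<exists>b\<in>?I. c b \<noteq> 0" "(\<Sum>b\<in>?I. c b *s F b) = 0"
    by (rule linear_relation_exists[OF fin small, of F])
  let ?sum = "\<lambda>M. \<Sum>b\<in>?I. mat (c b) ** M b"
  have r: "rel (?sum Q) (?sum Z1) (?sum Z2)"
  proof (rule linear_combination_closed)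
    show "rel 0 0 0" by (simp add: rel_def zero matrix_matrix_mult_def zero_vec_def[symmetric])
  next
    fix X Y Z X' Y' Z' assume "rel X Y Z" "rel X' Y' Z'"
    then show "rel (X + X') (Y + Y') (Z + Z')"
      by (simp add: rel_def wedge_op_add der_mat_add matrix_add_distrib algebra_simps)
  next
    fix d X Y Z assume *: "rel X Y Z"
    have "?a ** (mat d ** wedge_op X) ** matrix_inv ?a - mat d ** wedge_op X =
        mat d ** (?a ** wedge_op X ** matrix_inv ?a - wedge_op X)"
      by (simp only: conj_scaled matrix_diff_distrib)
    also have "\<dots> = mat d ** der_mat \<phi> f Y + h ** (mat d ** der_mat \<phi> f Z) ** matrix_inv h"
      using * by (simp only: rel_def conj_scaled matrix_add_distrib)
    finally show "rel (mat d ** X) (mat d ** Y) (mat d ** Z)"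
      by (simp add: rel_def wedge_op_scale der_mat_scale)
  qed (rule Z(1))
  have F: "(\<Sum>b\<in>?I. c b * F b $ x) = 0" for x
    using arg_cong[OF c(2), of "\<lambda>v. v $ x"] by simp
  have "?sum Z2 $ i $ j = 0" for i j
    unfolding sum_mat_entry using F[of "Inl (i, j)"] by (simp add: F_def)
  then have Z2: "?sum Z2 = 0" by (simp only: vec_eq_iff zero_index) blast
  have row: "?sum Z1 $ 2 $ k = 0" for k
    unfolding sum_mat_entry using F[of "Inr k"] by (simp add: F_def)
  have Qrow: "?sum Q $ i $ t = 0" if "i \<in> {1, 2}" for i t
    unfolding sum_mat_entry using that by (intro sum.neutral) (auto simp: Q_def)
  have Q0: "?sum Q = 0"
  proof (rule wedge_op_in_stab_trivial[OF A])
    show "?a ** wedge_op (?sum Q) ** matrix_inv ?a - wedge_op (?sum Q) = der_mat \<phi> f (?sum Z1)"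
      using r unfolding rel_def Z2 zero by (simp add: matrix_matrix_mult_def zero_vec_def[symmetric])
  qed (use row Qrow in simp_all)
  have some: "c (Some (i, t)) = 0" if "i \<notin> {1, 2}" for i t
  proof -
    have "(\<Sum>b\<in>?I. c b * Q b $ i $ t) = (\<Sum>b\<in>?I. if b = Some (i, t) then c b else 0)"
      by (rule sum.cong) (auto simp: Q_def split: option.splits)
    also have "\<dots> = c (Some (i, t))" using that by (simp add: sum.delta)
    also have "(\<Sum>b\<in>?I. c b * Q b $ i $ t) = ?sum Q $ i $ t" by (rule sum_mat_entry[symmetric])
    finally show ?thesis by (simp only: Q0 zero_index)
  qed
  have "c None = 0"
  proof -
    have "(\<Sum>b\<in>?I. c b * Z2 b $ 1 $ 1) = (\<Sum>b\<in>{None}. c b * Z2 b $ 1 $ 1)"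
      by (rule sum.mono_neutral_right) (auto simp: some)
    also have "\<dots> = c None" by (simp add: Z(2) mat_def)
    also have "(\<Sum>b\<in>?I. c b * Z2 b $ 1 $ 1) = ?sum Z2 $ 1 $ 1" by (rule sum_mat_entry[symmetric])
    finally show ?thesis by (simp only: Z2 zero_index)
  qed
  then show False using c(1) some by auto
qed

text \<open>
  If \<open>A\<close> is not a scalar, conjugation by \<open>g = g\<^sub>1 \<and>\<^sup>2B\<close>, for a basis \<open>B\<close> that starts with some \<open>v\<close>
  and \<open>Av\<close>, reduces to the normalised situation of \<open>no_trivial_action_moving_vector\<close>.
\<close>

lemma trivial_action_scalar:
  assumes inv: "invertible a" "invertible g1" "invertible g2"
    and a: "a ** g1 = g1 ** h" "h \<in> H_lift \<phi> f"
    and triv: "\<And>X. \<exists>Y\<in>stab_alg \<phi> f g1. \<exists>Y'\<in>stab_alg \<phi> f g2. a ** X ** matrix_inv a - X = Y + Y'"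
  shows "\<exists>c. c \<noteq> 0 \<and> a = mat c"
proof -
  obtain c A where h: "h = mat c ** ext_mat \<phi> f A" "c dvd 1" "invertible A"
    using a(2) by (auto simp: H_lift_def)
  have c0: "c \<noteq> 0" using h(2) by auto
  show ?thesis
  proof (cases "\<exists>d. A = mat d")
    case True
    then obtain d where d: "A = mat d" by auto
    have "h = mat (c * (d * d))"
      using ext_mat_scale[of d "mat 1"] by (simp add: h(1) d mat_mult_mat)
    then have "a ** g1 = mat (c * (d * d)) ** g1" using a(1) by (simp add: mat_central)
    then have "a = mat (c * (d * d))" by (metis inv(2) matrix_inv_cancel(3))
    moreover have "a \<noteq> mat 0"
    proof
      assume "a = mat 0"
      then have "(mat 1 :: 'a ^ 10 ^ 10) $ 1 $ 1 = (mat 0 ** matrix_inv a) $ 1 $ 1"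
        using matrix_inv_right[OF inv(1)] by metis
      then show False unfolding mat_mult_entry by (simp add: mat_def)
    qed
    ultimately show ?thesis by (metis mat_0)
  next
    case False
    then obtain v where v: "A *v v \<noteq> v" "vec.independent {v, A *v v}"
      by (metis nonscalar_moves_a_vector)
    obtain B :: "'a ^ 5 ^ 5" where B: "invertible B" "B *v axis 1 1 = v" "B *v axis 2 1 = A *v v"
      by (rule exists_basis_starting_with[OF v(1)[symmetric] v(2)])
    define A' where "A' = matrix_inv B ** A ** B"
    define g where "g = g1 ** ext_mat \<phi> f B"
    have A': "invertible A'"
      unfolding A'_def by (intro invertible_mult invertible_matrix_inv B h(3))
    have A'e: "A' *v axis 1 1 = axis 2 1"
      by (simp add: A'_def matrix_vector_mul_assoc[symmetric] B(2) B(3)[symmetric])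
        (simp add: matrix_vector_mul_assoc matrix_inv_left B(1))
    have BA: "A ** B = B ** A'" by (simp add: A'_def matrix_mul_assoc matrix_inv_right[OF B(1)])
    have g: "invertible g" unfolding g_def by (intro invertible_mult inv ext_mat_invertible B)
    let ?a = "ext_mat \<phi> f A'"
    have a': "invertible ?a" by (rule ext_mat_invertible[OF A'])
    have "a ** g = g1 ** h ** ext_mat \<phi> f B" by (simp add: g_def matrix_mul_assoc a(1))
    also have "\<dots> = g1 ** (mat c ** ext_mat \<phi> f (A ** B))"
      by (simp add: h(1) ext_mat_mult matrix_mul_assoc)
    also have "\<dots> = g ** (mat c ** ?a)"
      unfolding BA ext_mat_mult g_def matrix_mul_assoc[symmetric]
      by (subst mat_left_commute) (rule refl)
    finally have ag: "a ** g = g ** (mat c ** ?a)" .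
    have st: "stab_alg \<phi> f g1 = stab_alg \<phi> f g"
      unfolding g_def using stab_alg_H_lift[OF inv(2) H_lift_ext_mat[OF B(1)]] by simp
    let ?k = "matrix_inv g ** g2"
    have k: "invertible ?k" by (intro invertible_mult invertible_matrix_inv g inv)
    have "\<exists>Z1 Z2. ?a ** X ** matrix_inv ?a - X = der_mat \<phi> f Z1 + ?k ** der_mat \<phi> f Z2 ** matrix_inv ?k" for X
    proof -
      obtain Y Y' where Y: "Y \<in> stab_alg \<phi> f g" "Y' \<in> stab_alg \<phi> f g2"
        "a ** (g ** X ** matrix_inv g) ** matrix_inv a - g ** X ** matrix_inv g = Y + Y'"
        using triv[of "g ** X ** matrix_inv g"] st by auto
      obtain Z1 where Z1: "Y = g ** der_mat \<phi> f Z1 ** matrix_inv g" using Y(1) by (auto simp: stab_alg_def)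
      obtain Z2 where Z2: "Y' = g2 ** der_mat \<phi> f Z2 ** matrix_inv g2" using Y(2) by (auto simp: stab_alg_def)
      have "g ** (?a ** X ** matrix_inv ?a - X) ** matrix_inv g = Y + Y'"
        using Y(3) unfolding conj_mult[OF g inv(1) ag] conj_scale[OF c0 a']
        by (simp add: matrix_diff_distrib)
      then have "?a ** X ** matrix_inv ?a - X = matrix_inv g ** (Y + Y') ** g"
        by (metis g matrix_inv_cancel(2,4) matrix_mul_assoc)
      also have "\<dots> = der_mat \<phi> f Z1 + ?k ** der_mat \<phi> f Z2 ** matrix_inv ?k"
      proof -
        have "matrix_inv g ** Y ** g = der_mat \<phi> f Z1"
          by (simp add: Z1 matrix_mul_assoc matrix_inv_left[OF g] matrix_inv_cancel(4)[OF g])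
        moreover have "matrix_inv (matrix_inv g) = g"
          by (metis g invertible_matrix_inv matrix_inv_cancel(1) matrix_inv_right matrix_mul_rid)
        then have "matrix_inv g ** Y' ** g = ?k ** der_mat \<phi> f Z2 ** matrix_inv ?k"
          by (simp add: Z2 matrix_inv_mult[OF invertible_matrix_inv[OF g] inv(3)] matrix_mul_assoc)
        ultimately show ?thesis by (simp add: matrix_add_distrib)
      qed
      finally show ?thesis by blast
    qed
    then show ?thesis using no_trivial_action_moving_vector[OF A' A'e k] by blast
  qed
qed


text \<open>
  The centraliser of \<open>a\<close> would be the image of the \<open>25\<close>-dimensional space of matrices \<open>Z\<close> under
  \<open>Z \<mapsto> m(Z) + a m(Z) a\<close>, but it contains the more than \<open>25\<close> independent matrices
  \<open>P E\<^sub>i\<^sub>j P\<^sup>-\<^sup>1\<close> with equal eigenvalues in positions \<open>i\<close> and \<open>j\<close>.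
\<close>

lemma no_involution_averaging:
  assumes inv: "invertible g1" and aa: "a ** a = mat 1"
    and avg: "\<And>X. a ** X = X ** a \<Longrightarrow> \<exists>m\<in>stab_alg \<phi> f g1. X = m + a ** m ** a"
  shows False
proof -
  obtain P :: "'a ^ 10 ^ 10" and d where P: "invertible P" "\<And>i. d i = 1 \<or> d i = (- 1 :: 'a)"
    "a ** P = (\<chi> i j. P $ i $ j * d j)"
    by (rule involution_diagonalizable[OF aa]) blast
  let ?I = "{(i, j). d i = d j}"
  define E :: "10 \<times> 10 \<Rightarrow> 'a ^ 10 ^ 10" where "E b = (\<chi> k t. if b = (k, t) then 1 else 0)" for b
  define D :: "'a ^ 10 ^ 10" where "D = (\<chi> i j. if i = j then d j else 0)"
  have PD: "a ** P = P ** D"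
    unfolding P(3) by (simp add: vec_eq_iff matrix_matrix_mult_def D_def if_distrib cong: if_cong)
  have comm: "a ** (P ** E b ** matrix_inv P) = (P ** E b ** matrix_inv P) ** a" if "b \<in> ?I" for b
  proof -
    have "(D ** E b) $ i $ j = (E b ** D) $ i $ j" for i j
    proof -
      have "(D ** E b) $ i $ j = (\<Sum>k\<in>UNIV. if k = i then d i * E b $ i $ j else 0)"
        unfolding matrix_matrix_mult_def D_def vec_lambda_beta by (rule sum.cong[OF refl]) auto
      moreover have "(E b ** D) $ i $ j = (\<Sum>k\<in>UNIV. if k = j then E b $ i $ j * d j else 0)"
        unfolding matrix_matrix_mult_def D_def vec_lambda_beta by (rule sum.cong[OF refl]) auto
      ultimately show ?thesis using that by (auto simp: E_def)
    qed
    then have DE: "D ** E b = E b ** D" by (simp add: vec_eq_iff)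
    have iP: "matrix_inv P ** a = D ** matrix_inv P"
    proof -
      have "matrix_inv P ** (a ** P) ** matrix_inv P = matrix_inv P ** (P ** D) ** matrix_inv P" by (simp only: PD)
      then show ?thesis by (simp add: matrix_inv_cancel[OF P(1)] matrix_mul_assoc matrix_inv_left[OF P(1)])
    qed
    have "a ** (P ** E b ** matrix_inv P) = P ** (D ** E b) ** matrix_inv P"
      by (simp add: matrix_mul_assoc PD)
    also have "\<dots> = P ** E b ** (matrix_inv P ** a)"
      by (simp add: DE iP matrix_mul_assoc)
    finally show ?thesis by (simp add: matrix_mul_assoc)
  qed
  define m where "m Z = g1 ** der_mat \<phi> f Z ** matrix_inv g1" for Z
  define rel where "rel X (Y :: 'a ^ 5 ^ 5) Z \<longleftrightarrow> P ** X ** matrix_inv P = m Z + a ** m Z ** a" for X Y Z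
  have "\<exists>Z. rel (E b) 0 Z" if "b \<in> ?I" for b
    using avg[OF comm[OF that]] by (auto simp: rel_def stab_alg_def m_def)
  then obtain Z where Z: "\<And>b. b \<in> ?I \<Longrightarrow> rel (E b) 0 (Z b)" by metis
  define F :: "10 \<times> 10 \<Rightarrow> 'a ^ (5 \<times> 5)" where "F b = (\<chi> p. Z b $ fst p $ snd p)" for b
  have fin: "finite ?I" by simp
  have small: "CARD(5 \<times> 5) < card ?I" using card_equal_signs[of d] P(2) by simp
  obtain c where c: "\<exists>b\<in>?I. c b \<noteq> 0" "(\<Sum>b\<in>?I. c b *s F b) = 0"
    by (rule linear_relation_exists[OF fin small, of F])
  have m0: "m 0 = 0"
    using der_mat_scale[of 0 0] by (simp add: m_def matrix_matrix_mult_def zero_vec_def[symmetric])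
  have m_scale: "m (mat d ** Z) = mat d ** m Z" for d Z
    by (simp only: m_def der_mat_scale conj_scaled)
  have r: "rel (\<Sum>b\<in>?I. mat (c b) ** E b) (\<Sum>b\<in>?I. mat (c b) ** 0) (\<Sum>b\<in>?I. mat (c b) ** Z b)"
  proof (rule linear_combination_closed)
    show "rel 0 0 0" by (simp add: rel_def m0 matrix_matrix_mult_def zero_vec_def[symmetric])
  next
    fix X Y Z X' Y' Z' assume "rel X Y Z" "rel X' Y' Z'"
    then show "rel (X + X') (Y + Y') (Z + Z')"
      by (simp add: rel_def m_def der_mat_add matrix_add_distrib algebra_simps)
  next
    fix d X Y Z assume *: "rel X Y Z"
    have "P ** (mat d ** X) ** matrix_inv P = mat d ** (P ** X ** matrix_inv P)"
      by (rule conj_scaled)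
    also have "\<dots> = mat d ** m Z + a ** (mat d ** m Z) ** a"
      using * by (simp only: rel_def conj_scaled matrix_add_distrib)
    finally show "rel (mat d ** X) (mat d ** Y) (mat d ** Z)"
      by (simp add: rel_def m_scale)
  qed (use Z in auto)
  have "(\<Sum>b\<in>?I. mat (c b) ** Z b) $ i $ j = 0" for i j
    unfolding sum_mat_entry using arg_cong[OF c(2), of "\<lambda>v. v $ (i, j)"] by (simp add: F_def)
  then have "(\<Sum>b\<in>?I. mat (c b) ** Z b) = 0" by (simp only: vec_eq_iff zero_index) blast
  then have "P ** (\<Sum>b\<in>?I. mat (c b) ** E b) ** matrix_inv P = 0"
    using r m0 by (simp add: rel_def matrix_matrix_mult_def zero_vec_def[symmetric])
  then have "matrix_inv P ** (P ** (\<Sum>b\<in>?I. mat (c b) ** E b) ** matrix_inv P) ** P = matrix_inv P ** 0 ** P"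
    by simp
  then have E0: "(\<Sum>b\<in>?I. mat (c b) ** E b) = 0"
    by (simp add: matrix_inv_cancel[OF P(1)] matrix_mul_assoc matrix_inv_left[OF P(1)])
  have "c (i, j) = 0" if "(i, j) \<in> ?I" for i j
  proof -
    have "(\<Sum>b\<in>?I. c b * E b $ i $ j) = (\<Sum>b\<in>?I. if b = (i, j) then c b else 0)"
      by (rule sum.cong) (auto simp: E_def)
    also have "\<dots> = c (i, j)" using that by (simp add: sum.delta)
    also have "(\<Sum>b\<in>?I. c b * E b $ i $ j) = (\<Sum>b\<in>?I. mat (c b) ** E b) $ i $ j"
      by (rule sum_mat_entry[symmetric])
    finally show ?thesis by (simp only: E0 zero_index)
  qed
  then show False using c(1) by auto
qed

end

lemma scale_to_involution:
  fixes a :: "'a::{alg_closed_field, field_char_0} ^ 'n ^ 'n"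
  assumes "a ** a = mat c" "c \<noteq> 0"
  obtains d where "d \<noteq> 0" "(mat d ** a) ** (mat d ** a) = mat 1"
proof -
  obtain e where e: "e ^ 2 = c" using nth_root_exists[of 2 c] by auto
  then have "e \<noteq> 0" using assms(2) by auto
  have "(mat (inverse e) ** a) ** (mat (inverse e) ** a) = mat (inverse e * inverse e * c)"
    by (simp add: scaled_mult assms(1) mat_mult_mat)
  also have "inverse e * inverse e * c = 1" using e \<open>e \<noteq> 0\<close> by (auto simp: power2_eq_square field_simps)
  finally show ?thesis using \<open>e \<noteq> 0\<close> that by (metis inverse_nonzero_iff_nonzero)
qed


text \<open>
  With \<open>T X = - a X a\<^sup>-\<^sup>1\<close>, conjugation by \<open>a\<^sup>2\<close> is \<open>T\<^sup>2\<close>, and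
  \<open>T\<^sup>2 X - X = (T X - X) + (T (T X) - T X)\<close>.
\<close>

lemma (in ext2_field_change) swap_square_trivial:
  assumes inv: "invertible a" "invertible g1" "invertible g2"
    and swap: "a ** g1 = g2 ** h1" "a ** g2 = g1 ** h2" "h1 \<in> H_lift \<phi> f" "h2 \<in> H_lift \<phi> f"
    and triv: "\<And>X. \<exists>Y\<in>stab_alg \<phi> f g1. \<exists>Y'\<in>stab_alg \<phi> f g2. - (a ** X ** matrix_inv a) - X = Y + Y'"
  shows "\<exists>c. c \<noteq> 0 \<and> a ** a = mat c"
proof (rule trivial_action_scalar[OF _ inv(2,3)])
  show "invertible (a ** a)" by (intro invertible_mult inv)
  have "a ** a ** g1 = a ** (a ** g1)" by (simp add: matrix_mul_assoc)
  also have "\<dots> = a ** g2 ** h1" by (simp add: swap(1) matrix_mul_assoc)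
  also have "\<dots> = g1 ** (h2 ** h1)" by (simp add: swap(2) matrix_mul_assoc)
  finally show "a ** a ** g1 = g1 ** (h2 ** h1)" .
  show "h2 ** h1 \<in> H_lift \<phi> f" by (intro H_lift_mult swap)
  fix X
  let ?W = "a ** X ** matrix_inv a"
  obtain Y Y' where Y: "Y \<in> stab_alg \<phi> f g1" "Y' \<in> stab_alg \<phi> f g2" "- ?W - X = Y + Y'"
    using triv[of X] by auto
  obtain V V' where V: "V \<in> stab_alg \<phi> f g1" "V' \<in> stab_alg \<phi> f g2"
    "- (a ** ?W ** matrix_inv a) - ?W = V + V'"
    using triv[of ?W] by auto
  have "a ** a ** X ** matrix_inv (a ** a) = a ** ?W ** matrix_inv a"
    by (simp add: matrix_inv_mult[OF inv(1) inv(1)] matrix_mul_assoc)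
  then have "a ** a ** X ** matrix_inv (a ** a) - X = (- ?W - X) - (- (a ** ?W ** matrix_inv a) - ?W)"
    by simp
  also have "\<dots> = (Y - V) + (Y' - V')" unfolding Y(3) V(3) by simp
  finally show "\<exists>Y\<in>stab_alg \<phi> f g1. \<exists>Y'\<in>stab_alg \<phi> f g2. a ** a ** X ** matrix_inv (a ** a) - X = Y + Y'"
    using Y V stab_alg_diff by blast
qed

lemma swap_acts_nontrivially:
  fixes f :: "'k::field \<Rightarrow> 'a::{alg_closed_field, field_char_0}"
  assumes "ext2_base_change \<phi> f"
    and inv: "invertible a" "invertible g1" "invertible g2"
    and swap: "a ** g1 = g2 ** h1" "a ** g2 = g1 ** h2" "h1 \<in> H_lift \<phi> f" "h2 \<in> H_lift \<phi> f"
    and triv: "\<And>X. \<exists>Y\<in>stab_alg \<phi> f g1. \<exists>Y'\<in>stab_alg \<phi> f g2. - (a ** X ** matrix_inv a) - X = Y + Y'"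
  shows False
proof -
  interpret ext2_field_change \<phi> f using assms(1) by (simp add: ext2_field_change_def)
  obtain c where c: "c \<noteq> 0" "a ** a = mat c" using swap_square_trivial[OF inv swap triv] by auto
  obtain d where d: "d \<noteq> 0" "(mat d ** a) ** (mat d ** a) = mat 1"
    by (rule scale_to_involution[OF c(2,1)])
  define b where "b = mat d ** a"
  have bb: "b ** b = mat 1" using d(2) by (simp add: b_def)
  have ib: "matrix_inv b = b" by (rule matrix_inv_unique[OF bb bb])
  have b: "invertible b" using bb by (auto simp: invertible_def)
  have conj: "b ** X ** b = a ** X ** matrix_inv a" for X
    using conj_scale[OF d(1) inv(1), of X] by (simp add: b_def[symmetric] ib)
  have "b ** g2 = g1 ** (mat d ** h2)"
    by (simp add: b_def matrix_mul_assoc[symmetric] swap(2) mat_left_commute)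
  moreover have "mat d ** h2 \<in> H_lift \<phi> f"
  proof -
    obtain e A where h: "h2 = mat e ** ext_mat \<phi> f A" "e dvd 1" "invertible A"
      using swap(4) by (auto simp: H_lift_def)
    have "mat d ** h2 = mat (d * e) ** ext_mat \<phi> f A" by (simp add: h(1) matrix_mul_assoc mat_mult_mat)
    moreover have "d * e dvd 1" using d(1) h(2) by (simp add: dvd_field_iff)
    ultimately show ?thesis using h(3) unfolding H_lift_def by blast
  qed
  ultimately have "stab_alg \<phi> f (b ** g2) = stab_alg \<phi> f g1"
    using stab_alg_H_lift[OF inv(2)] by simp
  then have bY: "b ** Y ** b \<in> stab_alg \<phi> f g1" if "Y \<in> stab_alg \<phi> f g2" for Y
    using stab_alg_conj[OF b inv(3) that] by (simp add: ib)
  show False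
  proof (rule no_involution_averaging[OF inv(2) bb])
    fix X assume "b ** X = X ** b"
    then have bXb: "b ** X ** b = X" by (simp add: matrix_mul_assoc[symmetric] bb)
    obtain Y Y' where Y: "Y \<in> stab_alg \<phi> f g1" "Y' \<in> stab_alg \<phi> f g2" "- X - X = Y + Y'"
      using triv[of X] by (auto simp: conj[symmetric] bXb)
    \<comment> \<open>Averaging \<open>- 2X = Y + Y'\<close> over conjugation by \<open>b\<close> gives \<open>- 4X = ?m + b ?m b\<close>.\<close>
    let ?m = "Y + b ** Y' ** b"
    have bY'b: "b ** (b ** Y' ** b) ** b = Y'"
      by (simp add: matrix_mul_assoc bb) (simp add: matrix_mul_assoc[symmetric] bb)
    have "b ** (- X - X) ** b = - X - X"
      by (simp add: matrix_diff_distrib bXb uminus_as_scale conj_scaled)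
    then have "?m + b ** ?m ** b = (- X - X) + (- X - X)"
      unfolding Y(3) by (simp add: matrix_add_distrib bY'b add.commute)
    then have "mat (- 1 / 4) ** (?m + b ** ?m ** b) = X"
      by (simp add: vec_eq_iff mat_mult_entry)
    then have "X = mat (- 1 / 4) ** ?m + b ** (mat (- 1 / 4) ** ?m) ** b"
      by (simp only: conj_scaled matrix_add_distrib)
    moreover have "mat (- 1 / 4) ** ?m \<in> stab_alg \<phi> f g1"
      by (intro stab_alg_scale stab_alg_add Y(1) bY[OF Y(2)])
    ultimately show "\<exists>m\<in>stab_alg \<phi> f g1. X = m + b ** m ** b" by blast
  qed
qed

section \<open>Deformations in coordinates\<close>

text \<open>
  A point of \<open>U\<close> over a field of characteristic \<open>0\<close>, with chosen matrices that represent its two cosets.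
\<close>

locale gpk_point = ext2_field_change \<phi> f
  for \<phi> :: "'k::field ^ 5 ^ 5 \<Rightarrow> 'k ^ 10" and f :: "'k \<Rightarrow> 'a::field_char_0" +
  fixes g1 g2 :: "'a ^ 10 ^ 10"
  assumes g1: "invertible g1" and g2: "invertible g2"
    and in_U: "(coset_point \<phi> f g1, coset_point \<phi> f g2) \<in> U_pts \<phi> f"
begin

abbreviation base_point :: "'a coset_pt \<times> 'a coset_pt" where
  "base_point \<equiv> (coset_point \<phi> f g1, coset_point \<phi> f g2)"

abbreviation sqz_point :: "('a, 'n::finite) sqz ^ 10 ^ 10 \<Rightarrow> ('a, 'n) sqz coset_pt" where
  "sqz_point \<equiv> coset_point \<phi> (sqz_const \<circ> f)"

text \<open>
  Only the first coset is deformed: the second can be made constant by the action of \<open>G\<close>.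
\<close>

definition shifted_point :: "('n::finite \<Rightarrow> 'a ^ 10 ^ 10) \<Rightarrow> ('a, 'n) sqz coset_pt \<times> ('a, 'n) sqz coset_pt" where
  "shifted_point X = (sqz_point (eps_mat X ** const_mat g1), sqz_point (const_mat g2))"

definition std_deform :: "('n::finite \<Rightarrow> 'a ^ 10 ^ 10) \<Rightarrow> ('a, 'n) deform" where
  "std_deform X = (shifted_point X, \<one>\<^bsub>swapG\<^esub>)"

text \<open>
  The sum \<open>l\<^sub>1 + l\<^sub>2\<close> of the infinitesimal stabilisers of the two cosets.
\<close>

definition trivial_directions :: "('a ^ 10 ^ 10) set" where
  "trivial_directions = {Y + Y' | Y Y'. Y \<in> stab_alg \<phi> f g1 \<and> Y' \<in> stab_alg \<phi> f g2}"

lemma trivial_directions_add: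
  assumes "X \<in> trivial_directions" "Y \<in> trivial_directions" shows "X + Y \<in> trivial_directions"
proof -
  obtain A B C D where "X = A + B" "Y = C + D"
    and st: "A \<in> stab_alg \<phi> f g1" "B \<in> stab_alg \<phi> f g2" "C \<in> stab_alg \<phi> f g1" "D \<in> stab_alg \<phi> f g2"
    using assms by (auto simp: trivial_directions_def)
  then have "X + Y = (A + C) + (B + D)" by simp
  then show ?thesis
    unfolding trivial_directions_def using stab_alg_add[OF st(1,3)] stab_alg_add[OF st(2,4)] by blast
qed

lemma base_point_in_GmodH: "base_point \<in> GmodH \<phi> f \<times> GmodH \<phi> f"
  using g1 g2 by (auto simp: GmodH_eq)

lemma sqz_inv: "invertible g \<Longrightarrow> invertible (eps_mat X ** const_mat g)"
  by (intro invertible_mult eps_mat_invertible const_mat_invertible)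

lemma sqz_point_base:
  assumes "invertible B" "invertible C"
  shows "pair_map \<phi> f sqz_base (sqz_point B, sqz_point C) =
    (coset_point \<phi> f (map_matrix sqz_base B), coset_point \<phi> f (map_matrix sqz_base C))"
  by (rule ext2_base_change.pair_map_coset_point[OF sqz_base_change sqz_base_hom assms sqz_base_const])

lemma shifted_point_base: "pair_map \<phi> f sqz_base (shifted_point X) = base_point"
  by (simp add: shifted_point_def sqz_point_base sqz_inv const_mat_invertible g1 g2 map_matrix_mult[OF sqz_base_hom])

lemma shifted_point_GmodH: "shifted_point X \<in> GmodH \<phi> (sqz_const \<circ> f) \<times> GmodH \<phi> (sqz_const \<circ> f)"
  by (simp add: shifted_point_def ext2_base_change.GmodH_eq[OF sqz_base_change] sqz_inv const_mat_invertible g1 g2)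

lemma deforms_iff:
  "(t, \<gamma>) \<in> deforms \<phi> f base_point \<longleftrightarrow> t \<in> GmodH \<phi> (sqz_const \<circ> f) \<times> GmodH \<phi> (sqz_const \<circ> f) \<and>
    pair_map \<phi> f sqz_base t \<in> U_pts \<phi> f \<and> \<gamma> \<in> carrier swapG \<and>
    swapG_act \<gamma> (pair_map \<phi> f sqz_base t) = base_point"
  by (auto simp: deforms_def U_sqz_def isoms_def)

lemma deform_iso_iff:
  "((t, \<gamma>), (t', \<gamma>')) \<in> deform_iso \<phi> f base_point \<longleftrightarrow> (t, \<gamma>) \<in> deforms \<phi> f base_point \<and> (t', \<gamma>') \<in> deforms \<phi> f base_point \<and>
    (\<exists>\<delta>\<in>carrier swapG. swapG_act \<delta> t = t' \<and> \<gamma>' \<otimes>\<^bsub>swapG\<^esub> swapG_map sqz_base \<delta> = \<gamma>)"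
  by (auto simp: deform_iso_def isoms_def)

lemma isoms_iff: "\<alpha> \<in> isoms base_point base_point \<longleftrightarrow> \<alpha> \<in> carrier swapG \<and> swapG_act \<alpha> base_point = base_point"
  by (simp add: isoms_def)

lemma deform_aut:
  fixes t :: "('a, 'n::finite) sqz coset_pt \<times> ('a, 'n) sqz coset_pt"
  assumes "\<alpha> \<in> isoms base_point base_point" "(t, \<gamma>) \<in> deforms \<phi> f base_point"
  shows "(t, \<alpha> \<otimes>\<^bsub>swapG\<^esub> \<gamma>) \<in> deforms \<phi> f base_point"
proof -
  interpret G: group "swapG :: 'a swapG monoid" by (rule swapG_group)
  interpret S: group "swapG :: ('a, 'n) sqz swapG monoid" by (rule swapG_group)
  interpret R: ext2_base_change \<phi> "sqz_const \<circ> f :: 'k \<Rightarrow> ('a, 'n) sqz" by (rule sqz_base_change)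
  have t: "t \<in> GmodH \<phi> (sqz_const \<circ> f) \<times> GmodH \<phi> (sqz_const \<circ> f)"
    using assms(2) by (simp only: deforms_iff)
  have "pair_map \<phi> f sqz_base t \<in> GmodH \<phi> f \<times> GmodH \<phi> f"
    by (rule R.pair_map_swapG_act(2)[OF sqz_base_hom sqz_base_const S.one_closed t])
  then show ?thesis
    using assms by (simp add: deforms_iff isoms_iff swapG_act_mult(1))
qed

lemma std_deform_in_deforms: "std_deform X \<in> deforms \<phi> f base_point"
proof -
  interpret G: group "swapG :: 'a swapG monoid" by (rule swapG_group)
  show ?thesis
    unfolding std_deform_def deforms_iff
    using shifted_point_GmodH[of X] in_U swapG_act_mult(3)[OF G.one_closed G.one_closed base_point_in_GmodH]
    by (simp add: shifted_point_base)
qed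

text \<open>
  Isomorphisms of deformations are the morphisms of an action groupoid that are compatible with the
  identifications of the special fibre, and reduction modulo \<open>e\<close> is a homomorphism.
\<close>

lemma equiv_deform_iso: "equiv (deforms \<phi> f base_point) (deform_iso \<phi> f base_point :: (('a, 'n::finite) deform \<times> ('a, 'n) deform) set)"
proof -
  interpret G: group "swapG :: 'a swapG monoid" by (rule swapG_group)
  interpret S: group "swapG :: ('a, 'n) sqz swapG monoid" by (rule swapG_group)
  interpret R: ext2_base_change \<phi> "sqz_const \<circ> f :: 'k \<Rightarrow> ('a, 'n) sqz" by (rule sqz_base_change)
  let ?iso = "deform_iso \<phi> f base_point :: (('a, 'n) deform \<times> ('a, 'n) deform) set"
  note hom = swapG_map_hom[OF sqz_base_hom]
  have sub: "?iso \<subseteq> deforms \<phi> f base_point \<times> deforms \<phi> f base_point" by (auto simp: deform_iso_def)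
  have refl: "((t, \<gamma>), (t, \<gamma>)) \<in> ?iso" if "(t, \<gamma>) \<in> deforms \<phi> f base_point" for t \<gamma>
  proof -
    have "t \<in> GmodH \<phi> (sqz_const \<circ> f) \<times> GmodH \<phi> (sqz_const \<circ> f)" "\<gamma> \<in> carrier swapG"
      using that by (simp_all only: deforms_iff)
    then show ?thesis unfolding deform_iso_iff
      using that R.swapG_act_mult(3)[OF S.one_closed S.one_closed] hom(3)[OF S.one_closed S.one_closed]
      by (intro conjI bexI[of _ "\<one>\<^bsub>swapG\<^esub>"]) simp_all
  qed
  have sym: "((t', \<gamma>'), (t, \<gamma>)) \<in> ?iso" if iso: "((t, \<gamma>), (t', \<gamma>')) \<in> ?iso" for t \<gamma> t' \<gamma>'
  proof -
    obtain \<delta> where d: "\<delta> \<in> carrier swapG" "swapG_act \<delta> t = t'" "\<gamma>' \<otimes>\<^bsub>swapG\<^esub> swapG_map sqz_base \<delta> = \<gamma>"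
      and m: "(t, \<gamma>) \<in> deforms \<phi> f base_point" "(t', \<gamma>') \<in> deforms \<phi> f base_point"
      using iso by (auto simp: deform_iso_iff)
    have t: "t \<in> GmodH \<phi> (sqz_const \<circ> f) \<times> GmodH \<phi> (sqz_const \<circ> f)" and c: "\<gamma>' \<in> carrier swapG"
      using m by (simp_all only: deforms_iff)
    let ?e = "inv\<^bsub>swapG\<^esub> \<delta>"
    have e: "?e \<in> carrier swapG" using d(1) by simp
    have "swapG_act ?e t' = t"
      unfolding d(2)[symmetric] R.swapG_act_mult(1)[OF e d(1) t, symmetric]
      using R.swapG_act_mult(3)[OF e d(1) t] d(1) by simp
    moreover have "\<gamma> \<otimes>\<^bsub>swapG\<^esub> swapG_map sqz_base ?e = \<gamma>'"
    proof -
      have "\<gamma> \<otimes>\<^bsub>swapG\<^esub> swapG_map sqz_base ?e = \<gamma>' \<otimes>\<^bsub>swapG\<^esub> swapG_map sqz_base (\<delta> \<otimes>\<^bsub>swapG\<^esub> ?e)"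
        unfolding d(3)[symmetric] hom(1)[OF d(1) e] by (rule G.m_assoc[OF c hom(2)[OF d(1) d(1)] hom(2)[OF e e]])
      also have "\<dots> = \<gamma>'" using d(1) c hom(3)[OF d(1) d(1)] by simp
      finally show ?thesis .
    qed
    ultimately show ?thesis using m e by (auto simp: deform_iso_iff)
  qed
  have trans: "((t, \<gamma>), (t'', \<gamma>'')) \<in> ?iso"
    if "((t, \<gamma>), (t', \<gamma>')) \<in> ?iso" "((t', \<gamma>'), (t'', \<gamma>'')) \<in> ?iso" for t \<gamma> t' \<gamma>' t'' \<gamma>''
  proof -
    have m: "(t, \<gamma>) \<in> deforms \<phi> f base_point" "(t'', \<gamma>'') \<in> deforms \<phi> f base_point"
      and ex: "\<exists>\<delta>\<in>carrier swapG. swapG_act \<delta> t = t' \<and> \<gamma>' \<otimes>\<^bsub>swapG\<^esub> swapG_map sqz_base \<delta> = \<gamma>"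
        "\<exists>\<epsilon>\<in>carrier swapG. swapG_act \<epsilon> t' = t'' \<and> \<gamma>'' \<otimes>\<^bsub>swapG\<^esub> swapG_map sqz_base \<epsilon> = \<gamma>'"
      using that by (simp_all only: deform_iso_iff)
    obtain \<delta> where d: "\<delta> \<in> carrier swapG" "swapG_act \<delta> t = t'" "\<gamma>' \<otimes>\<^bsub>swapG\<^esub> swapG_map sqz_base \<delta> = \<gamma>"
      using ex(1) by blast
    obtain \<epsilon> where e: "\<epsilon> \<in> carrier swapG" "swapG_act \<epsilon> t' = t''" "\<gamma>'' \<otimes>\<^bsub>swapG\<^esub> swapG_map sqz_base \<epsilon> = \<gamma>'"
      using ex(2) by blast
    have t: "t \<in> GmodH \<phi> (sqz_const \<circ> f) \<times> GmodH \<phi> (sqz_const \<circ> f)" and c: "\<gamma>'' \<in> carrier swapG"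
      using m by (simp_all only: deforms_iff)
    have "swapG_act (\<epsilon> \<otimes>\<^bsub>swapG\<^esub> \<delta>) t = t''"
      by (simp add: R.swapG_act_mult(1)[OF e(1) d(1) t] d(2) e(2))
    moreover have "\<gamma>'' \<otimes>\<^bsub>swapG\<^esub> swapG_map sqz_base (\<epsilon> \<otimes>\<^bsub>swapG\<^esub> \<delta>) = \<gamma>"
      unfolding d(3)[symmetric] e(3)[symmetric] hom(1)[OF e(1) d(1)]
      by (rule G.m_assoc[OF c hom(2)[OF e(1) e(1)] hom(2)[OF d(1) d(1)], symmetric])
    ultimately show ?thesis using m d(1) e(1) by (auto simp: deform_iso_iff)
  qed
  show ?thesis
  proof (rule equivI)
    show "refl_on (deforms \<phi> f base_point) ?iso" using refl sub by (auto simp: refl_on_def)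
    show "sym ?iso"
    proof (rule symI)
      fix x y assume "(x, y) \<in> ?iso"
      then show "(y, x) \<in> ?iso" using sym[of "fst x" "snd x" "fst y" "snd y"] by simp
    qed
    show "trans ?iso"
    proof (rule transI)
      fix x y z assume "(x, y) \<in> ?iso" "(y, z) \<in> ?iso"
      then show "(x, z) \<in> ?iso"
        using trans[of "fst x" "snd x" "fst y" "snd y" "fst z" "snd z"] by simp
    qed
  qed (use sub in simp_all)
qed

text \<open>
  An isomorphism that reduces to the identity is given by some \<open>1 + eW\<close>.  It leaves the second coset
  unchanged if \<open>W \<in> l\<^sub>2\<close>, and it then changes \<open>X\<close> to \<open>X + W\<close> in the first coset, where
  \<open>l\<^sub>1\<close> is divided out.
\<close>

lemma std_deform_iso_iff:
  fixes X Y :: "'n::finite \<Rightarrow> 'a ^ 10 ^ 10"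
  shows "(std_deform X, std_deform Y) \<in> deform_iso \<phi> f base_point \<longleftrightarrow> (\<forall>l. X l - Y l \<in> trivial_directions)"
proof -
  interpret G: group "swapG :: 'a swapG monoid" by (rule swapG_group)
  interpret R: ext2_base_change \<phi> "sqz_const \<circ> f :: 'k \<Rightarrow> ('a, 'n) sqz" by (rule sqz_base_change)
  have act: "swapG_act (0, pclass (eps_mat W)) (shifted_point X) =
      (sqz_point (eps_mat (\<lambda>l. W l + X l) ** const_mat g1), sqz_point (eps_mat W ** const_mat g2))"
    for W X :: "'n \<Rightarrow> 'a ^ 10 ^ 10"
    unfolding shifted_point_def
    by (subst R.swapG_act_coset_point)
      (simp_all add: eps_mat_invertible sqz_inv const_mat_invertible g1 g2 matrix_mul_assoc eps_mat_mult)
  have act_eq: "swapG_act (0, pclass (eps_mat W)) (shifted_point X) = shifted_point Y \<longleftrightarrow>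
      (\<forall>l. W l + X l - Y l \<in> stab_alg \<phi> f g1) \<and> (\<forall>l. W l \<in> stab_alg \<phi> f g2)" for W
  proof -
    have "sqz_point (const_mat g2) = sqz_point (eps_mat (\<lambda>_ :: 'n. 0) ** const_mat g2)"
      by (simp add: eps_mat_zero)
    then show ?thesis
      unfolding act by (simp add: shifted_point_def coset_point_eps_eq_iff g1 g2 del: o_apply)
  qed
  show ?thesis
  proof
    assume "(std_deform X, std_deform Y) \<in> deform_iso \<phi> f base_point"
    then obtain \<delta> :: "('a, 'n) sqz swapG" where d: "\<delta> \<in> carrier swapG" "swapG_act \<delta> (shifted_point X) = shifted_point Y"
      "\<one>\<^bsub>swapG\<^esub> \<otimes>\<^bsub>swapG\<^esub> swapG_map sqz_base \<delta> = \<one>\<^bsub>swapG\<^esub>"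
      by (auto simp: std_deform_def deform_iso_iff)
    obtain \<sigma> D where D: "\<delta> = (\<sigma>, pclass D)" "invertible D" using d(1) by (rule swapG_cases)
    have "swapG_map sqz_base \<delta> = \<one>\<^bsub>swapG\<^esub>"
      using d(3) G.l_one[OF swapG_map_hom(2)[OF sqz_base_hom d(1) d(1)]] by simp
    then have \<sigma>: "\<sigma> = 0" and "pclass (mat 1) = pclass (map_matrix sqz_base D)"
      by (simp_all add: D(1) swapG_map_pclass[OF sqz_base_hom] one_swapG)
    then obtain c where c: "c dvd 1" "map_matrix sqz_base D = mat c"
      using pclass_eq_iff[of "mat 1" "map_matrix sqz_base D"] by auto
    obtain W where W: "D = eps_mat W ** const_mat (mat c)"
      using sqz_mat_decompose[OF map_matrix_invertible[OF sqz_base_hom D(2)]] c(2) by metis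
    then have "D = mat (sqz_const c) ** eps_mat W"
      by (simp add: map_matrix_mat[OF sqz_const_hom] mat_central)
    then have "pclass D = pclass (eps_mat W)"
      using ring_hom_unit[OF sqz_const_hom c(1)] by (metis pclass_eq_iff)
    then have W: "\<And>l. W l + X l - Y l \<in> stab_alg \<phi> f g1" "\<And>l. W l \<in> stab_alg \<phi> f g2"
      using d(2) act_eq[of W] by (auto simp: D(1) \<sigma>)
    show "\<forall>l. X l - Y l \<in> trivial_directions"
    proof
      fix l
      have "X l - Y l = (W l + X l - Y l) + (- W l)" by simp
      then show "X l - Y l \<in> trivial_directions"
        unfolding trivial_directions_def using W(1)[of l] stab_alg_uminus[OF W(2)[of l]] by blast
    qed
  next
    assume "\<forall>l. X l - Y l \<in> trivial_directions"
    then have "\<forall>l. \<exists>A B. X l - Y l = A + B \<and> A \<in> stab_alg \<phi> f g1 \<and> B \<in> stab_alg \<phi> f g2"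
      by (auto simp: trivial_directions_def)
    then obtain A B where AB: "\<And>l. X l - Y l = A l + B l" "\<And>l. A l \<in> stab_alg \<phi> f g1" "\<And>l. B l \<in> stab_alg \<phi> f g2"
      by metis
    let ?\<delta> = "(0, pclass (eps_mat (\<lambda>l. - B l)))"
    have "- B l + X l - Y l = A l" for l using AB(1)[of l] by (simp add: algebra_simps)
    then have "swapG_act ?\<delta> (shifted_point X) = shifted_point Y"
      using AB(2,3) stab_alg_uminus by (simp add: act_eq)
    moreover have "\<one>\<^bsub>swapG\<^esub> \<otimes>\<^bsub>swapG\<^esub> swapG_map sqz_base ?\<delta> = \<one>\<^bsub>swapG\<^esub>"
      by (simp add: swapG_map_pclass[OF sqz_base_hom] one_swapG mult_swapG)
    moreover have "?\<delta> \<in> carrier swapG" by (auto simp: carrier_swapG eps_mat_invertible)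
    ultimately show "(std_deform X, std_deform Y) \<in> deform_iso \<phi> f base_point"
      using std_deform_in_deforms[of X] std_deform_in_deforms[of Y] unfolding std_deform_def deform_iso_iff by blast
  qed
qed

text \<open>
  A representative of the deformed coset can be multiplied by a constant element of \<open>H_lift\<close> so that it
  reduces to \<open>g\<close> itself.
\<close>

lemma sqz_point_over:
  fixes B :: "('a, 'n::finite) sqz ^ 10 ^ 10"
  assumes "invertible B" "invertible g" "coset_point \<phi> f (map_matrix sqz_base B) = coset_point \<phi> f g"
  obtains X where "sqz_point B = sqz_point (eps_mat X ** const_mat g)"
proof -
  interpret R: ext2_base_change \<phi> "sqz_const \<circ> f :: 'k \<Rightarrow> ('a, 'n) sqz" by (rule sqz_base_change)
  obtain h where h: "h \<in> H_lift \<phi> f" "g = map_matrix sqz_base B ** h"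
    using assms coset_point_eq_iff[OF map_matrix_invertible[OF sqz_base_hom assms(1)] assms(2)] by auto
  have hR: "const_mat h \<in> H_lift \<phi> (sqz_const \<circ> f)" by (rule const_mat_H_lift[OF h(1)])
  have B': "invertible (B ** const_mat h)"
    by (intro invertible_mult assms R.H_lift_invertible[OF hR])
  have "map_matrix sqz_base (B ** const_mat h) = g"
    by (simp add: map_matrix_mult[OF sqz_base_hom] h(2))
  then obtain X where "B ** const_mat h = eps_mat X ** const_mat g"
    using sqz_mat_decompose[OF map_matrix_invertible[OF sqz_base_hom B']] by metis
  then show ?thesis
    using that R.coset_point_eq_iff[OF assms(1) B'] hR by metis
qed

text \<open>
  Lifting \<open>\<gamma>\<close> to a constant element makes the identification of the special fibre trivial; then the
  deformation is \<open>(1 + eX) g\<^sub>1, (1 + eY) g\<^sub>2\<close>, and \<open>1 - eY\<close> moves it to standard form.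
\<close>

lemma deform_iso_std_deform:
  fixes t :: "('a, 'n::finite) sqz coset_pt \<times> ('a, 'n) sqz coset_pt"
  assumes "(t, \<gamma>) \<in> deforms \<phi> f base_point"
  obtains X where "((t, \<gamma>), std_deform X) \<in> deform_iso \<phi> f base_point"
proof -
  interpret G: group "swapG :: 'a swapG monoid" by (rule swapG_group)
  interpret S: group "swapG :: ('a, 'n) sqz swapG monoid" by (rule swapG_group)
  interpret R: ext2_base_change \<phi> "sqz_const \<circ> f :: 'k \<Rightarrow> ('a, 'n) sqz" by (rule sqz_base_change)
  have t: "t \<in> GmodH \<phi> (sqz_const \<circ> f) \<times> GmodH \<phi> (sqz_const \<circ> f)" and \<gamma>: "\<gamma> \<in> carrier swapG"
    and base: "swapG_act \<gamma> (pair_map \<phi> f sqz_base t) = base_point"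
    using assms by (simp_all only: deforms_iff)
  obtain \<sigma> a where a: "\<gamma> = (\<sigma>, pclass a)" "\<sigma> = 0 \<or> \<sigma> = 1" "invertible a" using \<gamma> by (rule swapG_cases)
  let ?\<delta> = "(\<sigma>, pclass (const_mat a)) :: ('a, 'n) sqz swapG"
  have \<delta>: "?\<delta> \<in> carrier swapG" "swapG_map sqz_base ?\<delta> = \<gamma>"
    using a const_mat_invertible[OF a(3)] by (auto simp: carrier_swapG swapG_map_pclass[OF sqz_base_hom])
  have t': "swapG_act ?\<delta> t \<in> GmodH \<phi> (sqz_const \<circ> f) \<times> GmodH \<phi> (sqz_const \<circ> f)"
    by (rule R.swapG_act_mult(2)[OF \<delta>(1) \<delta>(1) t])
  obtain B C where BC: "swapG_act ?\<delta> t = (sqz_point B, sqz_point C)" "invertible B" "invertible C"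
    using t' by (rule R.GmodH_pair_cases)
  have "pair_map \<phi> f sqz_base (swapG_act ?\<delta> t) = base_point"
    using R.pair_map_swapG_act(1)[OF sqz_base_hom sqz_base_const \<delta>(1) t] base \<delta>(2) by simp
  then have "coset_point \<phi> f (map_matrix sqz_base B) = coset_point \<phi> f g1"
    "coset_point \<phi> f (map_matrix sqz_base C) = coset_point \<phi> f g2"
    by (simp_all add: BC sqz_point_base)
  then obtain X Y where X: "sqz_point B = sqz_point (eps_mat X ** const_mat g1)"
    and Y: "sqz_point C = sqz_point (eps_mat Y ** const_mat g2)"
    using sqz_point_over[OF BC(2) g1] sqz_point_over[OF BC(3) g2] by metis
  let ?\<epsilon> = "(0, pclass (eps_mat (\<lambda>l. - Y l))) :: ('a, 'n) sqz swapG"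
  have \<epsilon>: "?\<epsilon> \<in> carrier swapG" by (auto simp: carrier_swapG eps_mat_invertible)
  have "swapG_act ?\<epsilon> (swapG_act ?\<delta> t) = shifted_point (\<lambda>l. - Y l + X l)"
    unfolding BC(1) X Y
    by (subst R.swapG_act_coset_point)
      (simp_all add: shifted_point_def eps_mat_invertible sqz_inv g1 g2 matrix_mul_assoc eps_mat_mult eps_mat_zero)
  then have "swapG_act (?\<epsilon> \<otimes>\<^bsub>swapG\<^esub> ?\<delta>) t = shifted_point (\<lambda>l. - Y l + X l)"
    using R.swapG_act_mult(1)[OF \<epsilon> \<delta>(1) t] by simp
  moreover have "\<one>\<^bsub>swapG\<^esub> \<otimes>\<^bsub>swapG\<^esub> swapG_map sqz_base (?\<epsilon> \<otimes>\<^bsub>swapG\<^esub> ?\<delta>) = \<gamma>"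
  proof -
    have "swapG_map sqz_base ?\<epsilon> = \<one>\<^bsub>swapG\<^esub>"
      by (simp add: swapG_map_pclass[OF sqz_base_hom] one_swapG)
    then show ?thesis using \<gamma> by (simp add: swapG_map_hom(1)[OF sqz_base_hom \<epsilon> \<delta>(1)] \<delta>(2))
  qed
  ultimately have "((t, \<gamma>), std_deform (\<lambda>l. - Y l + X l)) \<in> deform_iso \<phi> f base_point"
    using assms std_deform_in_deforms[of "\<lambda>l. - Y l + X l"] S.m_closed[OF \<epsilon> \<delta>(1)]
    unfolding std_deform_def deform_iso_iff by blast
  then show ?thesis by (rule that)
qed

definition tangent_vec :: "('n::finite \<Rightarrow> 'a ^ 10 ^ 10) \<Rightarrow> ('a, 'n) deform set" where
  "tangent_vec X = deform_iso \<phi> f base_point `` {std_deform X}"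

lemma tangent_vec_eq_iff: "tangent_vec X = tangent_vec Y \<longleftrightarrow> (\<forall>l. X l - Y l \<in> trivial_directions)"
  unfolding tangent_vec_def
  using eq_equiv_class_iff[OF equiv_deform_iso std_deform_in_deforms std_deform_in_deforms, of X Y]
  by (simp add: std_deform_iso_iff)

lemma tangent_vec_eqI: "(std_deform X, d) \<in> deform_iso \<phi> f base_point \<Longrightarrow> deform_iso \<phi> f base_point `` {d} = tangent_vec X"
  unfolding tangent_vec_def using equiv_class_eq[OF equiv_deform_iso] by metis

text \<open>
  With \<open>tangent_vec_eq_iff\<close> this identifies the tangent space with \<open>gl(W) / (l\<^sub>1 + l\<^sub>2)\<close>.
\<close>

lemma tangent_eq: "tangent \<phi> f base_point = range tangent_vec"
proof (rule subset_antisym)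
  show "range tangent_vec \<subseteq> tangent \<phi> f base_point"
    using std_deform_in_deforms by (auto simp: tangent_def tangent_vec_def intro: quotientI)
  show "tangent \<phi> f base_point \<subseteq> (range tangent_vec :: ('a, 'n::finite) deform set set)"
  proof
    fix D :: "('a, 'n) deform set" assume "D \<in> tangent \<phi> f base_point"
    then obtain t \<gamma> where D: "(t, \<gamma>) \<in> deforms \<phi> f base_point" "D = deform_iso \<phi> f base_point `` {(t, \<gamma>)}"
      by (auto simp: tangent_def elim!: quotientE)
    obtain X where "((t, \<gamma>), std_deform X) \<in> deform_iso \<phi> f base_point" using D(1) by (rule deform_iso_std_deform)
    then have "(std_deform X, (t, \<gamma>)) \<in> deform_iso \<phi> f base_point"
      using equiv_deform_iso by (meson equivE symE)
    then show "D \<in> range tangent_vec" using tangent_vec_eqI D(2) by blast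
  qed
qed

end

section \<open>The vector space structure and the action of automorphisms\<close>

context gpk_point
begin

text \<open>
  The union over all representatives in the definition of \<open>tangent_map\<close> is a single class because
  base change along \<open>sqz_map L\<close> preserves isomorphisms and does not affect reductions.
\<close>

lemma tangent_map_tangent_vec:
  fixes L :: "'a ^ 'm::finite \<Rightarrow> 'a ^ 'n::finite" and X :: "'m \<Rightarrow> 'a ^ 10 ^ 10"
  assumes add: "\<And>v w. L (v + w) = L v + L w" and scale: "\<And>c v. L (c *s v) = c *s L v"
  shows "tangent_map \<phi> f base_point L (tangent_vec X) = tangent_vec (\<lambda>l. \<chi> i j. L (\<chi> k. X k $ i $ j) $ l)"
proof -
  let ?Y = "\<lambda>l. \<chi> i j. L (\<chi> k. X k $ i $ j) $ l"
  let ?L = "sqz_map L" and ?f = "sqz_const \<circ> f :: 'k \<Rightarrow> ('a, 'n) sqz"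
  interpret M: ext2_base_change \<phi> "sqz_const \<circ> f :: 'k \<Rightarrow> ('a, 'm) sqz" by (rule sqz_base_change)
  interpret N: ext2_base_change \<phi> "sqz_const \<circ> f :: 'k \<Rightarrow> ('a, 'n) sqz" by (rule sqz_base_change)
  have L0: "L 0 = 0" using scale[of 0 0] by simp
  have hom: "is_ring_hom ?L" by (rule sqz_map_hom[OF add scale])
  have comp: "?L \<circ> (sqz_const \<circ> f) = ?f" by (auto simp: sqz_map_def sqz_const_def L0)
  have base_L: "map_matrix sqz_base (map_matrix ?L D) = map_matrix sqz_base D" for D :: "('a, 'm) sqz ^ 10 ^ 10"
    by (simp add: vec_eq_iff sqz_map_def)
  have shifted_L: "pair_map \<phi> ?f ?L (shifted_point X) = shifted_point ?Y"
    unfolding shifted_point_def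
    by (subst M.pair_map_coset_point[OF hom sqz_inv[OF g1] const_mat_invertible[OF g2] comp])
      (simp add: map_matrix_mult[OF hom] map_eps_mat[where L = L, OF L0] map_const_mat[where L = L, OF L0])
  have img: "(std_deform ?Y, (pair_map \<phi> ?f ?L t, \<gamma>)) \<in> deform_iso \<phi> f base_point"
    if "(std_deform X, (t, \<gamma>)) \<in> deform_iso \<phi> f base_point" for t \<gamma>
  proof -
    have m: "(t, \<gamma>) \<in> deforms \<phi> f base_point"
      and ex: "\<exists>\<delta>\<in>carrier swapG. swapG_act \<delta> (shifted_point X) = t \<and> \<gamma> \<otimes>\<^bsub>swapG\<^esub> swapG_map sqz_base \<delta> = \<one>\<^bsub>swapG\<^esub>"
      using that by (simp_all only: std_deform_def deform_iso_iff)
    obtain \<delta> where d: "\<delta> \<in> carrier swapG" "swapG_act \<delta> (shifted_point X) = t"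
      "\<gamma> \<otimes>\<^bsub>swapG\<^esub> swapG_map sqz_base \<delta> = \<one>\<^bsub>swapG\<^esub>" using ex by blast
    obtain \<sigma> D where D: "\<delta> = (\<sigma>, pclass D)" "invertible D" using d(1) by (rule swapG_cases)
    have t: "t \<in> GmodH \<phi> (sqz_const \<circ> f) \<times> GmodH \<phi> (sqz_const \<circ> f)" using m by (simp_all only: deforms_iff)
    obtain B C where BC: "t = (sqz_point B, sqz_point C)" "invertible B" "invertible C"
      using t by (rule M.GmodH_pair_cases)
    have Lt: "pair_map \<phi> ?f ?L t = (sqz_point (map_matrix ?L B), sqz_point (map_matrix ?L C))"
      unfolding BC(1) by (rule M.pair_map_coset_point[OF hom BC(2,3) comp])
    have "pair_map \<phi> f sqz_base (pair_map \<phi> ?f ?L t) = pair_map \<phi> f sqz_base t"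
      unfolding Lt unfolding BC(1)
      by (simp add: sqz_point_base BC map_matrix_invertible[OF hom] base_L)
    then have "(pair_map \<phi> ?f ?L t, \<gamma>) \<in> deforms \<phi> f base_point"
      using m M.pair_map_swapG_act(2)[OF hom comp d(1) t] by (simp add: deforms_iff)
    moreover have "swapG_act (swapG_map ?L \<delta>) (shifted_point ?Y) = pair_map \<phi> ?f ?L t"
      using M.pair_map_swapG_act(1)[OF hom comp d(1) shifted_point_GmodH[of X]] d(2) shifted_L by simp
    moreover have "\<gamma> \<otimes>\<^bsub>swapG\<^esub> swapG_map sqz_base (swapG_map ?L \<delta>) = \<one>\<^bsub>swapG\<^esub>"
      using d(3) by (simp add: D(1) swapG_map_pclass[OF hom] swapG_map_pclass[OF sqz_base_hom] base_L)
    moreover have "swapG_map ?L \<delta> \<in> carrier swapG" by (rule swapG_map_hom(2)[OF hom d(1) d(1)])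
    ultimately show ?thesis
      using std_deform_in_deforms[of ?Y] unfolding std_deform_def deform_iso_iff by blast
  qed
  have self: "(std_deform X, std_deform X) \<in> deform_iso \<phi> f base_point"
    using equiv_deform_iso std_deform_in_deforms by (meson equivE refl_onD)
  have "tangent_map \<phi> f base_point L (tangent_vec X) =
      (\<Union>d\<in>tangent_vec X. deform_iso \<phi> f base_point `` {(pair_map \<phi> ?f ?L (fst d), snd d)})"
    by (auto simp: tangent_map_def)
  also have "\<dots> = (\<Union>d\<in>tangent_vec X. tangent_vec ?Y)"
  proof (rule SUP_cong[OF refl])
    fix d assume "d \<in> tangent_vec X"
    then have "(std_deform X, (fst d, snd d)) \<in> deform_iso \<phi> f base_point" by (simp add: tangent_vec_def)
    from img[OF this] show "deform_iso \<phi> f base_point `` {(pair_map \<phi> ?f ?L (fst d), snd d)} = tangent_vec ?Y"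
      by (rule tangent_vec_eqI)
  qed
  also have "\<dots> = tangent_vec ?Y" using self by (auto simp: tangent_vec_def)
  finally show ?thesis .
qed

lemma tangent_smult_tangent_vec: "tangent_smult \<phi> f base_point c (tangent_vec X) = tangent_vec (\<lambda>l. mat c ** X l)"
proof -
  have "tangent_smult \<phi> f base_point c (tangent_vec X) = tangent_vec (\<lambda>l. \<chi> i j. (c *s (\<chi> k. X k $ i $ j)) $ l)"
    unfolding tangent_smult_def
    by (rule tangent_map_tangent_vec) (simp_all add: vec_eq_iff algebra_simps)
  also have "(\<lambda>l. \<chi> i j. (c *s (\<chi> k. X k $ i $ j)) $ l) = (\<lambda>l. mat c ** X l)"
    by (simp add: vec_eq_iff fun_eq_iff mat_mult_entry)
  finally show ?thesis .
qed

text \<open>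
  A deformation over \<open>('a, 2) sqz\<close> is, up to isomorphism, given by a pair of matrices \<open>E\<^sub>1, E\<^sub>2\<close> modulo \<open>l\<^sub>1 + l\<^sub>2\<close>, so it
  exists with prescribed restrictions and is determined by them; hence the description in
  \<open>tangent_add\<close> is satisfied by exactly one class.
\<close>

lemma tangent_add_tangent_vec: "tangent_add \<phi> f base_point (tangent_vec X) (tangent_vec Y) = tangent_vec (\<lambda>l. X l + Y l)"
proof -
  have all1: "(\<forall>l :: 1. P l) \<longleftrightarrow> P 1" for P by (metis (full_types) num1_eq1)
  have step: "tangent_map \<phi> f base_point L (tangent_vec E) = tangent_vec Y"
    if "\<And>v w. L (v + w) = L v + L w" "\<And>c v. L (c *s v) = c *s L v"
      "\<And>l i j. L (\<chi> k. E k $ i $ j) $ l = Y l $ i $ j"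
    for L :: "'a ^ 2 \<Rightarrow> 'a ^ 1" and E Y
    by (simp add: tangent_map_tangent_vec[OF that(1,2)] that(3))
  have maps:
    "tangent_map \<phi> f base_point (\<lambda>v :: 'a ^ 2. (\<chi> _. v $ 1) :: 'a ^ 1) (tangent_vec E) = tangent_vec (\<lambda>_. E 1)"
    "tangent_map \<phi> f base_point (\<lambda>v :: 'a ^ 2. (\<chi> _. v $ 2) :: 'a ^ 1) (tangent_vec E) = tangent_vec (\<lambda>_. E 2)"
    "tangent_map \<phi> f base_point (\<lambda>v :: 'a ^ 2. (\<chi> _. v $ 1 + v $ 2) :: 'a ^ 1) (tangent_vec E) = tangent_vec (\<lambda>_. E 1 + E 2)" for E
    by (rule step; simp add: vec_eq_iff algebra_simps)+
  let ?P = "\<lambda>Z. \<exists>D\<in>tangent \<phi> f base_point.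
     tangent_map \<phi> f base_point (\<lambda>v :: 'a ^ 2. \<chi> _. v $ 1) D = tangent_vec X \<and>
     tangent_map \<phi> f base_point (\<lambda>v :: 'a ^ 2. \<chi> _. v $ 2) D = tangent_vec Y \<and>
     tangent_map \<phi> f base_point (\<lambda>v :: 'a ^ 2. \<chi> _. v $ 1 + v $ 2) D = Z"
  \<comment> \<open>The one-element index type of the dual numbers has \<open>1\<close> as its only element.\<close>
  let ?E = "\<lambda>i :: 2. if i = 1 then X 1 else Y 1"
  have "?P (tangent_vec (\<lambda>l. X l + Y l))"
  proof (rule bexI[of _ "tangent_vec ?E"])
    show "tangent_vec ?E \<in> tangent \<phi> f base_point" by (simp add: tangent_eq)
    have "(2 :: 2) \<noteq> 1" by simp
    then show "tangent_map \<phi> f base_point (\<lambda>v :: 'a ^ 2. \<chi> _. v $ 1) (tangent_vec ?E) = tangent_vec X \<and>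
      tangent_map \<phi> f base_point (\<lambda>v :: 'a ^ 2. \<chi> _. v $ 2) (tangent_vec ?E) = tangent_vec Y \<and>
      tangent_map \<phi> f base_point (\<lambda>v :: 'a ^ 2. \<chi> _. v $ 1 + v $ 2) (tangent_vec ?E) = tangent_vec (\<lambda>l. X l + Y l)"
      unfolding maps by (auto intro!: arg_cong[of _ _ tangent_vec] simp: fun_eq_iff all1)
  qed
  moreover have "Z = tangent_vec (\<lambda>l. X l + Y l)" if Z: "?P Z" for Z
  proof -
    obtain E :: "2 \<Rightarrow> 'a ^ 10 ^ 10" where E: "tangent_vec (\<lambda>_. E 1) = tangent_vec X" "tangent_vec (\<lambda>_. E 2) = tangent_vec Y" "tangent_vec (\<lambda>_. E 1 + E 2) = Z"
      using Z unfolding tangent_eq by (auto simp: maps)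
    have "(E 1 - X 1) + (E 2 - Y 1) \<in> trivial_directions"
      using E(1,2) by (intro trivial_directions_add) (auto simp: tangent_vec_eq_iff all1)
    then have "tangent_vec (\<lambda>_. E 1 + E 2) = tangent_vec (\<lambda>l. X l + Y l)"
      by (simp add: tangent_vec_eq_iff all1 algebra_simps)
    then show ?thesis using E(3) by simp
  qed
  ultimately show ?thesis
    unfolding tangent_add_def by (rule the_equality)
qed

lemma Aut_inverse:
  assumes "\<alpha> \<in> isoms base_point base_point" shows "inv\<^bsub>swapG\<^esub> \<alpha> \<in> isoms base_point base_point"
proof -
  interpret G: group "swapG :: 'a swapG monoid" by (rule swapG_group)
  have a: "\<alpha> \<in> carrier swapG" "swapG_act \<alpha> base_point = base_point" using assms by (simp_all only: isoms_iff)
  have i: "inv\<^bsub>swapG\<^esub> \<alpha> \<in> carrier swapG" using a by simp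
  have "swapG_act (inv\<^bsub>swapG\<^esub> \<alpha>) (swapG_act \<alpha> base_point) = swapG_act \<one>\<^bsub>swapG\<^esub> base_point"
    unfolding swapG_act_mult(1)[OF i a(1) base_point_in_GmodH, symmetric] using a by simp
  then show ?thesis using i swapG_act_mult(3)[OF i i base_point_in_GmodH] by (simp add: isoms_iff a(2))
qed

lemma Aut_mult:
  assumes "\<alpha> \<in> isoms base_point base_point" "\<beta> \<in> isoms base_point base_point" shows "\<alpha> \<otimes>\<^bsub>swapG\<^esub> \<beta> \<in> isoms base_point base_point"
proof -
  interpret G: group "swapG :: 'a swapG monoid" by (rule swapG_group)
  have a: "\<alpha> \<in> carrier swapG" "swapG_act \<alpha> base_point = base_point" using assms by (simp_all only: isoms_iff)
  have b: "\<beta> \<in> carrier swapG" "swapG_act \<beta> base_point = base_point" using assms by (simp_all only: isoms_iff)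
  show ?thesis
    using a b by (simp add: isoms_iff swapG_act_mult(1)[OF a(1) b(1) base_point_in_GmodH])
qed

lemma Aut_deform_iso:
  fixes t t' :: "('a, 'n::finite) sqz coset_pt \<times> ('a, 'n) sqz coset_pt"
  assumes \<alpha>: "\<alpha> \<in> isoms base_point base_point" and iso: "((t, \<gamma>), (t', \<gamma>')) \<in> deform_iso \<phi> f base_point"
  shows "((t, \<alpha> \<otimes>\<^bsub>swapG\<^esub> \<gamma>), (t', \<alpha> \<otimes>\<^bsub>swapG\<^esub> \<gamma>')) \<in> deform_iso \<phi> f base_point"
proof -
  interpret G: group "swapG :: 'a swapG monoid" by (rule swapG_group)
  have m: "(t, \<gamma>) \<in> deforms \<phi> f base_point" "(t', \<gamma>') \<in> deforms \<phi> f base_point"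
    and ex: "\<exists>\<delta>\<in>carrier swapG. swapG_act \<delta> t = t' \<and> \<gamma>' \<otimes>\<^bsub>swapG\<^esub> swapG_map sqz_base \<delta> = \<gamma>"
    using iso by (simp_all only: deform_iso_iff)
  obtain \<delta> where d: "\<delta> \<in> carrier swapG" "swapG_act \<delta> t = t'" "\<gamma>' \<otimes>\<^bsub>swapG\<^esub> swapG_map sqz_base \<delta> = \<gamma>"
    using ex by blast
  have c: "\<gamma>' \<in> carrier swapG" "\<alpha> \<in> carrier swapG"
    using m(2) \<alpha> by (simp_all only: deforms_iff isoms_iff)
  have "(\<alpha> \<otimes>\<^bsub>swapG\<^esub> \<gamma>') \<otimes>\<^bsub>swapG\<^esub> swapG_map sqz_base \<delta> = \<alpha> \<otimes>\<^bsub>swapG\<^esub> \<gamma>"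
    unfolding d(3)[symmetric] by (rule G.m_assoc[OF c(2,1) swapG_map_hom(2)[OF sqz_base_hom d(1) d(1)]])
  then show ?thesis
    unfolding deform_iso_iff using deform_aut[OF \<alpha> m(1)] deform_aut[OF \<alpha> m(2)] d(1,2) by blast
qed

text \<open>
  An automorphism either fixes the two cosets or exchanges them.
\<close>

lemma Aut_cases:
  assumes "\<alpha> \<in> isoms base_point base_point"
  obtains (fixing) a h1 h2 where "\<alpha> = (0, pclass a)" "invertible a" "a ** g1 = g1 ** h1" "a ** g2 = g2 ** h2"
      "h1 \<in> H_lift \<phi> f" "h2 \<in> H_lift \<phi> f"
    | (swap) a h1 h2 where "\<alpha> = (1, pclass a)" "invertible a" "a ** g1 = g2 ** h1" "a ** g2 = g1 ** h2"
      "h1 \<in> H_lift \<phi> f" "h2 \<in> H_lift \<phi> f"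
proof -
  have c: "\<alpha> \<in> carrier swapG" and s: "swapG_act \<alpha> base_point = base_point"
    using assms by (simp_all only: isoms_iff)
  obtain \<sigma> a where a: "\<alpha> = (\<sigma>, pclass a)" "\<sigma> = 0 \<or> \<sigma> = 1" "invertible a" using c by (rule swapG_cases)
  note act = swapG_act_coset_point[OF a(3) g1 g2, of \<sigma>]
  have move: "\<exists>h\<in>H_lift \<phi> f. a ** g = g' ** h"
    if "coset_point \<phi> f (a ** g) = coset_point \<phi> f g'" "invertible g" "invertible g'" for g g'
    using coset_point_eq_iff[OF that(3) invertible_mult[OF a(3) that(2)]] that(1) by simp
  show ?thesis
  proof (cases "\<sigma> = 0")
    case True
    then have "coset_point \<phi> f (a ** g1) = coset_point \<phi> f g1" "coset_point \<phi> f (a ** g2) = coset_point \<phi> f g2"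
      using s act by (simp_all add: a(1))
    then show ?thesis using move g1 g2 fixing a True by metis
  next
    case False
    then have "coset_point \<phi> f (a ** g1) = coset_point \<phi> f g2" "coset_point \<phi> f (a ** g2) = coset_point \<phi> f g1"
      using s act by (simp_all add: a(1))
    then show ?thesis using move g1 g2 swap a False by metis
  qed
qed

text \<open>
  Conjugation by any representative of the class in \<open>PGLn\<close>; the choice does not matter since
  scalars cancel (\<open>pclass_conj\<close>).  The sign for elements that swap the factors is explained by
  \<open>shifted_point_Aut\<close>.
\<close>

definition signed_conj :: "'a swapG \<Rightarrow> 'a ^ 10 ^ 10 \<Rightarrow> 'a ^ 10 ^ 10" where
  "signed_conj \<alpha> X = (let a = (SOME a. a \<in> snd \<alpha> \<and> invertible a) in
    if fst \<alpha> = 0 then a ** X ** matrix_inv a else - (a ** X ** matrix_inv a))"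

lemma pclass_conj:
  fixes a :: "'a ^ 'n ^ 'n"
  assumes "invertible a" "b \<in> pclass a" "invertible b"
  shows "b ** X ** matrix_inv b = a ** X ** matrix_inv a"
proof -
  obtain c where "c dvd 1" "b = mat c ** a" using assms(2) by (auto simp: pclass_eq)
  moreover then have "c \<noteq> 0" by auto
  ultimately show ?thesis using conj_scale assms(1) by simp
qed

lemma signed_conj_pclass:
  assumes "invertible a"
  shows "signed_conj (\<sigma>, pclass a) X = (if \<sigma> = 0 then a ** X ** matrix_inv a else - (a ** X ** matrix_inv a))"
proof -
  have "a \<in> pclass a" by (auto simp: pclass_eq intro!: exI[of _ 1])
  then have "\<exists>b. b \<in> pclass a \<and> invertible b" using assms by blast
  then have "(SOME b. b \<in> pclass a \<and> invertible b) \<in> pclass a \<and> invertible (SOME b. b \<in> pclass a \<and> invertible b)"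
    by (rule someI_ex)
  then show ?thesis using pclass_conj[OF assms] by (simp add: signed_conj_def Let_def)
qed

lemma signed_conj_linear:
  "signed_conj \<alpha> (X + Y) = signed_conj \<alpha> X + signed_conj \<alpha> Y" "signed_conj \<alpha> (mat c ** X) = mat c ** signed_conj \<alpha> X"
  by (simp_all add: signed_conj_def Let_def matrix_add_distrib conj_scaled uminus_as_scale)
    (simp_all add: matrix_mul_assoc mat_mult_mat)

text \<open>
  The constant lift of \<open>a\<close> maps \<open>((1 + eX) g\<^sub>1, g\<^sub>2)\<close> to a pair in which \<open>1 + e a X a\<^sup>-\<^sup>1\<close> occurs at the first
  coset, or at the second one if \<open>a\<close> swaps.  In the latter case one has to multiply by
  \<open>1 - e a X a\<^sup>-\<^sup>1\<close> to return to standard form, and this produces the sign.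
\<close>

lemma shifted_point_Aut:
  fixes X :: "'n::finite \<Rightarrow> 'a ^ 10 ^ 10"
  assumes "\<alpha> \<in> isoms base_point base_point"
  shows "((shifted_point X, \<alpha>), std_deform (\<lambda>l. signed_conj \<alpha> (X l))) \<in> deform_iso \<phi> f base_point"
proof -
  interpret G: group "swapG :: 'a swapG monoid" by (rule swapG_group)
  interpret R: ext2_base_change \<phi> "sqz_const \<circ> f :: 'k \<Rightarrow> ('a, 'n) sqz" by (rule sqz_base_change)
  have \<alpha>: "\<alpha> \<in> carrier swapG" using assms by (simp only: isoms_iff)
  have mem: "(shifted_point X, \<alpha>) \<in> deforms \<phi> f base_point"
    using deform_aut[OF assms, of "shifted_point X" "\<one>\<^bsub>swapG\<^esub>"] std_deform_in_deforms[of X] \<alpha> by (simp add: std_deform_def)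
  have absorb: "sqz_point (eps_mat Y ** const_mat (g ** h)) = sqz_point (eps_mat Y ** const_mat g)"
    if "invertible g" "h \<in> H_lift \<phi> f" for Y :: "'n \<Rightarrow> _" and g h
  proof -
    let ?P = "eps_mat Y ** const_mat g"
    have P: "invertible ?P" by (rule sqz_inv[OF that(1)])
    have h: "const_mat h \<in> H_lift \<phi> (sqz_const \<circ> f)" by (rule const_mat_H_lift[OF that(2)])
    have "sqz_point ?P = sqz_point (?P ** const_mat h)"
      unfolding R.coset_point_eq_iff[OF P invertible_mult[OF P R.H_lift_invertible[OF h]]] using h by blast
    then show ?thesis by (simp add: const_mat_mult matrix_mul_assoc)
  qed
  have move: "eps_mat V ** const_mat a ** (eps_mat X ** const_mat g) =
      eps_mat (\<lambda>l. V l + a ** X l ** matrix_inv a) ** const_mat (a ** g)"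
    "eps_mat V ** const_mat a ** const_mat g = eps_mat V ** const_mat (a ** g)"
    if "invertible a" for V X :: "'n \<Rightarrow> 'a ^ 10 ^ 10" and a g
    using const_eps_mat[OF that, of X]
    by (simp_all add: const_mat_mult eps_mat_mult[symmetric] matrix_mul_assoc)
      (simp add: matrix_mul_assoc[symmetric])
  have "\<exists>\<delta>\<in>carrier swapG. swapG_act \<delta> (shifted_point X) = shifted_point (\<lambda>l. signed_conj \<alpha> (X l)) \<and> swapG_map sqz_base \<delta> = \<alpha>"
    using assms
  proof (cases rule: Aut_cases)
    case (fixing a h1 h2)
    let ?\<delta> = "(0, pclass (eps_mat (\<lambda>_. 0) ** const_mat a)) :: ('a, 'n) sqz swapG"
    have "swapG_act ?\<delta> (shifted_point X) = shifted_point (\<lambda>l. signed_conj \<alpha> (X l))"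
      unfolding shifted_point_def fixing(1) signed_conj_pclass[OF fixing(2)]
      by (subst R.swapG_act_coset_point)
        (simp_all only: sqz_inv g1 g2 const_mat_invertible fixing(2) move fixing(3,4) absorb fixing(5,6) if_True refl,
         simp add: eps_mat_zero)
    moreover have "?\<delta> \<in> carrier swapG" "swapG_map sqz_base ?\<delta> = \<alpha>"
      by (auto simp: carrier_swapG sqz_inv fixing(1,2) swapG_map_pclass[OF sqz_base_hom] map_matrix_mult[OF sqz_base_hom])
    ultimately show ?thesis by blast
  next
    case (swap a h1 h2)
    let ?W = "\<lambda>l. a ** X l ** matrix_inv a"
    let ?\<delta> = "(1, pclass (eps_mat (\<lambda>l. - ?W l) ** const_mat a)) :: ('a, 'n) sqz swapG"
    have "swapG_act ?\<delta> (shifted_point X) = shifted_point (\<lambda>l. signed_conj \<alpha> (X l))"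
      unfolding shifted_point_def swap(1) signed_conj_pclass[OF swap(2)]
      by (subst R.swapG_act_coset_point)
        (simp_all only: sqz_inv g1 g2 const_mat_invertible swap(2) move swap(3,4) absorb swap(5,6),
         simp add: eps_mat_zero)
    moreover have "?\<delta> \<in> carrier swapG" "swapG_map sqz_base ?\<delta> = \<alpha>"
      by (auto simp: carrier_swapG sqz_inv swap(1,2) swapG_map_pclass[OF sqz_base_hom] map_matrix_mult[OF sqz_base_hom])
    ultimately show ?thesis by blast
  qed
  then obtain \<delta> where d: "\<delta> \<in> carrier swapG" "swapG_act \<delta> (shifted_point X) = shifted_point (\<lambda>l. signed_conj \<alpha> (X l))"
    "swapG_map sqz_base \<delta> = \<alpha>" by blast
  have "\<one>\<^bsub>swapG\<^esub> \<otimes>\<^bsub>swapG\<^esub> swapG_map sqz_base \<delta> = \<alpha>" using d(3) \<alpha> by simp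
  then show ?thesis
    using mem std_deform_in_deforms[of "\<lambda>l. signed_conj \<alpha> (X l)"] d(1,2) unfolding std_deform_def deform_iso_iff by blast
qed

text \<open>
  The image of a class under \<open>(t, \<gamma>) \<mapsto> (t, \<alpha>\<gamma>)\<close> is again a full class because the inverse of
  \<open>\<alpha>\<close> maps it back.
\<close>

lemma tangent_rep_tangent_vec:
  assumes \<alpha>: "\<alpha> \<in> isoms base_point base_point"
  shows "tangent_rep \<phi> f base_point \<alpha> (tangent_vec X) = tangent_vec (\<lambda>l. signed_conj \<alpha> (X l))"
proof -
  interpret G: group "swapG :: 'a swapG monoid" by (rule swapG_group)
  have c: "\<alpha> \<in> carrier swapG" using \<alpha> by (simp only: isoms_iff)
  let ?m = "\<lambda>(t, \<gamma>). (t, \<alpha> \<otimes>\<^bsub>swapG\<^esub> \<gamma>)"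
  have "?m ` tangent_vec X = deform_iso \<phi> f base_point `` {(shifted_point X, \<alpha>)}"
  proof (rule subset_antisym; rule subsetI)
    fix e assume "e \<in> ?m ` tangent_vec X"
    then obtain t \<gamma> where e: "e = (t, \<alpha> \<otimes>\<^bsub>swapG\<^esub> \<gamma>)" "(std_deform X, (t, \<gamma>)) \<in> deform_iso \<phi> f base_point"
      by (auto simp: tangent_vec_def)
    then show "e \<in> deform_iso \<phi> f base_point `` {(shifted_point X, \<alpha>)}"
      using Aut_deform_iso[OF \<alpha>, of "shifted_point X" "\<one>\<^bsub>swapG\<^esub>" t \<gamma>] c by (simp add: std_deform_def)
  next
    fix e assume e: "e \<in> deform_iso \<phi> f base_point `` {(shifted_point X, \<alpha>)}"
    obtain t \<gamma> where tg: "e = (t, \<gamma>)" by (cases e)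
    have iso: "((shifted_point X, \<alpha>), (t, \<gamma>)) \<in> deform_iso \<phi> f base_point" using e by (simp add: tg)
    then have "(t, \<gamma>) \<in> deforms \<phi> f base_point" by (simp only: deform_iso_iff)
    then have g: "\<gamma> \<in> carrier swapG" by (simp only: deforms_iff)
    have "(std_deform X, (t, inv\<^bsub>swapG\<^esub> \<alpha> \<otimes>\<^bsub>swapG\<^esub> \<gamma>)) \<in> deform_iso \<phi> f base_point"
      using Aut_deform_iso[OF Aut_inverse[OF \<alpha>] iso] c by (simp add: std_deform_def)
    then have "(t, inv\<^bsub>swapG\<^esub> \<alpha> \<otimes>\<^bsub>swapG\<^esub> \<gamma>) \<in> tangent_vec X" by (simp add: tangent_vec_def)
    moreover have "e = ?m (t, inv\<^bsub>swapG\<^esub> \<alpha> \<otimes>\<^bsub>swapG\<^esub> \<gamma>)"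
      using c g by (simp add: tg G.m_assoc[symmetric])
    ultimately show "e \<in> ?m ` tangent_vec X" by (rule rev_image_eqI)
  qed
  also have "\<dots> = tangent_vec (\<lambda>l. signed_conj \<alpha> (X l))"
  proof (rule tangent_vec_eqI)
    show "(std_deform (\<lambda>l. signed_conj \<alpha> (X l)), (shifted_point X, \<alpha>)) \<in> deform_iso \<phi> f base_point"
      using shifted_point_Aut[OF \<alpha>, of X] equiv_deform_iso by (meson equivE symE)
  qed
  finally show ?thesis by (simp add: tangent_rep_def tangent_eq)
qed

lemma tangent_rep_mult:
  assumes "\<alpha> \<in> isoms base_point base_point" "\<beta> \<in> isoms base_point base_point" "x \<in> tangent \<phi> f base_point"
  shows "tangent_rep \<phi> f base_point (\<alpha> \<otimes>\<^bsub>swapG\<^esub> \<beta>) x = tangent_rep \<phi> f base_point \<alpha> (tangent_rep \<phi> f base_point \<beta> x)"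
    "tangent_rep \<phi> f base_point \<alpha> x \<in> tangent \<phi> f base_point" "tangent_rep \<phi> f base_point \<one>\<^bsub>swapG\<^esub> x = x"
proof -
  interpret G: group "swapG :: 'a swapG monoid" by (rule swapG_group)
  obtain X where x: "x = tangent_vec X" using assms(3) by (auto simp: tangent_eq)
  show mem: "tangent_rep \<phi> f base_point \<alpha> x \<in> tangent \<phi> f base_point"
    by (simp add: x tangent_rep_tangent_vec[OF assms(1)] tangent_eq)
  have mem': "tangent_rep \<phi> f base_point \<beta> x \<in> tangent \<phi> f base_point"
    by (simp add: x tangent_rep_tangent_vec[OF assms(2)] tangent_eq)
  have c: "\<alpha> \<in> carrier swapG" "\<beta> \<in> carrier swapG" using assms(1,2) by (simp_all only: isoms_iff)
  have g: "\<gamma> \<in> carrier swapG" if "(t, \<gamma>) \<in> x" for t \<gamma>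
  proof -
    have "(t, \<gamma>) \<in> deforms \<phi> f base_point" using that unfolding x tangent_vec_def std_deform_def by (auto simp: deform_iso_iff)
    then show ?thesis by (simp only: deforms_iff)
  qed
  show "tangent_rep \<phi> f base_point (\<alpha> \<otimes>\<^bsub>swapG\<^esub> \<beta>) x = tangent_rep \<phi> f base_point \<alpha> (tangent_rep \<phi> f base_point \<beta> x)"
  proof -
    have "tangent_rep \<phi> f base_point \<alpha> (tangent_rep \<phi> f base_point \<beta> x) =
        (\<lambda>(t, \<gamma>). (t, \<alpha> \<otimes>\<^bsub>swapG\<^esub> \<gamma>)) ` (\<lambda>(t, \<gamma>). (t, \<beta> \<otimes>\<^bsub>swapG\<^esub> \<gamma>)) ` x"
      using mem' assms(3) by (simp add: tangent_rep_def)
    also have "\<dots> = (\<lambda>(t, \<gamma>). (t, \<alpha> \<otimes>\<^bsub>swapG\<^esub> \<beta> \<otimes>\<^bsub>swapG\<^esub> \<gamma>)) ` x"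
      unfolding image_image using c g by (intro image_cong refl) (auto simp: G.m_assoc)
    finally show ?thesis using assms(3) by (simp add: tangent_rep_def)
  qed
  have "(\<lambda>(t, \<gamma>). (t, \<one>\<^bsub>swapG\<^esub> \<otimes>\<^bsub>swapG\<^esub> \<gamma>)) ` x = (\<lambda>d. d) ` x"
    using g by (intro image_cong refl) auto
  then show "tangent_rep \<phi> f base_point \<one>\<^bsub>swapG\<^esub> x = x"
    using assms(3) by (simp add: tangent_rep_def)
qed

text \<open>
  In coordinates the action is the linear map \<open>signed_conj\<close>, and the inverse automorphism gives the
  inverse map.
\<close>

lemma tangent_rep_GL:
  assumes \<alpha>: "\<alpha> \<in> isoms base_point base_point"
  shows "tangent_rep \<phi> f base_point \<alpha> \<in> carrier (GL_tangent \<phi> f base_point)"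
proof -
  interpret G: group "swapG :: 'a swapG monoid" by (rule swapG_group)
  let ?T = "tangent \<phi> f base_point" and ?r = "tangent_rep \<phi> f base_point"
  note \<alpha>' = Aut_inverse[OF \<alpha>]
  have c: "\<alpha> \<in> carrier swapG" using \<alpha> by (simp only: isoms_iff)
  have "bij_betw (?r \<alpha>) ?T ?T"
  proof (rule bij_betw_byWitness[where f' = "?r (inv\<^bsub>swapG\<^esub> \<alpha>)"])
    show "\<forall>x\<in>?T. ?r (inv\<^bsub>swapG\<^esub> \<alpha>) (?r \<alpha> x) = x"
      using tangent_rep_mult(1)[OF \<alpha>' \<alpha>] tangent_rep_mult(3)[OF \<alpha> \<alpha>] c by simp
    show "\<forall>x\<in>?T. ?r \<alpha> (?r (inv\<^bsub>swapG\<^esub> \<alpha>) x) = x"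
      using tangent_rep_mult(1)[OF \<alpha> \<alpha>'] tangent_rep_mult(3)[OF \<alpha> \<alpha>] c by simp
    show "?r \<alpha> ` ?T \<subseteq> ?T" "?r (inv\<^bsub>swapG\<^esub> \<alpha>) ` ?T \<subseteq> ?T"
      using tangent_rep_mult(2)[OF \<alpha> \<alpha>] tangent_rep_mult(2)[OF \<alpha>' \<alpha>] by auto
  qed
  moreover have "?r \<alpha> \<in> extensional ?T" by (simp add: tangent_rep_def)
  ultimately show ?thesis
    by (auto simp: GL_tangent_def Bij_def tangent_eq tangent_add_tangent_vec tangent_smult_tangent_vec tangent_rep_tangent_vec[OF \<alpha>] signed_conj_linear)
qed

lemma tangent_rep_hom: "tangent_rep \<phi> f base_point \<in> hom (Aut_grp base_point) (GL_tangent \<phi> f base_point)"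
proof (rule homI)
  fix \<alpha> assume "\<alpha> \<in> carrier (Aut_grp base_point)"
  then show "tangent_rep \<phi> f base_point \<alpha> \<in> carrier (GL_tangent \<phi> f base_point)"
    by (simp add: Aut_grp_def tangent_rep_GL)
next
  fix \<alpha> \<beta> assume "\<alpha> \<in> carrier (Aut_grp base_point)" "\<beta> \<in> carrier (Aut_grp base_point)"
  then have a: "\<alpha> \<in> isoms base_point base_point" "\<beta> \<in> isoms base_point base_point" by (simp_all add: Aut_grp_def)
  let ?r = "tangent_rep \<phi> f base_point" and ?T = "tangent \<phi> f base_point :: ('a, 1) deform set set"
  have Bij: "?r \<alpha> \<in> Bij ?T" "?r \<beta> \<in> Bij ?T"
    using tangent_rep_GL[OF a(1)] tangent_rep_GL[OF a(2)] by (simp_all add: GL_tangent_def)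
  have "?r (\<alpha> \<otimes>\<^bsub>swapG\<^esub> \<beta>) = compose ?T (?r \<alpha>) (?r \<beta>)"
  proof (rule extensionalityI[of _ ?T])
    fix x assume "x \<in> ?T"
    then show "?r (\<alpha> \<otimes>\<^bsub>swapG\<^esub> \<beta>) x = compose ?T (?r \<alpha>) (?r \<beta>) x"
      by (simp add: compose_eq tangent_rep_mult(1)[OF a])
  qed (simp_all add: tangent_rep_def compose_extensional)
  then show "?r (\<alpha> \<otimes>\<^bsub>Aut_grp base_point\<^esub> \<beta>) = ?r \<alpha> \<otimes>\<^bsub>GL_tangent \<phi> f base_point\<^esub> ?r \<beta>"
    using Bij by (simp add: Aut_grp_def GL_tangent_def BijGroup_def)
qed

lemma trivial_rep_directions:
  assumes "\<alpha> \<in> isoms base_point base_point" "\<And>x. x \<in> tangent \<phi> f base_point \<Longrightarrow> tangent_rep \<phi> f base_point \<alpha> x = x"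
  shows "signed_conj \<alpha> X - X \<in> trivial_directions"
proof -
  have "tangent_vec (\<lambda>_ :: 1. signed_conj \<alpha> X) = tangent_vec (\<lambda>_. X)"
    using assms(2)[of "tangent_vec (\<lambda>_. X)"] tangent_rep_tangent_vec[OF assms(1), of "\<lambda>_. X"] by (simp add: tangent_eq)
  then show ?thesis by (simp add: tangent_vec_eq_iff)
qed

end

section \<open>Faithfulness\<close>

text \<open>
  Triviality of the action is the hypothesis of \<open>trivial_action_scalar\<close> or of
  \<open>swap_acts_nontrivially\<close>, respectively.
\<close>

lemma faithful_at_point:
  fixes f :: "'k::field \<Rightarrow> 'a::{alg_closed_field, field_char_0}"
  assumes "gpk_point \<phi> f g1 g2"
  defines "s \<equiv> (coset_point \<phi> f g1, coset_point \<phi> f g2)"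
  assumes \<alpha>: "\<alpha> \<in> isoms s s" and triv: "\<And>x. x \<in> tangent \<phi> f s \<Longrightarrow> tangent_rep \<phi> f s \<alpha> x = x"
  shows "\<alpha> = \<one>\<^bsub>swapG\<^esub>"
proof -
  interpret gpk_point \<phi> f g1 g2 by fact
  note dirs = trivial_rep_directions[OF \<alpha>[unfolded s_def] triv[unfolded s_def]]
  from \<alpha>[unfolded s_def] show ?thesis
  proof (cases rule: Aut_cases)
    case (fixing a h1 h2)
    have "\<exists>c. c \<noteq> 0 \<and> a = mat c"
    proof (rule trivial_action_scalar[OF fixing(2) g1 g2 fixing(3,5)])
      show "\<exists>Y\<in>stab_alg \<phi> f g1. \<exists>Y'\<in>stab_alg \<phi> f g2. a ** X ** matrix_inv a - X = Y + Y'" for X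
        using dirs[of X] by (auto simp: fixing(1) signed_conj_pclass[OF fixing(2)] trivial_directions_def)
    qed
    then obtain c where "c \<noteq> 0" "a = mat c ** mat 1" by auto
    then have "pclass (mat 1) = pclass a" using pclass_eq_iff[of "mat 1" a] by (auto simp: dvd_field_iff)
    then show ?thesis by (simp add: fixing(1) one_swapG)
  next
    case (swap a h1 h2)
    have "\<exists>Y\<in>stab_alg \<phi> f g1. \<exists>Y'\<in>stab_alg \<phi> f g2. - (a ** X ** matrix_inv a) - X = Y + Y'" for X
      using dirs[of X] by (auto simp: swap(1) signed_conj_pclass[OF swap(2)] trivial_directions_def)
    then have False
      by (rule swap_acts_nontrivially[OF ext2_base_change_axioms swap(2) g1 g2 swap(3-6)])
    then show ?thesis ..
  qed
qed

theorem theorem1p8: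
  fixes \<phi> :: "'k::{alg_closed_field, field_char_0} ^ 5 ^ 5 \<Rightarrow> 'k ^ 10"
    and \<iota> :: "'k \<Rightarrow> 'K::{alg_closed_field, field_char_0}"
    and s :: "'K coset_pt \<times> 'K coset_pt"
  assumes "ext2_iso \<phi>"
    and "is_ring_hom \<iota>"
    and "s \<in> U_pts \<phi> \<iota>"
  shows "tangent_rep \<phi> \<iota> s \<in> hom (Aut_grp s) (GL_tangent \<phi> \<iota> s) \<and>
    inj_on (tangent_rep \<phi> \<iota> s) (carrier (Aut_grp s))"
proof -
  obtain g1 g2 where g: "invertible g1" "invertible g2" and s: "s = (coset_point \<phi> \<iota> g1, coset_point \<phi> \<iota> g2)"
    using assms(3) by (auto simp: U_pts_def carrier_PGLn coset_point_def)
  have loc: "gpk_point \<phi> \<iota> g1 g2"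
    by unfold_locales (use assms g s in simp_all)
  interpret gpk_point \<phi> \<iota> g1 g2 by (rule loc)
  interpret G: group "swapG :: 'K swapG monoid" by (rule swapG_group)
  let ?r = "tangent_rep \<phi> \<iota> base_point"
  have "inj_on ?r (carrier (Aut_grp base_point))"
  proof (rule inj_onI)
    fix \<alpha> \<beta> assume "\<alpha> \<in> carrier (Aut_grp base_point)" "\<beta> \<in> carrier (Aut_grp base_point)" and eq: "?r \<alpha> = ?r \<beta>"
    then have a: "\<alpha> \<in> isoms base_point base_point" "\<beta> \<in> isoms base_point base_point" by (simp_all add: Aut_grp_def)
    then have c: "\<alpha> \<in> carrier swapG" "\<beta> \<in> carrier swapG" by (simp_all only: isoms_iff)
    have b: "inv\<^bsub>swapG\<^esub> \<beta> \<in> isoms base_point base_point" by (rule Aut_inverse[OF a(2)])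
    have "?r (inv\<^bsub>swapG\<^esub> \<beta> \<otimes>\<^bsub>swapG\<^esub> \<alpha>) x = x" if "x \<in> tangent \<phi> \<iota> base_point" for x
    proof -
      have "?r (inv\<^bsub>swapG\<^esub> \<beta> \<otimes>\<^bsub>swapG\<^esub> \<alpha>) x = ?r (inv\<^bsub>swapG\<^esub> \<beta> \<otimes>\<^bsub>swapG\<^esub> \<beta>) x"
        by (simp only: tangent_rep_mult(1)[OF b a(1) that] tangent_rep_mult(1)[OF b a(2) that] eq)
      then show ?thesis using tangent_rep_mult(3)[OF a that] c by simp
    qed
    then have "inv\<^bsub>swapG\<^esub> \<beta> \<otimes>\<^bsub>swapG\<^esub> \<alpha> = \<one>\<^bsub>swapG\<^esub>"
      by (intro faithful_at_point[OF loc] Aut_mult b a)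
    then show "\<alpha> = \<beta>" using c by (metis G.inv_closed G.inv_inv G.inv_equality G.inv_unique')
  qed
  then show ?thesis unfolding s using tangent_rep_hom by simp
qed

end
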